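(* The following evaluations hold: $$V(-e^{-\pi\sqrt5})=\frac{(3-\sqrt5)(\sqrt3-\sqrt5)}{4},\qquad V(-e^{-\pi/\sqrt5})=\frac{(\sqrt3+\sqrt5)(\sqrt5-3)}{4},$$ $$V(-e^{-\pi/\sqrt3})=-\frac{1}{\sqrt[3]4},\qquad V(-e^{-\pi\sqrt3})=\frac{1-\sqrt[3]4}{2+\sqrt[3]4},$$ $$V(-e^{-\pi/(3\sqrt3)})=-\frac{1}{\sqrt[3]{\tfrac13(\sqrt[3]4-1)^4+1}},\qquad V(-e^{-\pi})=\frac{1-\sqrt3}{2},\qquad V(-e^{-\pi/3})=-\frac{1}{\sqrt[3]{2(\sqrt3-1)}}.$$
   Context: Ramanujan's cubic continued fraction is $$V(q)=\cfrac{q^{1/3}}{1+\cfrac{q+q^2}{1+\cfrac{q^2+q^4}{1+\cdots}}},\qquad |q|<1,$$ the $n$-th partial numerator after the first being $q^n+q^{2n}$; for real $q$ (including negative $q$), $q^{1/3}$ denotes the real cube root of $q$. Cube roots of positive numbers in the claim are positive real roots. *)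

theory Defs
  imports Complex_Main
begin

text \<open>Truncated tail of Ramanujan's cubic continued fraction:
  cf_tail q n m = 1 + a_m/(1 + a_(m+1)/( ... /(1 + a_(m+n-1)/1))), with a_k = q^k + q^(2k).\<close>
fun cf_tail :: "real \<Rightarrow> nat \<Rightarrow> nat \<Rightarrow> real" where
  "cf_tail q 0 m = 1"
| "cf_tail q (Suc n) m = 1 + (q ^ m + q ^ (2 * m)) / cf_tail q n (Suc m)"

text \<open>n-th convergent of V(q) = q^(1/3)/(1 + (q+q^2)/(1 + (q^2+q^4)/(1 + ...))),
  with the real cube root of q (root 3 is the real cube root, also for negative q).\<close>
definition V_conv :: "real \<Rightarrow> nat \<Rightarrow> real" where
  "V_conv q n = root 3 q / cf_tail q n 1"

definition V :: "real \<Rightarrow> real" where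
  "V q = lim (V_conv q)"

end

theory Submission
  imports Defs "HOL-Analysis.Analysis"
begin

text \<open>Put \<open>\<phi>(x) = \<Sum>\<^sub>n x^(n^2)\<close>, \<open>S(x) = \<Sum>\<^sub>n x^(3n^2+2n)\<close> (sums over the integers) and \<open>\<chi>(x) = (-x;x^2)\<close>.
  The tails of the continued fraction are quotients of consecutive terms of a sequence of
  Rogers-Ramanujan type series; a Bailey pair turns the first two of these series into theta
  series, so that \<open>V(-x) = -x^(1/3) S(x) / \<phi>(x^3)\<close>. Splitting \<open>\<phi>\<close> modulo 3 gives
  \<open>1 - 2 V(-x^3) = \<phi>(x) / \<phi>(x^9)\<close>, and multiplying the three versions of this with \<open>x\<close> replaced by
  \<open>\<omega>^k x\<close> gives \<open>1 - 8 V(-x)^3 = \<phi>(x)^4 / \<phi>(x^3)^4\<close>. Together with the inversion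
  \<open>\<phi>(e^(-\<pi>t)) = t^(-1/2) \<phi>(e^(-\<pi>/t))\<close> these relations determine the values at
  \<open>e^(-\<pi>)\<close>, \<open>e^(-\<pi>/3)\<close>, \<open>e^(-\<pi>/\<surd>3)\<close>, \<open>e^(-\<pi>\<surd>3)\<close> and \<open>e^(-\<pi>/(3\<surd>3))\<close>.
  For \<open>\<surd>5\<close> one more relation is needed: the Gaussian integers split into five cosets of the ideal
  generated by \<open>2 + i\<close>, whence \<open>\<phi>(x)^2 / \<phi>(x^5)^2 = 1 + 4x \<chi>(x) / \<chi>(x^5)^5\<close>. Used at the two nomes
  \<open>e^(-\<pi>/\<surd>5)\<close> and \<open>e^(-3\<pi>/\<surd>5)\<close> together with \<open>V(-x) = -x^(1/3) \<chi>(x) / \<chi>(x^3)^3\<close>, all values of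
  \<open>\<chi>\<close> cancel and a polynomial equation over \<open>\<rat>(\<surd>5)\<close> remains.\<close>

section \<open>Dominated convergence and q-Pochhammer products\<close>

text \<open>The fraction is evaluated at negative q, where the partial numerators of odd index are
  negative, so positivity gives no convergence. What saves it is t + t^2 >= -1/4, Worpitzky's
  constant: the lower bound 1/2 is then preserved both by the truncated tails and by the ratios that
  are to be their limits. The Bailey transform leaves a factor depending on q that is never
  computed: it is nonzero and cancels in the quotient. Only the multiplication by cube roots of
  unity leaves the reals; for its sake the theta functions are defined over an arbitrary Banach
  field. Inversion follows Polya's elementary route: even powers of the cosine, summed over l
  equally spaced angles, give a finite identity between cosines and binomial coefficients, and both
  sides become theta series when l grows and m is about s l^2. For sqrt 5 the final equation has
  degree seven and splits into a quadratic and a quintic factor. Algebra cannot choose the root;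
  explicit numerical bounds do.\<close>

lemma infsum_dominated_convergence:
  fixes a :: "'i \<Rightarrow> 'b \<Rightarrow> 'a :: banach"
  assumes lim: "\<And>k. ((\<lambda>n. a k n) \<longlongrightarrow> b k) F"
    and bound: "eventually (\<lambda>n. \<forall>k. norm (a k n) \<le> M k) F"
    and M: "M summable_on UNIV"
    and nt: "F \<noteq> bot"
  shows "((\<lambda>n. \<Sum>\<^sub>\<infinity>k. a k n) \<longlongrightarrow> (\<Sum>\<^sub>\<infinity>k. b k)) F"
\<comment> \<open>By the Weierstrass M-test the finite partial sums converge uniformly in
  \<open>n\<close>, which permits exchanging the limit over finite index sets with the limit along
  \<open>F\<close>.\<close>
proof (rule swap_uniform_limit')
  let ?Y = "{n. \<forall>k. norm (a k n) \<le> M k}"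
  show "\<forall>\<^sub>F X in finite_subsets_at_top UNIV. ((\<lambda>n. \<Sum>k\<in>X. a k n) \<longlongrightarrow> (\<Sum>k\<in>X. b k)) F"
    by (intro always_eventually allI tendsto_sum lim)
  show "uniform_limit ?Y (\<lambda>X n. \<Sum>k\<in>X. a k n) (\<lambda>n. \<Sum>\<^sub>\<infinity>k. a k n) (finite_subsets_at_top UNIV)"
    by (rule Weierstrass_m_test_general[OF _ M]) auto
  show "\<forall>\<^sub>F n in F. n \<in> ?Y" using bound by simp
  have "norm (b k) \<le> M k" for k
    by (rule tendsto_upperbound[OF tendsto_norm[OF lim] _ nt], rule eventually_mono[OF bound]) auto
  hence "(\<lambda>k. norm (b k)) summable_on UNIV"
    by (intro Infinite_Sum.abs_summable_on_comparison_test'[OF M])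
  hence "b summable_on UNIV" by (rule abs_summable_summable)
  thus "((\<lambda>X. \<Sum>k\<in>X. b k) \<longlongrightarrow> (\<Sum>\<^sub>\<infinity>k. b k)) (finite_subsets_at_top UNIV)"
    using has_sum_infsum has_sum_def by blast
qed auto

section \<open>Two-sided series with quadratic exponents\<close>

lemma summable_on_int_split:
  fixes f :: "int \<Rightarrow> real"
  assumes nn: "\<And>r. f r \<ge> 0" and "summable (\<lambda>n. f (int n))" "summable (\<lambda>n. f (- int n))"
  shows "f summable_on UNIV"
proof -
  have "(\<lambda>n. f (int n)) summable_on UNIV" "(\<lambda>n. f (- int n)) summable_on UNIV"
    using assms by (auto intro!: summable_nonneg_imp_summable_on)
  hence "f summable_on range int" "f summable_on range (\<lambda>n. - int n)"
    by (subst summable_on_reindex; auto simp: o_def inj_on_def)+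
  hence "f summable_on (range int \<union> range (\<lambda>n. - int n))"
    by (rule summable_on_union)
  moreover have "range int \<union> range (\<lambda>n. - int n) = UNIV"
  proof -
    have "x \<in> range int \<or> x \<in> range (\<lambda>n. - int n)" for x :: int
      by (cases x rule: int_cases2) auto
    thus ?thesis by blast
  qed
  ultimately show ?thesis by simp
qed

text \<open>\<open>w\<close> may be large: \<open>w * x ^ n\<close> still drops below
  \<open>1/2\<close>, and the n-th term is the n-th power of that number.\<close>

lemma summable_power_square:
  fixes x w :: real
  assumes "0 \<le> x" "x < 1" "0 \<le> w"
  shows "summable (\<lambda>n. w ^ n * x ^ (n * n))"
proof -
  have "(\<lambda>n. w * x ^ n) \<longlonglongrightarrow> w * 0"
    using assms by (intro tendsto_intros LIMSEQ_realpow_zero) auto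
  hence "eventually (\<lambda>n. w * x ^ n < 1/2) sequentially"
    by (rule order_tendstoD) auto
  hence "eventually (\<lambda>n. norm (w ^ n * x ^ (n * n)) \<le> (1/2) ^ n) sequentially"
  proof eventually_elim
    case (elim n)
    have "(w * x ^ n) ^ n \<le> (1/2) ^ n"
      using elim assms by (intro power_mono) auto
    thus ?case using assms by (simp add: power_mult_distrib power_mult)
  qed
  thus ?thesis by (rule summable_comparison_test_ev) (simp add: summable_geometric)
qed

lemma summable_on_powi_square:
  fixes x w :: real
  assumes "0 < x" "x < 1" "0 < w"
  shows "(\<lambda>r::int. w powi r * x powi (r * r)) summable_on UNIV"
proof (rule summable_on_int_split)
  have e: "x powi (int n * int n) = x ^ (n * n)" for n
    by (metis of_nat_mult power_int_of_nat)
  show "summable (\<lambda>n. w powi int n * x powi (int n * int n))"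
    using assms by (simp add: e summable_power_square)
  have "w powi (- int n) = (1 / w) ^ n" for n
    by (simp add: power_int_minus power_one_over inverse_eq_divide)
  thus "summable (\<lambda>n. w powi - int n * x powi (- int n * - int n))"
    using assms by (simp add: e summable_power_square)
qed (use assms in auto)

text \<open>The q-Pochhammer symbol (a; q) with infinitely many factors.\<close>

definition qpoch :: "'a :: {real_normed_field, banach} \<Rightarrow> 'a \<Rightarrow> 'a" where
  "qpoch a q = (\<Prod>i. 1 - a * q ^ i)"

lemma convergent_prod_qpoch:
  fixes a q :: "'a :: {real_normed_field, banach}"
  assumes "norm q < 1"
  shows "convergent_prod (\<lambda>i. 1 - a * q ^ i)"
proof (rule abs_convergent_prod_imp_convergent_prod)
  have "summable (\<lambda>i. norm a * norm q ^ i)"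
    using assms by (intro summable_mult summable_geometric) auto
  hence "summable (\<lambda>i. norm ((1 - a * q ^ i) - 1))"
    by (simp add: norm_mult norm_power)
  thus "abs_convergent_prod (\<lambda>i. 1 - a * q ^ i)"
    by (rule summable_imp_abs_convergent_prod)
qed

lemma qpoch_tendsto:
  fixes a q :: "'a :: {real_normed_field, banach}"
  assumes "norm q < 1"
  shows "(\<lambda>n. \<Prod>i<n. 1 - a * q ^ i) \<longlonglongrightarrow> qpoch a q"
proof -
  have "(\<lambda>n. \<Prod>i\<le>n. 1 - a * q ^ i) \<longlonglongrightarrow> qpoch a q"
    unfolding qpoch_def by (rule convergent_prod_LIMSEQ[OF convergent_prod_qpoch[OF assms]])
  hence "(\<lambda>n. \<Prod>i<Suc n. 1 - a * q ^ i) \<longlonglongrightarrow> qpoch a q"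
    by (simp add: lessThan_Suc_atMost)
  thus ?thesis by (rule LIMSEQ_imp_Suc)
qed

lemma qpoch_nonzero:
  fixes a q :: "'a :: {real_normed_field, banach}"
  assumes "norm q < 1" "norm a < 1"
  shows "qpoch a q \<noteq> 0"
  unfolding qpoch_def
proof (rule prodinf_nonzero[OF convergent_prod_qpoch[OF assms(1)]])
  fix i
  have "norm (a * q ^ i) < 1"
  proof -
    have "norm a * norm q ^ i \<le> norm a * 1"
      using assms by (intro mult_left_mono power_le_one) auto
    thus ?thesis using assms by (simp add: norm_mult norm_power)
  qed
  thus "1 - a * q ^ i \<noteq> 0" by auto
qed

text \<open>The factors are sorted by the residue of their exponent modulo \<open>m\<close>; each
  class is a product of the same kind with base \<open>q ^ m\<close>.\<close>

lemma qpoch_split: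
  fixes a q :: "'a :: {real_normed_field, banach}"
  assumes "norm q < 1" "0 < m"
  shows "qpoch a q = (\<Prod>j<m. qpoch (a * q ^ j) (q ^ m))"
proof (rule LIMSEQ_unique)
  have "filterlim (\<lambda>n. n * m) sequentially sequentially"
    by (rule filterlim_subseq) (use assms in \<open>auto simp: strict_mono_def\<close>)
  from filterlim_compose[OF qpoch_tendsto[OF assms(1)] this]
  show "(\<lambda>n. \<Prod>i<n*m. 1 - a * q ^ i) \<longlonglongrightarrow> qpoch a q" .
  have qm: "norm (q ^ m) < 1"
    using assms by (simp add: norm_power power_less_one_iff)
  have "(\<Prod>j<m. \<Prod>i<n. 1 - a * q ^ j * (q ^ m) ^ i) = (\<Prod>i<n*m. 1 - a * q ^ i)" for n
  proof -
    have "(\<Prod>i<n*m. 1 - a * q ^ i) = (\<Prod>k<n. \<Prod>i = k*m..<k*m+m. 1 - a * q ^ i)"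
      by (rule prod.nat_group[symmetric])
    also have "\<dots> = (\<Prod>k<n. \<Prod>j<m. 1 - a * q ^ j * (q ^ m) ^ k)"
    proof (rule prod.cong[OF refl])
      fix k
      have "(\<Prod>i = k*m..<k*m+m. 1 - a * q ^ i) = (\<Prod>j = 0..<m. 1 - a * q ^ (j + k*m))"
        using prod.shift_bounds_nat_ivl[of "\<lambda>i. 1 - a * q ^ i" 0 "k*m" m] by (simp add: add.commute)
      thus "(\<Prod>i = k*m..<k*m+m. 1 - a * q ^ i) = (\<Prod>j<m. 1 - a * q ^ j * (q ^ m) ^ k)"
        by (simp add: power_add power_mult[symmetric] atLeast0LessThan mult_ac)
    qed
    finally show ?thesis by (subst prod.swap) simp
  qed
  moreover have "(\<lambda>n. \<Prod>j<m. \<Prod>i<n. 1 - a * q ^ j * (q ^ m) ^ i) \<longlonglongrightarrow> (\<Prod>j<m. qpoch (a * q ^ j) (q ^ m))"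
    by (intro tendsto_prod qpoch_tendsto qm)
  ultimately show "(\<lambda>n. \<Prod>i<n*m. 1 - a * q ^ i) \<longlonglongrightarrow> (\<Prod>j<m. qpoch (a * q ^ j) (q ^ m))"
    by simp
qed

definition qfac :: "'a :: comm_ring_1 \<Rightarrow> nat \<Rightarrow> 'a" where
  "qfac Q n = (\<Prod>i<n. 1 - Q ^ Suc i)"

text \<open>The value 0 at negative \<open>k\<close> lets terminating sums run over all integers,
  and it keeps \<open>rqfac_diff_one\<close> valid everywhere: at \<open>k = 0\<close> the factor
  \<open>1 - Q powi 0\<close> vanishes as well.\<close>

definition rqfac :: "'a :: field \<Rightarrow> int \<Rightarrow> 'a" where
  "rqfac Q k = (if k < 0 then 0 else inverse (qfac Q (nat k)))"

lemma one_minus_power_nonzero: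
  fixes Q :: "'a :: real_normed_field"
  assumes "norm Q < 1" "k > 0"
  shows "1 - Q ^ k \<noteq> 0"
proof -
  have "norm (Q ^ k) < 1"
    using assms by (simp add: norm_power power_less_one_iff)
  thus ?thesis by auto
qed

lemma qfac_nonzero:
  fixes Q :: "'a :: real_normed_field"
  assumes "norm Q < 1"
  shows "qfac Q n \<noteq> 0"
  unfolding qfac_def using one_minus_power_nonzero[OF assms] by (simp del: power_Suc add: prod_zero_iff)

lemma qfac_0 [simp]: "qfac Q 0 = 1"
  by (simp add: qfac_def)

lemma qfac_Suc: "qfac Q (Suc n) = qfac Q n * (1 - Q ^ Suc n)"
  by (simp add: qfac_def)

lemma rqfac_neg [simp]: "k < 0 \<Longrightarrow> rqfac Q k = 0"
  by (simp add: rqfac_def)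

lemma rqfac_of_nat: "rqfac Q (int n) = inverse (qfac Q n)"
  by (simp add: rqfac_def)

lemma rqfac_diff_one:
  fixes Q :: "'a :: real_normed_field"
  assumes "norm Q < 1"
  shows "rqfac Q (k - 1) = (1 - Q powi k) * rqfac Q k"
proof (cases "k > 0")
  case True
  then obtain n where n: "k = int (Suc n)" by (metis gr0_conv_Suc pos_int_cases)
  have "k - 1 = int n" using n by simp
  hence "rqfac Q (k - 1) = inverse (qfac Q n)" by (simp add: rqfac_of_nat)
  moreover have "rqfac Q k = inverse (qfac Q n * (1 - Q ^ Suc n))"
    unfolding n rqfac_of_nat qfac_Suc ..
  moreover have "Q powi k = Q ^ Suc n" unfolding n by (rule power_int_of_nat)
  ultimately show ?thesis
    using one_minus_power_nonzero[OF assms, of "Suc n"] qfac_nonzero[OF assms, of n] by simp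
next
  case False
  thus ?thesis by (cases "k = 0") auto
qed

lemma qfac_tendsto:
  fixes Q :: "'a :: {real_normed_field, banach}"
  assumes "norm Q < 1"
  shows "qfac Q \<longlonglongrightarrow> qpoch Q Q"
  using qpoch_tendsto[OF assms, of Q] by (simp add: qfac_def[abs_def])

lemma rqfac_tendsto:
  fixes Q :: "'a :: {real_normed_field, banach}"
  assumes "norm Q < 1"
  shows "(\<lambda>n. rqfac Q (int n + r)) \<longlonglongrightarrow> inverse (qpoch Q Q)"
proof -
  have *: "(\<lambda>n. inverse (qfac Q n)) \<longlonglongrightarrow> inverse (qpoch Q Q)"
    by (intro tendsto_inverse qfac_tendsto qpoch_nonzero assms)
  have "filterlim (\<lambda>n. nat (int n + r)) sequentially sequentially"
    unfolding filterlim_at_top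
  proof
    fix Z
    show "\<forall>\<^sub>F n in sequentially. Z \<le> nat (int n + r)"
      by (rule eventually_sequentiallyI[of "Z + nat \<bar>r\<bar>"]) linarith
  qed
  from filterlim_compose[OF * this]
  show ?thesis
    by (rule Lim_transform_eventually)
       (rule eventually_sequentiallyI[of "nat \<bar>r\<bar>"], auto simp: rqfac_def)
qed

lemma rqfac_bounded:
  fixes Q :: "'a :: {real_normed_field, banach}"
  assumes "norm Q < 1"
  obtains C where "C > 0" "\<And>k. norm (rqfac Q k) \<le> C"
proof -
  have "(\<lambda>n. inverse (qfac Q n)) \<longlonglongrightarrow> inverse (qpoch Q Q)"
    by (intro tendsto_inverse qfac_tendsto qpoch_nonzero assms)
  hence "Bseq (\<lambda>n. inverse (qfac Q n))"
    by (intro convergent_imp_Bseq convergentI)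
  then obtain C where "C > 0" "\<And>n. norm (inverse (qfac Q n)) \<le> C"
    by (auto simp: Bseq_def)
  thus ?thesis by (intro that[of C]) (auto simp: rqfac_def)
qed

section \<open>The Jacobi triple product\<close>

lemma has_sum_int_shift:
  fixes f :: "int \<Rightarrow> 'a :: {topological_comm_monoid_add, t2_space}"
  shows "((\<lambda>r. f (r + d)) has_sum S) UNIV \<longleftrightarrow> (f has_sum S) UNIV"
  by (rule has_sum_reindex_bij_witness[of _ "\<lambda>r. r - d" "\<lambda>r. r + d"]) auto

lemma powi_split:
  fixes q :: "'a :: field"
  assumes "q \<noteq> 0"
  shows "q powi (a + b) = q powi a * q powi b" "q powi (a - b) = q powi a / q powi b"
  using assms by (simp_all add: power_int_add power_int_diff)

text \<open>The polynomial core of \<open>jacobi_finite_step\<close>, after common factors are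
  removed. Writing \<open>i\<close> for the inverse of \<open>Y\<close> turns a rational identity
  into a polynomial one modulo \<open>Y * i = 1\<close>.\<close>

lemma jacobi_poly: 
  fixes w g Y i :: "'a :: field"
  assumes "Y * i = 1"
  shows "(1 - w\<^sup>2 * g\<^sup>2) * (1 - w\<^sup>2 * g) = (1 + w\<^sup>2 * g) * ((1 - w * g * i) * (1 - w * g * Y))
     + w * g * i * ((1 - w * Y) * (1 - w * g * Y)) + w * g * Y * ((1 - w * i) * (1 - w * g * i))"
  using assms by algebra

text \<open>Coefficient comparison: with c = q^(2n+1) the finite product acquires the factor (1 +
  zc)(1 + c/z) = (1 + c^2) + zc + c/z, whose last two terms shift \<open>r\<close> by one. The two
  factors on the left are the quotient of \<open>qfac\<close> at \<open>2 * n + 2\<close> and at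
  \<open>2 * n\<close>.\<close>

lemma jacobi_finite_step:
  fixes q z :: "'a :: real_normed_field"
  assumes q: "q \<noteq> 0" "norm q < 1" and z: "z \<noteq> 0"
  defines "f \<equiv> \<lambda>n r. z powi r * q powi (r * r) * (rqfac (q\<^sup>2) (int n - r) * rqfac (q\<^sup>2) (int n + r))"
  shows "(1 - (q\<^sup>2) ^ (2 * n + 2)) * (1 - (q\<^sup>2) ^ (2 * n + 1)) * f (Suc n) r =
    (1 + (q ^ (2 * n + 1))\<^sup>2) * f n r + z * q ^ (2 * n + 1) * f n (r - 1)
      + q ^ (2 * n + 1) / z * f n (r + 1)"
proof -
  define Q where "Q = q\<^sup>2"
  have Q: "norm Q < 1" "Q \<noteq> 0"
    using q by (auto simp: Q_def norm_power power_less_one_iff)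
  define a b where "a = rqfac Q (int n + 1 - r)" and "b = rqfac Q (int n + 1 + r)"
  define p y where "p = q ^ n" and "y = q powi r"
  have nz: "p \<noteq> 0" "y \<noteq> 0" "z \<noteq> 0" "q \<noteq> 0" using q z by (auto simp: p_def y_def)
  note step = rqfac_diff_one[OF Q(1)]
  have Qp: "Q powi k = (q powi k)\<^sup>2" for k
    by (simp add: Q_def power2_eq_square power_int_mult_distrib)
  have a1: "rqfac Q (int n - r) = (1 - (p * q / y)\<^sup>2) * a"
  proof -
    have "rqfac Q (int n - r) = (1 - Q powi (int n + 1 - r)) * a"
      using step[of "int n + 1 - r"] by (simp add: a_def algebra_simps)
    moreover have "q powi (int n + 1 - r) = p * q / y"
      by (simp add: powi_split[OF q(1)] p_def y_def)
    ultimately show ?thesis by (simp add: Qp)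
  qed
  have a2: "rqfac Q (int n - r - 1) = (1 - (p / y)\<^sup>2) * ((1 - (p * q / y)\<^sup>2) * a)"
  proof -
    have "q powi (int n - r) = p / y"
      by (simp add: powi_split[OF q(1)] p_def y_def)
    thus ?thesis using step[of "int n - r"] a1 by (simp add: Qp)
  qed
  have b1: "rqfac Q (int n + r) = (1 - (p * q * y)\<^sup>2) * b"
  proof -
    have "rqfac Q (int n + r) = (1 - Q powi (int n + 1 + r)) * b"
      using step[of "int n + 1 + r"] by (simp add: b_def algebra_simps)
    moreover have "q powi (int n + 1 + r) = p * q * y"
      by (simp add: powi_split[OF q(1)] p_def y_def)
    ultimately show ?thesis by (simp add: Qp)
  qed
  have b2: "rqfac Q (int n + r - 1) = (1 - (p * y)\<^sup>2) * ((1 - (p * q * y)\<^sup>2) * b)"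
  proof -
    have "q powi (int n + r) = p * y"
      by (simp add: powi_split[OF q(1)] p_def y_def)
    thus ?thesis using step[of "int n + r"] b1 by (simp add: Qp)
  qed
  define M where "M = z powi r * q powi (r * r)"
  have m1: "z powi (r - 1) * q powi ((r - 1) * (r - 1)) = M * (q / y\<^sup>2) / z"
  proof -
    have "(r - 1) * (r - 1) = r * r + 1 - (r + r)" by (simp add: algebra_simps)
    hence "q powi ((r - 1) * (r - 1)) = q powi (r * r) * q / (y * y)"
      by (simp only: powi_split[OF q(1)] y_def) simp
    thus ?thesis using nz by (simp add: M_def powi_split[OF z] field_simps power2_eq_square)
  qed
  have m2: "z powi (r + 1) * q powi ((r + 1) * (r + 1)) = M * (q * y\<^sup>2) * z"
  proof -
    have "(r + 1) * (r + 1) = r * r + 1 + (r + r)" by (simp add: algebra_simps)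
    hence "q powi ((r + 1) * (r + 1)) = q powi (r * r) * q * (y * y)"
      by (simp only: powi_split[OF q(1)] y_def) simp
    thus ?thesis using nz by (simp add: M_def powi_split[OF z] field_simps power2_eq_square)
  qed
  have f1: "f (Suc n) r = M * (a * b)"
    by (simp add: f_def M_def Q_def a_def b_def add_ac)
  have f0: "f n r = M * (((1 - (p * q / y)\<^sup>2) * a) * ((1 - (p * q * y)\<^sup>2) * b))"
    unfolding f_def Q_def[symmetric] a1 b1 M_def ..
  have fm: "f n (r - 1) = M * (q / y\<^sup>2) / z * (a * ((1 - (p * y)\<^sup>2) * ((1 - (p * q * y)\<^sup>2) * b)))"
  proof -
    have "int n - (r - 1) = int n + 1 - r" "int n + (r - 1) = int n + r - 1" by auto
    thus ?thesis unfolding f_def Q_def[symmetric] m1 by (simp only: a_def[symmetric] b2)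
  qed
  have fp: "f n (r + 1) = M * (q * y\<^sup>2) * z * (((1 - (p / y)\<^sup>2) * ((1 - (p * q / y)\<^sup>2) * a)) * b)"
  proof -
    have "int n - (r + 1) = int n - r - 1" "int n + (r + 1) = int n + 1 + r" by auto
    thus ?thesis unfolding f_def Q_def[symmetric] m2 by (simp only: b_def[symmetric] a2)
  qed
  have p1: "q ^ (2 * n + 1) = p\<^sup>2 * q"
    by (simp add: p_def power_add power_mult[symmetric] mult_ac)
  have p2: "(q\<^sup>2) ^ (2 * n + 1) = p ^ 4 * q\<^sup>2" "(q\<^sup>2) ^ (2 * n + 2) = p ^ 4 * q ^ 4"
    by (simp_all add: p_def power_add power_mult[symmetric] mult_ac)
  define w g Y i where "w = p\<^sup>2" and "g = q\<^sup>2" and "Y = y\<^sup>2" and "i = 1 / y\<^sup>2"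
  have Yi: "Y * i = 1" using nz by (simp add: Y_def i_def)
  have sq: "(p * q / y)\<^sup>2 = w * g * i" "(p * q * y)\<^sup>2 = w * g * Y" "(p * y)\<^sup>2 = w * Y"
    "(p / y)\<^sup>2 = w * i" "q / y\<^sup>2 = q * i" "q * y\<^sup>2 = q * Y" "(p\<^sup>2 * q)\<^sup>2 = w\<^sup>2 * g"
    "p ^ 4 * q\<^sup>2 = w\<^sup>2 * g" "p ^ 4 * q ^ 4 = w\<^sup>2 * g\<^sup>2" "p\<^sup>2 * q = w * q" "(w * q)\<^sup>2 = w\<^sup>2 * g"
    by (simp_all add: w_def g_def Y_def i_def power_mult_distrib power_divide flip: power_mult)
  define K where "K = M * (a * b)"
  have t: "z * (w * q) * (M * (q * i) / z * (a * ((1 - w * Y) * ((1 - w * g * Y) * b))))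
      = w * g * i * ((1 - w * Y) * (1 - w * g * Y)) * K"
    "w * q / z * (M * (q * Y) * z * ((1 - w * i) * ((1 - w * g * i) * a) * b))
      = w * g * Y * ((1 - w * i) * (1 - w * g * i)) * K"
    using nz by (simp_all add: K_def g_def power2_eq_square)
  have "(1 - w\<^sup>2 * g\<^sup>2) * (1 - w\<^sup>2 * g) * K = (1 + w\<^sup>2 * g) * ((1 - w * g * i) * (1 - w * g * Y)) * K
     + w * g * i * ((1 - w * Y) * (1 - w * g * Y)) * K + w * g * Y * ((1 - w * i) * (1 - w * g * i)) * K"
    by (subst jacobi_poly[OF Yi]) (simp only: distrib_right)
  thus ?thesis
    unfolding p1 p2 f1 f0 fm fp sq t by (simp only: K_def mult_ac)
qed

text \<open>A symmetric form of the finite q-binomial theorem; only the indices with |r| <= n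
  contribute.\<close>

lemma jacobi_finite:
  fixes q z :: "'a :: {real_normed_field, banach}"
  assumes q: "q \<noteq> 0" "norm q < 1" and z: "z \<noteq> 0"
  shows "((\<lambda>r. z powi r * q powi (r * r) * (rqfac (q\<^sup>2) (int n - r) * rqfac (q\<^sup>2) (int n + r)))
    has_sum (\<Prod>i<n. (1 + z * q ^ (2 * i + 1)) * (1 + q ^ (2 * i + 1) / z)) / qfac (q\<^sup>2) (2 * n)) UNIV"
proof (induction n)
  case 0
  have "rqfac (q\<^sup>2) (- r) * rqfac (q\<^sup>2) r = 0" if "r \<noteq> 0" for r :: int
    using that by (cases "r < 0") auto
  thus ?case
    by (intro has_sum_finite_neutralI[of "{0}"]) (auto simp: rqfac_def)
next
  case (Suc n)
  define f where "f = (\<lambda>n r. z powi r * q powi (r * r) * (rqfac (q\<^sup>2) (int n - r) * rqfac (q\<^sup>2) (int n + r)))"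
  define S where "S = (\<Prod>i<n. (1 + z * q ^ (2 * i + 1)) * (1 + q ^ (2 * i + 1) / z)) / qfac (q\<^sup>2) (2 * n)"
  have IH: "(f n has_sum S) UNIV" using Suc.IH by (simp add: f_def S_def)
  have Q: "norm (q\<^sup>2) < 1" using q by (auto simp: norm_power power_less_one_iff)
  define D where "D = (1 - (q\<^sup>2) ^ (2 * n + 2)) * (1 - (q\<^sup>2) ^ (2 * n + 1))"
  have D: "D \<noteq> 0" unfolding D_def
    using one_minus_power_nonzero[OF Q, of "2*n+2"] one_minus_power_nonzero[OF Q, of "2*n+1"] by simp
  have s1: "((\<lambda>r. f n (r - 1)) has_sum S) UNIV"
    using has_sum_int_shift[of "f n" "-1" S] IH by simp
  have s2: "((\<lambda>r. f n (r + 1)) has_sum S) UNIV"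
    using has_sum_int_shift[of "f n" "1" S] IH by simp
  define c where "c = q ^ (2 * n + 1)"
  have eqc: "(1 + c\<^sup>2) * S + z * c * S + c / z * S = (1 + z * c) * (1 + c / z) * S"
  proof -
    have "z * c * (c / z) = c\<^sup>2" using z by (simp add: power2_eq_square)
    thus ?thesis by (simp only: distrib_left distrib_right mult_1_left mult_1_right) (simp add: add_ac)
  qed
  have "((\<lambda>r. (1 + c\<^sup>2) * f n r + z * c * f n (r - 1) + c / z * f n (r + 1)) has_sum
      ((1 + c\<^sup>2) * S + z * c * S + c / z * S)) UNIV"
    by (intro has_sum_add has_sum_cmult_right IH s1 s2)
  moreover have "D * f (Suc n) r = (1 + c\<^sup>2) * f n r + z * c * f n (r - 1) + c / z * f n (r + 1)" for r
    unfolding D_def f_def c_def by (rule jacobi_finite_step[OF q z])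
  ultimately have "((\<lambda>r. D * f (Suc n) r) has_sum ((1 + z * c) * (1 + c / z) * S)) UNIV"
    by (simp only: eqc)
  from has_sum_cmult_right[OF this, of "inverse D"]
  have "((\<lambda>r. inverse D * (D * f (Suc n) r)) has_sum
      (inverse D * ((1 + z * c) * (1 + c / z) * S))) UNIV" .
  moreover have "(\<lambda>r. inverse D * (D * f (Suc n) r)) = f (Suc n)"
    using D by (simp add: mult.assoc[symmetric])
  moreover have "inverse D * ((1 + z * c) * (1 + c / z) * S) =
      (\<Prod>i<Suc n. (1 + z * q ^ (2 * i + 1)) * (1 + q ^ (2 * i + 1) / z)) / qfac (q\<^sup>2) (2 * Suc n)"
  proof -
    have "qfac (q\<^sup>2) (2 * Suc n) = qfac (q\<^sup>2) (2 * n) * D"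
      by (simp add: qfac_Suc D_def mult_ac)
    thus ?thesis by (simp add: S_def c_def divide_inverse mult_ac)
  qed
  ultimately show ?case unfolding f_def by simp
qed

text \<open>Limit of \<open>jacobi_finite\<close>: each term acquires the factor 1/E^2 with E =
  (q^2; q^2), the right side acquires 1/E, so one E is left on the product side. Boundedness of
  \<open>rqfac\<close> supplies the dominating series.\<close>

theorem jacobi_triple_product:
  fixes q z :: "'a :: {real_normed_field, banach}"
  assumes q: "q \<noteq> 0" "norm q < 1" and z: "z \<noteq> 0"
  shows "((\<lambda>r. z powi r * q powi (r * r)) has_sum
    qpoch (q\<^sup>2) (q\<^sup>2) * qpoch (- z * q) (q\<^sup>2) * qpoch (- q / z) (q\<^sup>2)) UNIV"
proof -
  define Q where "Q = q\<^sup>2"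
  have Q: "norm Q < 1" using q by (auto simp: Q_def norm_power power_less_one_iff)
  obtain C where C: "C > 0" "\<And>k. norm (rqfac Q k) \<le> C" using rqfac_bounded[OF Q] by blast
  define M where "M = (\<lambda>r::int. norm z powi r * norm q powi (r * r))"
  have M: "M summable_on UNIV"
    unfolding M_def using q z by (intro summable_on_powi_square) auto
  have nM: "norm (z powi r * q powi (r * r)) = M r" for r
    by (simp add: M_def norm_mult norm_power_int)
  define f where "f = (\<lambda>r n. z powi r * q powi (r * r) * (rqfac Q (int n - r) * rqfac Q (int n + r)))"
  define E where "E = qpoch Q Q"
  have E: "E \<noteq> 0" unfolding E_def by (rule qpoch_nonzero[OF Q Q])
  have "(\<lambda>n. \<Sum>\<^sub>\<infinity>r. f r n) \<longlonglongrightarrow> (\<Sum>\<^sub>\<infinity>r. z powi r * q powi (r * r) * (inverse E * inverse E))"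
  proof (rule infsum_dominated_convergence)
    show "(\<lambda>r. M r * (C * C)) summable_on UNIV"
      by (intro summable_on_cmult_left M)
    show "\<forall>\<^sub>F n in sequentially. \<forall>r. norm (f r n) \<le> M r * (C * C)"
    proof (intro always_eventually allI)
      fix n r
      have "norm (rqfac Q (int n - r)) * norm (rqfac Q (int n + r)) \<le> C * C"
        using C by (intro mult_mono) (auto intro: less_imp_le)
      moreover have "0 \<le> M r" using nM[of r] by (metis norm_ge_zero)
      ultimately show "norm (f r n) \<le> M r * (C * C)"
        unfolding f_def norm_mult[of "z powi r * q powi (r * r)"] nM
        by (intro mult_left_mono) (auto simp: norm_mult)
    qed
    fix r
    show "f r \<longlonglongrightarrow> z powi r * q powi (r * r) * (inverse E * inverse E)"
      unfolding f_def E_def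
      using rqfac_tendsto[OF Q, of "-r"] rqfac_tendsto[OF Q, of r]
      by (intro tendsto_intros) simp_all
  qed auto
  moreover have "(\<lambda>n. \<Sum>\<^sub>\<infinity>r. f r n) =
      (\<lambda>n. ((\<Prod>i<n. 1 - (- z * q) * Q ^ i) * (\<Prod>i<n. 1 - (- q / z) * Q ^ i)) * inverse (qfac Q (2 * n)))"
  proof
    fix n
    have "(\<Sum>\<^sub>\<infinity>r. f r n) = (\<Prod>i<n. (1 + z * q ^ (2 * i + 1)) * (1 + q ^ (2 * i + 1) / z)) / qfac Q (2 * n)"
      unfolding f_def Q_def by (rule infsumI[OF jacobi_finite[OF q z]])
    moreover have factors: "1 + z * q ^ (2 * i + 1) = 1 - (- z * q) * Q ^ i"
        "1 + q ^ (2 * i + 1) / z = 1 - (- q / z) * Q ^ i" for i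
      by (simp_all add: Q_def power_mult)
    ultimately show "(\<Sum>\<^sub>\<infinity>r. f r n) = ((\<Prod>i<n. 1 - (- z * q) * Q ^ i) * (\<Prod>i<n. 1 - (- q / z) * Q ^ i)) * inverse (qfac Q (2 * n))"
      by (simp only: factors prod.distrib divide_inverse)
  qed
  moreover have "(\<lambda>n. ((\<Prod>i<n. 1 - (- z * q) * Q ^ i) * (\<Prod>i<n. 1 - (- q / z) * Q ^ i)) * inverse (qfac Q (2 * n)))
     \<longlonglongrightarrow> qpoch (- z * q) Q * qpoch (- q / z) Q * inverse E"
  proof -
    have "filterlim (\<lambda>n. 2 * n) sequentially sequentially"
      by (rule filterlim_subseq) (auto simp: strict_mono_def)
    from filterlim_compose[OF qfac_tendsto[OF Q] this]
    have "(\<lambda>n. qfac Q (2 * n)) \<longlonglongrightarrow> E" by (simp add: E_def)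
    thus ?thesis by (intro tendsto_mult tendsto_inverse qpoch_tendsto Q E)
  qed
  ultimately have "(\<Sum>\<^sub>\<infinity>r. z powi r * q powi (r * r) * (inverse E * inverse E)) =
      qpoch (- z * q) Q * qpoch (- q / z) Q * inverse E"
    by (simp only: LIMSEQ_unique)
  moreover have sm: "(\<lambda>r. z powi r * q powi (r * r)) summable_on UNIV"
    by (rule abs_summable_summable) (simp only: nM M)
  ultimately have "infsum (\<lambda>r. z powi r * q powi (r * r)) UNIV * (inverse E * inverse E) =
      qpoch (- z * q) Q * qpoch (- q / z) Q * inverse E"
    by (subst (asm) infsum_cmult_left) auto
  hence "infsum (\<lambda>r. z powi r * q powi (r * r)) UNIV = E * qpoch (- z * q) Q * qpoch (- q / z) Q"
    using E by (simp add: divide_simps mult_ac)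
  thus ?thesis using sm by (simp add: has_sum_iff E_def Q_def)
qed

section \<open>Theta functions and their cubic dissection\<close>

text \<open>This is phi of the overview; \<open>theta6\<close> and \<open>qchi\<close> below are S
  and chi.\<close>

definition theta :: "'a :: {real_normed_field, banach} \<Rightarrow> 'a" where
  "theta q = (\<Sum>\<^sub>\<infinity>n::int. q powi (n * n))"

definition theta6 :: "'a :: {real_normed_field, banach} \<Rightarrow> 'a" where
  "theta6 q = (\<Sum>\<^sub>\<infinity>n::int. q powi (3 * (n * n) + 2 * n))"

definition qchi :: "'a :: {real_normed_field, banach} \<Rightarrow> 'a" where
  "qchi q = qpoch (- q) (q\<^sup>2)"

lemma norm_power_less_one:
  fixes q :: "'a :: real_normed_field"
  assumes "norm q < 1" "n > 0"
  shows "norm (q ^ n) < 1"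
  using assms by (simp add: norm_power power_less_one_iff)

text \<open>The triple product with base \<open>q ^ a\<close> and
  \<open>z = q powi b\<close>.\<close>

lemma quadratic_theta_has_sum:
  fixes q :: "'a :: {real_normed_field, banach}"
  assumes q: "q \<noteq> 0" "norm q < 1" and a: "a > 0"
  shows "((\<lambda>r. q powi (int a * (r * r) + b * r)) has_sum
    qpoch (q ^ (2 * a)) (q ^ (2 * a)) * qpoch (- (q powi (int a + b))) (q ^ (2 * a))
      * qpoch (- (q powi (int a - b))) (q ^ (2 * a))) UNIV"
proof -
  have "(q powi b) powi r * (q ^ a) powi (r * r) = q powi (int a * (r * r) + b * r)" for r
    using q by (simp add: power_int_add power_int_mult power_int_power mult_ac)
  moreover have "(q ^ a)\<^sup>2 = q ^ (2 * a)" by (simp add: power_mult[symmetric] mult_ac)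
  moreover have "- (q powi b) * q ^ a = - (q powi (int a + b))"
    using q by (simp add: power_int_add mult_ac)
  moreover have "- (q ^ a) / (q powi b) = - (q powi (int a - b))"
    using q by (simp add: power_int_diff)
  ultimately show ?thesis
    using jacobi_triple_product[of "q ^ a" "q powi b"] q norm_power_less_one[OF q(2) a]
    by simp
qed

lemma
  fixes q :: "'a :: {real_normed_field, banach}"
  assumes q: "q \<noteq> 0" "norm q < 1"
  shows theta_has_sum: "((\<lambda>n. q powi (n * n)) has_sum theta q) UNIV"
    and theta_product: "theta q = qpoch (q\<^sup>2) (q\<^sup>2) * (qchi q)\<^sup>2"
proof -
  have *: "((\<lambda>n. q powi (n * n)) has_sum qpoch (q\<^sup>2) (q\<^sup>2) * (qchi q)\<^sup>2) UNIV"
    using quadratic_theta_has_sum[OF q, of 1 0] by (simp add: qchi_def power2_eq_square mult.assoc)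
  from infsumI[OF *] show "theta q = qpoch (q\<^sup>2) (q\<^sup>2) * (qchi q)\<^sup>2"
    by (simp add: theta_def)
  with * show "((\<lambda>n. q powi (n * n)) has_sum theta q) UNIV" by simp
qed

lemma qchi_split_3:
  fixes q :: "'a :: {real_normed_field, banach}"
  assumes "norm q < 1"
  shows "qchi q = qpoch (- q) (q ^ 6) * qpoch (- (q ^ 3)) (q ^ 6) * qpoch (- (q ^ 5)) (q ^ 6)"
proof -
  have "qchi q = (\<Prod>j<3. qpoch (- q * (q\<^sup>2) ^ j) ((q\<^sup>2) ^ 3))"
    unfolding qchi_def using assms by (intro qpoch_split norm_power_less_one) auto
  also have "\<dots> = (\<Prod>j<3. qpoch (- (q ^ (2 * j + 1))) (q ^ 6))"
    by (simp flip: power_mult add: power_add mult.commute)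
  finally show ?thesis by (simp add: numeral_3_eq_3 numeral_eq_Suc)
qed

lemma
  fixes q :: "'a :: {real_normed_field, banach}"
  assumes q: "q \<noteq> 0" "norm q < 1"
  shows theta6_has_sum: "((\<lambda>n. q powi (3 * (n * n) + 2 * n)) has_sum theta6 q) UNIV"
    and theta6_product: "theta6 q * qchi (q ^ 3) = qpoch (q ^ 6) (q ^ 6) * qchi q"
proof -
  have *: "((\<lambda>n. q powi (3 * (n * n) + 2 * n)) has_sum
      qpoch (q ^ 6) (q ^ 6) * qpoch (- (q ^ 5)) (q ^ 6) * qpoch (- q) (q ^ 6)) UNIV"
    using quadratic_theta_has_sum[OF q, of 3 2] by simp
  have eq: "theta6 q = qpoch (q ^ 6) (q ^ 6) * qpoch (- (q ^ 5)) (q ^ 6) * qpoch (- q) (q ^ 6)"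
    unfolding theta6_def by (rule infsumI[OF *])
  with * show "((\<lambda>n. q powi (3 * (n * n) + 2 * n)) has_sum theta6 q) UNIV" by simp
  \<comment> \<open>Of the three residue classes of exponents in \<open>qchi q\<close> modulo 6, the
    product for \<open>theta6\<close> contains 1 and 5; the missing class 3 is
    \<open>qchi (q ^ 3)\<close>.\<close>
  have "qchi (q ^ 3) = qpoch (- (q ^ 3)) (q ^ 6)"
    by (simp add: qchi_def flip: power_mult)
  thus "theta6 q * qchi (q ^ 3) = qpoch (q ^ 6) (q ^ 6) * qchi q"
    by (simp add: eq qchi_split_3[OF q(2)] mult_ac)
qed

lemma has_sum_int_mod_3:
  fixes f :: "int \<Rightarrow> 'a :: {topological_comm_monoid_add, t2_space}"
  assumes "((\<lambda>j. f (3 * j)) has_sum a) UNIV" "((\<lambda>j. f (3 * j + 1)) has_sum b) UNIV"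
    "((\<lambda>j. f (3 * j - 1)) has_sum c) UNIV"
  shows "(f has_sum a + b + c) UNIV"
proof -
  let ?A = "range (\<lambda>j. 3 * j :: int)" and ?B = "range (\<lambda>j. 3 * j + 1 :: int)"
    and ?C = "range (\<lambda>j. 3 * j - 1 :: int)"
  have "(f has_sum a) ?A" "(f has_sum b) ?B" "(f has_sum c) ?C"
    using assms by (subst has_sum_reindex; simp add: o_def inj_on_def)+
  moreover have "?A \<inter> ?B = {}" "(?A \<union> ?B) \<inter> ?C = {}"
    by (auto; presburger)+
  ultimately have "(f has_sum a + b + c) (?A \<union> ?B \<union> ?C)"
    by (intro has_sum_Un_disjoint)
  moreover have "x \<in> ?A \<union> ?B \<union> ?C" for x
  proof -
    have "x = 3 * (x div 3) \<or> x = 3 * (x div 3) + 1 \<or> x = 3 * (x div 3 + 1) - 1" by presburger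
    thus ?thesis by blast
  qed
  hence "?A \<union> ?B \<union> ?C = UNIV" by blast
  ultimately show ?thesis by simp
qed

text \<open>Multiples of 3 give \<open>theta (q ^ 9)\<close>. The classes 1 and -1 are exchanged by
  n -> -n, hence the factor 2, and (3j+1)^2 = 1 + 3(3j^2 + 2j) produces
  \<open>theta6 (q ^ 3)\<close>.\<close>

lemma theta_dissection_3:
  fixes q :: "'a :: {real_normed_field, banach}"
  assumes q: "q \<noteq> 0" "norm q < 1"
  shows "theta q = theta (q ^ 9) + 2 * q * theta6 (q ^ 3)"
proof -
  have q3: "q ^ 3 \<noteq> 0" "norm (q ^ 3) < 1" using q norm_power_less_one[OF q(2)] by auto
  have q9: "q ^ 9 \<noteq> 0" "norm (q ^ 9) < 1" using q norm_power_less_one[OF q(2)] by auto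
  have e3: "(q ^ 3) powi k = q powi (3 * k)" for k by (simp add: power_int_power)
  have e9: "(q ^ 9) powi k = q powi (9 * k)" for k by (simp add: power_int_power)
  have "((\<lambda>j. q powi (3 * j * (3 * j))) has_sum theta (q ^ 9)) UNIV"
    using theta_has_sum[OF q9] by (simp add: e9 mult_ac)
  moreover have s1: "((\<lambda>j. q powi ((3 * j + 1) * (3 * j + 1))) has_sum q * theta6 (q ^ 3)) UNIV"
  proof -
    have "(3 * j + 1) * (3 * j + 1) = 1 + 3 * (3 * (j * j) + 2 * j)" for j :: int
      by (simp add: algebra_simps)
    hence "q powi ((3 * j + 1) * (3 * j + 1)) = q * (q ^ 3) powi (3 * (j * j) + 2 * j)" for j
      using q power_int_add[of q 1 "3 * (3 * (j * j) + 2 * j)" for j] by (simp add: e3)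
    thus ?thesis using has_sum_cmult_right[OF theta6_has_sum[OF q3], of q] by simp
  qed
  moreover have "((\<lambda>j. q powi ((3 * j - 1) * (3 * j - 1))) has_sum q * theta6 (q ^ 3)) UNIV"
  proof -
    have "((\<lambda>j. q powi ((3 * j - 1) * (3 * j - 1))) has_sum q * theta6 (q ^ 3)) UNIV \<longleftrightarrow>
      ((\<lambda>j. q powi ((3 * j + 1) * (3 * j + 1))) has_sum q * theta6 (q ^ 3)) UNIV"
      by (rule has_sum_reindex_bij_witness[of _ uminus uminus])
         (auto intro!: arg_cong[of _ _ "power_int q"] simp: algebra_simps)
    thus ?thesis using s1 by simp
  qed
  ultimately have "((\<lambda>n. q powi (n * n)) has_sum theta (q ^ 9) + q * theta6 (q ^ 3) + q * theta6 (q ^ 3)) UNIV"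
    by (rule has_sum_int_mod_3)
  hence "theta q = theta (q ^ 9) + q * theta6 (q ^ 3) + q * theta6 (q ^ 3)"
    by (rule has_sum_unique[OF theta_has_sum[OF q]])
  thus ?thesis by simp
qed

lemma cube_root_of_unity:
  fixes w :: "'a :: comm_ring_1"
  assumes "1 + w + w\<^sup>2 = 0"
  shows "w ^ 3 = 1"
proof -
  have "w ^ 3 - 1 = (w - 1) * (1 + w + w\<^sup>2)"
    by (simp add: algebra_simps power2_eq_square power3_eq_cube)
  thus ?thesis using assms by simp
qed

lemma prod_cube_roots:
  fixes w a :: "'a :: comm_ring_1"
  assumes "1 + w + w\<^sup>2 = 0"
  shows "(1 - a) * (1 - w * a) * (1 - w\<^sup>2 * a) = 1 - a ^ 3"
proof -
  have "(1 - a) * (1 - w * a) * (1 - w\<^sup>2 * a) = 1 - a ^ 3 +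
      (1 + w + w\<^sup>2) * (w * a\<^sup>2 - a - (w - 1) * a ^ 3)"
    by (simp add: algebra_simps power2_eq_square power3_eq_cube)
  thus ?thesis using assms by simp
qed

lemma qpoch_cube_roots:
  fixes w a q :: "'a :: {real_normed_field, banach}"
  assumes "1 + w + w\<^sup>2 = 0" "norm q < 1"
  shows "qpoch a q * qpoch (w * a) q * qpoch (w\<^sup>2 * a) q = qpoch (a ^ 3) (q ^ 3)"
proof (rule LIMSEQ_unique)
  show "(\<lambda>n. (\<Prod>i<n. 1 - a * q ^ i) * (\<Prod>i<n. 1 - w * a * q ^ i) * (\<Prod>i<n. 1 - w\<^sup>2 * a * q ^ i))
    \<longlonglongrightarrow> qpoch a q * qpoch (w * a) q * qpoch (w\<^sup>2 * a) q"
    by (intro tendsto_mult qpoch_tendsto assms)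
  have "(1 - a * q ^ i) * (1 - w * a * q ^ i) * (1 - w\<^sup>2 * a * q ^ i) = 1 - a ^ 3 * (q ^ 3) ^ i" for i
    using prod_cube_roots[OF assms(1), of "a * q ^ i"]
    by (simp add: power_mult_distrib mult.assoc flip: power_mult) (simp add: mult.commute)
  hence "(\<Prod>i<n. 1 - a * q ^ i) * (\<Prod>i<n. 1 - w * a * q ^ i) * (\<Prod>i<n. 1 - w\<^sup>2 * a * q ^ i)
      = (\<Prod>i<n. 1 - a ^ 3 * (q ^ 3) ^ i)" for n
    by (simp only: prod.distrib[symmetric])
  thus "(\<lambda>n. (\<Prod>i<n. 1 - a * q ^ i) * (\<Prod>i<n. 1 - w * a * q ^ i) * (\<Prod>i<n. 1 - w\<^sup>2 * a * q ^ i))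
    \<longlonglongrightarrow> qpoch (a ^ 3) (q ^ 3)"
    using qpoch_tendsto[of "q ^ 3" "a ^ 3"] norm_power_less_one[OF assms(2), of 3] by simp
qed

text \<open>In the product formula, factors whose exponent is divisible by 3 do not see
  \<open>w\<close> and occur three times; the others combine by (1-a)(1-wa)(1-w^2 a) = 1 - a^3. The
  fourth factor \<open>theta (q ^ 9)\<close> supplies exactly what is missing for another copy of
  \<open>theta (q ^ 3)\<close>. This is checked separately for the two ingredients
  \<open>qchi\<close> and (x^2; x^2).\<close>

lemma theta_prod_cube_roots:
  fixes w q :: "'a :: {real_normed_field, banach}"
  assumes w: "1 + w + w\<^sup>2 = 0" and q: "q \<noteq> 0" "norm q < 1"
  shows "theta q * theta (w * q) * theta (w\<^sup>2 * q) * theta (q ^ 9) = theta (q ^ 3) ^ 4"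
proof -
  have w3: "w ^ 3 = 1" by (rule cube_root_of_unity[OF w])
  have nw: "norm w = 1"
  proof -
    have "norm w ^ 3 = 1" using w3 by (simp flip: norm_power)
    thus ?thesis using power_eq_imp_eq_base[of "norm w" 3 1] by simp
  qed
  have nq: "norm (q ^ n) < 1" if "n > 0" for n using norm_power_less_one[OF q(2) that] .
  have w6: "w ^ 6 = 1" "w ^ 5 = w\<^sup>2" "w ^ 4 = w" "w ^ 12 = 1" "w ^ 10 = w" "w ^ 8 = w\<^sup>2"
    using w3 power_add[of w 3 3] power_add[of w 3 2] power_add[of w 3 1]
      power_mult[of w 3 4] power_mult[of w 3 3] power_add[of w 9 1] power_add[of w 6 2] power_mult[of w 3 2]
    by simp_all
  have chi: "qchi q * qchi (w * q) * qchi (w\<^sup>2 * q) * qchi (q ^ 9) = qchi (q ^ 3) ^ 4"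
  proof -
    define A B C where "A = qpoch (- (q ^ 3)) (q ^ 18)" and "B = qpoch (- (q ^ 9)) (q ^ 18)"
      and "C = qpoch (- (q ^ 15)) (q ^ 18)"
    have s0: "qchi q = qpoch (- q) (q ^ 6) * qpoch (- (q ^ 3)) (q ^ 6) * qpoch (- (q ^ 5)) (q ^ 6)"
      by (rule qchi_split_3) (use q in auto)
    have s1: "qchi (w * q) = qpoch (w * - q) (q ^ 6) * qpoch (- (q ^ 3)) (q ^ 6) * qpoch (w\<^sup>2 * - (q ^ 5)) (q ^ 6)"
      using qchi_split_3[of "w * q"] q nw by (simp add: norm_mult power_mult_distrib w6 w3)
    have s2: "qchi (w\<^sup>2 * q) = qpoch (w\<^sup>2 * - q) (q ^ 6) * qpoch (- (q ^ 3)) (q ^ 6) * qpoch (w * - (q ^ 5)) (q ^ 6)"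
      using qchi_split_3[of "w\<^sup>2 * q"] q nw
      by (simp add: norm_mult norm_power power_mult_distrib w6 w3 flip: power_mult)
    have p1: "qpoch (- q) (q ^ 6) * qpoch (w * - q) (q ^ 6) * qpoch (w\<^sup>2 * - q) (q ^ 6) = A"
      using qpoch_cube_roots[OF w nq, of 6 "- q"] by (simp add: A_def flip: power_mult)
    have p5: "qpoch (- (q ^ 5)) (q ^ 6) * qpoch (w * - (q ^ 5)) (q ^ 6) * qpoch (w\<^sup>2 * - (q ^ 5)) (q ^ 6) = C"
      using qpoch_cube_roots[OF w nq, of 6 "- (q ^ 5)"] by (simp add: C_def flip: power_mult)
    have c3: "qchi (q ^ 3) = A * B * C"
      using qchi_split_3[OF nq, of 3] by (simp add: A_def B_def C_def flip: power_mult)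
    have c3': "qchi (q ^ 3) = qpoch (- (q ^ 3)) (q ^ 6)"
      by (simp add: qchi_def flip: power_mult)
    have c9: "qchi (q ^ 9) = B"
      by (simp add: qchi_def B_def flip: power_mult)
    have "qchi q * qchi (w * q) * qchi (w\<^sup>2 * q) * qchi (q ^ 9) = A * B * C * qchi (q ^ 3) ^ 3"
      unfolding s0 s1 s2 c9 c3'[symmetric] p1[symmetric] p5[symmetric]
      by (simp only: power3_eq_cube mult_ac)
    thus ?thesis unfolding c3 by (simp add: numeral_eq_Suc mult_ac)
  qed
  define E where "E = (\<lambda>x :: 'a. qpoch (x\<^sup>2) (x\<^sup>2))"
  have split: "E x = qpoch (x\<^sup>2) (x ^ 6) * qpoch (x ^ 4) (x ^ 6) * qpoch (x ^ 6) (x ^ 6)"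
    if "norm x < 1" for x
  proof -
    have "E x = (\<Prod>j<3. qpoch (x\<^sup>2 * (x\<^sup>2) ^ j) ((x\<^sup>2) ^ 3))"
      unfolding E_def using that by (intro qpoch_split norm_power_less_one) auto
    also have "\<dots> = (\<Prod>j<3. qpoch (x ^ (2 * j + 2)) (x ^ 6))"
    proof -
      have "x\<^sup>2 * (x\<^sup>2) ^ j = x ^ (2 * j + 2)" for j
        by (simp only: power_mult[symmetric] power_add[symmetric] add.commute)
      moreover have "(x\<^sup>2) ^ 3 = x ^ 6" by (simp flip: power_mult)
      ultimately show ?thesis by simp
    qed
    finally show ?thesis by (simp add: numeral_3_eq_3 numeral_eq_Suc)
  qed
  have E: "E q * E (w * q) * E (w\<^sup>2 * q) * E (q ^ 9) = E (q ^ 3) ^ 4"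
  proof -
    define A B C where "A = qpoch (q ^ 6) (q ^ 18)" and "B = qpoch (q ^ 12) (q ^ 18)"
      and "C = qpoch (q ^ 18) (q ^ 18)"
    have s0: "E q = qpoch (q\<^sup>2) (q ^ 6) * qpoch (q ^ 4) (q ^ 6) * qpoch (q ^ 6) (q ^ 6)"
      using split q by simp
    have s1: "E (w * q) = qpoch (w\<^sup>2 * q\<^sup>2) (q ^ 6) * qpoch (w * q ^ 4) (q ^ 6) * qpoch (q ^ 6) (q ^ 6)"
      using split[of "w * q"] q nw by (simp add: norm_mult power_mult_distrib w6 w3)
    have s2: "E (w\<^sup>2 * q) = qpoch (w * q\<^sup>2) (q ^ 6) * qpoch (w\<^sup>2 * q ^ 4) (q ^ 6) * qpoch (q ^ 6) (q ^ 6)"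
      using split[of "w\<^sup>2 * q"] q nw
      by (simp add: norm_mult norm_power power_mult_distrib w6 w3 flip: power_mult)
    have p1: "qpoch (q\<^sup>2) (q ^ 6) * qpoch (w * q\<^sup>2) (q ^ 6) * qpoch (w\<^sup>2 * q\<^sup>2) (q ^ 6) = A"
      using qpoch_cube_roots[OF w nq, of 6 "q\<^sup>2"] by (simp add: A_def flip: power_mult)
    have p5: "qpoch (q ^ 4) (q ^ 6) * qpoch (w * q ^ 4) (q ^ 6) * qpoch (w\<^sup>2 * q ^ 4) (q ^ 6) = B"
      using qpoch_cube_roots[OF w nq, of 6 "q ^ 4"] by (simp add: B_def flip: power_mult)
    have c3: "E (q ^ 3) = A * B * C"
      using split[OF nq, of 3] by (simp add: A_def B_def C_def flip: power_mult)
    have c3': "E (q ^ 3) = qpoch (q ^ 6) (q ^ 6)"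
      by (simp add: E_def flip: power_mult)
    have c9: "E (q ^ 9) = C"
      by (simp add: E_def C_def flip: power_mult)
    have "E q * E (w * q) * E (w\<^sup>2 * q) * E (q ^ 9) = A * B * C * E (q ^ 3) ^ 3"
      unfolding s0 s1 s2 c9 c3'[symmetric] p1[symmetric] p5[symmetric]
      by (simp only: power3_eq_cube mult_ac)
    thus ?thesis unfolding c3 by (simp add: numeral_eq_Suc mult_ac)
  qed
  have th: "theta x = E x * (qchi x)\<^sup>2" if "x \<noteq> 0" "norm x < 1" for x
    unfolding E_def by (rule theta_product[OF that])
  have "w \<noteq> 0" using nw by auto
  hence "theta q * theta (w * q) * theta (w\<^sup>2 * q) * theta (q ^ 9) =
    (E q * E (w * q) * E (w\<^sup>2 * q) * E (q ^ 9)) * (qchi q * qchi (w * q) * qchi (w\<^sup>2 * q) * qchi (q ^ 9))\<^sup>2"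
    using q nw nq by (simp add: th norm_mult norm_power power_mult_distrib mult_ac)
  also have "\<dots> = (E (q ^ 3) * (qchi (q ^ 3))\<^sup>2) ^ 4"
    unfolding E chi by (simp add: power_mult_distrib flip: power_mult)
  also have "\<dots> = theta (q ^ 3) ^ 4"
    using q nq by (simp add: th)
  finally show ?thesis .
qed

text \<open>In the dissection both theta values depend on \<open>q ^ 3\<close> only, so replacing q
  by wq merely multiplies the second summand B by w; the three versions multiply to A^3 +
  B^3.\<close>

lemma theta_cubic_complex:
  fixes q :: complex
  assumes q: "q \<noteq> 0" "norm q < 1"
  shows "(theta (q ^ 9) ^ 3 + (2 * q * theta6 (q ^ 3)) ^ 3) * theta (q ^ 9) = theta (q ^ 3) ^ 4"
proof -
  define w where "w = cis (2 * pi / 3)"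
  have w: "1 + w + w\<^sup>2 = 0"
    by (simp add: w_def complex_eq_iff power2_eq_square cos_120 sin_120)
  have w3: "w ^ 3 = 1" by (rule cube_root_of_unity[OF w])
  have w9: "w ^ 9 = 1" "w ^ 6 = 1" "w ^ 18 = 1"
    using power_mult[of w 3 3] power_mult[of w 3 2] power_mult[of w 3 6] w3 by simp_all
  have nw: "norm w = 1" by (simp add: w_def)
  define A B where "A = theta (q ^ 9)" and "B = 2 * q * theta6 (q ^ 3)"
  have "theta q = A + B"
    unfolding A_def B_def by (rule theta_dissection_3[OF q])
  moreover have "theta (w * q) = A + w * B"
    using theta_dissection_3[of "w * q"] q nw
    by (simp add: A_def B_def norm_mult power_mult_distrib w3 w9 w_def[symmetric] mult_ac) (auto simp: w_def)
  moreover have "theta (w\<^sup>2 * q) = A + w\<^sup>2 * B"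
    using theta_dissection_3[of "w\<^sup>2 * q"] q nw
    by (simp add: A_def B_def norm_mult norm_power power_mult_distrib w3 w9 mult_ac flip: power_mult) (auto simp: w_def)
  moreover have "(A + B) * (A + w * B) * (A + w\<^sup>2 * B) = A ^ 3 + B ^ 3"
  proof -
    have "(A + B) * (A + w * B) * (A + w\<^sup>2 * B) = A ^ 3 + B ^ 3 +
        (1 + w + w\<^sup>2) * (A\<^sup>2 * B + w * A * B\<^sup>2 + (w - 1) * B ^ 3)"
      by (simp add: algebra_simps power2_eq_square power3_eq_cube)
    thus ?thesis using w by simp
  qed
  ultimately show ?thesis
    using theta_prod_cube_roots[OF w q] by (simp add: A_def B_def)
qed

section \<open>Cubic and quintic theta identities\<close>

lemma theta_of_real:
  assumes "0 < x" "x < 1"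
  shows "theta (complex_of_real x) = of_real (theta x)" "theta6 (complex_of_real x) = of_real (theta6 x)"
proof -
  have "((\<lambda>n. complex_of_real (x powi (n * n))) has_sum of_real (theta x)) UNIV"
    by (intro has_sum_of_real theta_has_sum) (use assms in auto)
  from infsumI[OF this] show "theta (complex_of_real x) = of_real (theta x)"
    by (simp add: theta_def of_real_power_int)
  have "((\<lambda>n. complex_of_real (x powi (3 * (n * n) + 2 * n))) has_sum of_real (theta6 x)) UNIV"
    by (intro has_sum_of_real theta6_has_sum) (use assms in auto)
  from infsumI[OF this] show "theta6 (complex_of_real x) = of_real (theta6 x)"
    by (simp add: theta6_def of_real_power_int)
qed

text \<open>\<open>theta_cubic_complex\<close> at the real cube root of \<open>x\<close>, which is
  why the factor \<open>8 * x\<close> appears without radicals.\<close>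

lemma theta_cubic:
  fixes x :: real
  assumes x: "0 < x" "x < 1"
  shows "(theta (x ^ 3) ^ 3 + 8 * x * theta6 x ^ 3) * theta (x ^ 3) = theta x ^ 4"
proof -
  define y where "y = root 3 x"
  have y: "0 < y" "y < 1" "y ^ 3 = x" using x by (auto simp: y_def)
  have y9: "y ^ 9 = x ^ 3" using power_mult[of y 3 3] y(3) by simp
  have x3: "0 < x ^ 3" "x ^ 3 < 1" using x by (auto simp: power_less_one_iff)
  have "(theta (complex_of_real y ^ 9) ^ 3 + (2 * complex_of_real y * theta6 (complex_of_real y ^ 3)) ^ 3)
      * theta (complex_of_real y ^ 9) = theta (complex_of_real y ^ 3) ^ 4"
    by (rule theta_cubic_complex) (use y in auto)
  moreover have "complex_of_real ((theta (x ^ 3) ^ 3 + (2 * y * theta6 x) ^ 3) * theta (x ^ 3)) =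
      complex_of_real (theta x ^ 4)"
    if "(theta (complex_of_real y ^ 9) ^ 3 + (2 * complex_of_real y * theta6 (complex_of_real y ^ 3)) ^ 3)
      * theta (complex_of_real y ^ 9) = theta (complex_of_real y ^ 3) ^ 4"
  proof -
    have "complex_of_real y ^ 9 = of_real (x ^ 3)" "complex_of_real y ^ 3 = of_real x"
      by (simp_all only: of_real_power[symmetric] y9 y(3))
    thus ?thesis using that theta_of_real[OF x] theta_of_real[OF x3] by simp
  qed
  ultimately have "(theta (x ^ 3) ^ 3 + (2 * y * theta6 x) ^ 3) * theta (x ^ 3) = theta x ^ 4"
    using of_real_eq_iff by blast
  thus ?thesis by (simp add: power_mult_distrib y(3))
qed

section \<open>The quintic identity: sums over the Gaussian integers\<close>

lemma has_sum_times_real: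
  fixes f :: "'i \<Rightarrow> real" and g :: "'j \<Rightarrow> real"
  assumes f: "(f has_sum a) A" and g: "(g has_sum b) B"
    and nn: "\<And>x. x \<in> A \<Longrightarrow> f x \<ge> 0" "\<And>y. y \<in> B \<Longrightarrow> g y \<ge> 0"
  shows "((\<lambda>(x, y). f x * g y) has_sum a * b) (A \<times> B)"
proof (rule has_sum_SigmaI)
  show "((\<lambda>y. case (x, y) of (x, y) \<Rightarrow> f x * g y) has_sum f x * b) B" for x
    using has_sum_cmult_right[OF g, of "f x"] by simp
  show "((\<lambda>x. f x * b) has_sum a * b) A"
    using has_sum_cmult_left[OF f] .
  show "(\<lambda>(x, y). f x * g y) summable_on A \<times> B"
  proof (rule summable_on_SigmaI)
    show "((\<lambda>y. case (x, y) of (x, y) \<Rightarrow> f x * g y) has_sum f x * b) B" for x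
      using has_sum_cmult_right[OF g, of "f x"] by simp
    show "(\<lambda>x. f x * b) summable_on A"
      using has_sum_cmult_left[OF f] by (rule has_sum_imp_summable)
  qed (use nn in auto)
qed


text \<open>Multiplication by 2 + i sends c + di to (2c - d) + (c + 2d)i, and division is
  multiplication by (2 - i)/5. Divisibility of a + bi by 2 + i means 5 | a - 2b, since i is
  congruent to -2 modulo 2 + i.\<close>

lemma gauss_div_5:
  fixes a b c d :: int
  shows "(2 * (2 * c - d) + (c + 2 * d)) div 5 = c" "(2 * (c + 2 * d) - (2 * c - d)) div 5 = d"
    and "(a - 2 * b) mod 5 = 0 \<Longrightarrow> 2 * ((2 * a + b) div 5) - (2 * b - a) div 5 = a"
    and "(a - 2 * b) mod 5 = 0 \<Longrightarrow> (2 * a + b) div 5 + 2 * ((2 * b - a) div 5) = b"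
proof -
  have "2 * (2 * c - d) + (c + 2 * d) = 5 * c" "2 * (c + 2 * d) - (2 * c - d) = 5 * d" by auto
  thus "(2 * (2 * c - d) + (c + 2 * d)) div 5 = c" "(2 * (c + 2 * d) - (2 * c - d)) div 5 = d" by simp_all
  have *: "2 * ((2 * a + b) div 5) - (2 * b - a) div 5 = a \<and> (2 * a + b) div 5 + 2 * ((2 * b - a) div 5) = b"
    if "(a - 2 * b) mod 5 = 0"
  proof -
    from that obtain k where k: "a - 2 * b = 5 * k" by (auto simp: mod_eq_0_iff_dvd dvd_def)
    have "2 * a + b = 5 * (b + 2 * k)" "2 * b - a = 5 * (- k)" using k by auto
    hence "(2 * a + b) div 5 = b + 2 * k" "(2 * b - a) div 5 = - k" by simp_all
    thus ?thesis using k by simp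
  qed
  show "(a - 2 * b) mod 5 = 0 \<Longrightarrow> 2 * ((2 * a + b) div 5) - (2 * b - a) div 5 = a"
    "(a - 2 * b) mod 5 = 0 \<Longrightarrow> (2 * a + b) div 5 + 2 * ((2 * b - a) div 5) = b" by (simp_all only: *)
qed

lemma theta_square_quintic:
  fixes q :: real
  assumes q: "0 < q" "q < 1"
  shows "theta q ^ 2 = theta (q ^ 5) ^ 2 + 4 * q *
    (\<Sum>\<^sub>\<infinity>r::int. q powi (5 * (r * r) + 4 * r)) * (\<Sum>\<^sub>\<infinity>r::int. q powi (5 * (r * r) + (- 2) * r))"
proof -
  \<comment> \<open>The square of \<open>theta\<close> is the sum of q^N(z) over Gaussian integers z
    = a + bi with norm N.\<close>
  define F where "F = (\<lambda>(a, b). q powi (a * a + b * b :: int))"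
  define X Y where "X = (\<Sum>\<^sub>\<infinity>r::int. q powi (5 * (r * r) + 4 * r))"
    and "Y = (\<Sum>\<^sub>\<infinity>r::int. q powi (5 * (r * r) + (- 2) * r))"
  \<comment> \<open>\<open>S 0\<close> is the ideal generated by \<open>2 + i\<close>; the units permute the four other residue classes.\<close>
  define S where "S = (\<lambda>r. {p :: int \<times> int. (fst p - 2 * snd p) mod 5 = r})"
  have q0: "q \<noteq> 0" "norm q < 1" using q by auto
  have q5: "q ^ 5 \<noteq> 0" "norm (q ^ 5) < 1" using q by (auto simp: power_less_one_iff)
  have hX: "((\<lambda>r. q powi (5 * (r * r) + 4 * r)) has_sum X) UNIV"
    using has_sum_imp_summable[OF quadratic_theta_has_sum[OF q0, of 5 4]] unfolding X_def
    by (intro has_sum_infsum) simp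
  have hY: "((\<lambda>r. q powi (5 * (r * r) + (- 2) * r)) has_sum Y) UNIV"
    using has_sum_imp_summable[OF quadratic_theta_has_sum[OF q0, of 5 "- 2"]] unfolding Y_def
    by (intro has_sum_infsum) simp
  have total: "(F has_sum theta q * theta q) UNIV"
    using has_sum_times_real[OF theta_has_sum[OF q0] theta_has_sum[OF q0]] q
    by (simp add: F_def power_int_add case_prod_unfold)
  have S0: "(F has_sum theta (q ^ 5) * theta (q ^ 5)) (S 0)"
  proof -
    have "((\<lambda>(c, d). (q ^ 5) powi (c * c) * (q ^ 5) powi (d * d)) has_sum theta (q ^ 5) * theta (q ^ 5)) (UNIV \<times> UNIV)"
      by (intro has_sum_times_real theta_has_sum q5) (use q in auto)
    moreover have "((\<lambda>(c, d). (q ^ 5) powi (c * c) * (q ^ 5) powi (d * d)) has_sum theta (q ^ 5) * theta (q ^ 5)) (UNIV \<times> UNIV)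
       \<longleftrightarrow> ?thesis"
    proof (rule has_sum_reindex_bij_witness[of _ "\<lambda>(a, b). ((2 * a + b) div 5, (2 * b - a) div 5)"
          "\<lambda>(c, d). (2 * c - d, c + 2 * d)"], goal_cases)
      case (5 p)
      obtain c d where p: "p = (c, d)" by (cases p)
      have "(2 * c - d) * (2 * c - d) + (c + 2 * d) * (c + 2 * d) = 5 * (c * c) + 5 * (d * d)"
        by (simp add: algebra_simps)
      hence "F (2 * c - d, c + 2 * d) = q powi (5 * (c * c)) * q powi (5 * (d * d))"
        unfolding F_def prod.case by (simp only: power_int_add[OF disjI1[OF q0(1)]])
      thus ?case by (simp add: p power_int_power)
    next
      case (1 p)
      show ?case by (cases p) (simp only: prod.case gauss_div_5)
    next
      case (2 p)
      have "(2 * c - d - 2 * (c + 2 * d)) mod 5 = 0" for c d :: int by presburger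
      thus ?case by (cases p) (simp only: S_def mem_Collect_eq prod.case fst_conv snd_conv)
    next
      case (3 p)
      obtain a b where ab: "p = (a, b)" by (cases p)
      have "(a - 2 * b) mod 5 = 0" using 3 by (simp add: ab S_def)
      thus ?case by (simp only: ab prod.case gauss_div_5)
    qed auto
    ultimately show ?thesis by blast
  qed
  have base: "((\<lambda>(c, d). q * (q powi (5 * (c * c) + 4 * c) * q powi (5 * (d * d) + (- 2) * d))) has_sum q * (X * Y)) UNIV"
    using has_sum_cmult_right[OF has_sum_times_real[OF hX hY], of q] q by (simp add: case_prod_unfold)
  \<comment> \<open>Here \<open>s\<close> is multiplication by a unit and \<open>t\<close> its
    inverse, so every coset reduces to that of 1. There the norm of 1 + (2+i)(c+di) is 1 + (5c^2 +
    4c) + (5d^2 - 2d), and the double sum factors.\<close>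
  have coset: "(F has_sum q * (X * Y)) (S r)"
    if w: "\<And>c d. s (1 + 2 * c - d, c + 2 * d) \<in> S r" "\<And>p. p \<in> S r \<Longrightarrow> t p \<in> S 1"
      "\<And>p. s (t p) = p" "\<And>p. t (s p) = p" "\<And>p. F (s p) = F p" for r s t
  proof -
    have iff: "((\<lambda>(c, d). q * (q powi (5 * (c * c) + 4 * c) * q powi (5 * (d * d) + (- 2) * d))) has_sum q * (X * Y)) UNIV
       \<longleftrightarrow> (F has_sum q * (X * Y)) (S r)"
    proof (rule has_sum_reindex_bij_witness[of _ "\<lambda>p. case t p of (a, b) \<Rightarrow> ((2 * (a - 1) + b) div 5, (2 * b - (a - 1)) div 5)"
          "\<lambda>(c, d). s (1 + 2 * c - d, c + 2 * d)"], goal_cases)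
      case (1 p)
      have "1 + 2 * c - d - 1 = 2 * c - d" for c d :: int by simp
      thus ?case by (cases p) (simp only: prod.case w gauss_div_5)
    next
      case (2 p)
      show ?case by (cases p) (simp only: prod.case w)
    next
      case (3 p)
      obtain a b where ab: "t p = (a, b)" by (cases "t p")
      have "(a - 2 * b) mod 5 = 1" using w(2)[OF 3] by (simp add: ab S_def)
      hence m: "(a - 1 - 2 * b) mod 5 = 0" by presburger
      have "1 + 2 * ((2 * (a - 1) + b) div 5) - (2 * b - (a - 1)) div 5 = a"
        "(2 * (a - 1) + b) div 5 + 2 * ((2 * b - (a - 1)) div 5) = b"
        using gauss_div_5(3,4)[OF m] by linarith+
      hence "s (1 + 2 * ((2 * (a - 1) + b) div 5) - (2 * b - (a - 1)) div 5,
        (2 * (a - 1) + b) div 5 + 2 * ((2 * b - (a - 1)) div 5)) = s (t p)" by (simp only: ab)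
      thus ?case using w(3)[of p] by (simp only: ab prod.case)
    next
      case (5 p)
      obtain c d where p: "p = (c, d)" by (cases p)
      have "(1 + 2 * c - d) * (1 + 2 * c - d) + (c + 2 * d) * (c + 2 * d) =
        1 + ((5 * (c * c) + 4 * c) + (5 * (d * d) + (- 2) * d))"
        by (simp add: algebra_simps)
      hence "F (1 + 2 * c - d, c + 2 * d) =
          q * (q powi (5 * (c * c) + 4 * c) * q powi (5 * (d * d) + (- 2) * d))"
        unfolding F_def prod.case
        by (simp only: power_int_add[OF disjI1[OF q0(1)]] power_int_1_right)
      thus ?case by (simp add: p w)
    qed auto
    show ?thesis using iff base by blast
  qed
  have S1: "(F has_sum q * (X * Y)) (S 1)"
    by (rule coset[of "\<lambda>p. p" _ "\<lambda>p. p"]; simp add: S_def; presburger)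
  have S2: "(F has_sum q * (X * Y)) (S 3)"
    by (rule coset[of "\<lambda>p. (- snd p, fst p)" _ "\<lambda>p. (snd p, - fst p)"];
        simp add: S_def F_def case_prod_unfold add.commute; presburger)
  have S3: "(F has_sum q * (X * Y)) (S 4)"
    by (rule coset[of "\<lambda>p. (- fst p, - snd p)" _ "\<lambda>p. (- fst p, - snd p)"];
        simp add: S_def F_def case_prod_unfold; presburger)
  have S4: "(F has_sum q * (X * Y)) (S 2)"
    by (rule coset[of "\<lambda>p. (snd p, - fst p)" _ "\<lambda>p. (- snd p, fst p)"];
        simp add: S_def F_def case_prod_unfold add.commute; presburger)
  have "(F has_sum theta (q ^ 5) * theta (q ^ 5) + q * (X * Y) + q * (X * Y) + q * (X * Y) + q * (X * Y))
      (S 0 \<union> S 1 \<union> S 2 \<union> S 3 \<union> S 4)"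
    by (intro has_sum_Un_disjoint S0 S1 S2 S3 S4) (auto simp: S_def)
  moreover have "p \<in> S 0 \<union> S 1 \<union> S 2 \<union> S 3 \<union> S 4" for p
  proof (cases p)
    case (Pair a b)
    have "(a - 2 * b) mod 5 \<in> {0, 1, 2, 3, 4}" by (simp, presburger)
    thus ?thesis by (auto simp: S_def Pair)
  qed
  hence "S 0 \<union> S 1 \<union> S 2 \<union> S 3 \<union> S 4 = UNIV" by blast
  ultimately have "theta q * theta q = theta (q ^ 5) * theta (q ^ 5) + q * (X * Y) + q * (X * Y) + q * (X * Y) + q * (X * Y)"
    using has_sum_unique[OF total] by simp
  thus ?thesis unfolding X_def[symmetric] Y_def[symmetric] by (simp add: power2_eq_square)
qed

lemma theta_pos:
  fixes q :: real
  assumes "0 < q" "q < 1"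
  shows "theta q > 0"
proof -
  have "1 \<le> theta q"
    using has_sum_mono2[OF has_sum_finiteI[OF _ refl, of "{0}" "\<lambda>n. q powi (n * n)"] theta_has_sum[of q]] assms
    by simp
  thus ?thesis by simp
qed

lemma qchi_pos:
  fixes q :: real
  assumes "0 < q" "q < 1"
  shows "qchi q > 0"
proof -
  have "qchi q \<noteq> 0" unfolding qchi_def
    by (rule qpoch_nonzero) (use assms in \<open>auto simp: norm_power power_less_one_iff\<close>)
  moreover have "qchi q \<ge> 0"
  proof (rule LIMSEQ_le_const)
    show "(\<lambda>n. \<Prod>i<n. 1 - (- q) * (q\<^sup>2) ^ i) \<longlonglongrightarrow> qchi q"
      unfolding qchi_def by (rule qpoch_tendsto) (use assms in \<open>auto simp: power_less_one_iff\<close>)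
    show "\<exists>N. \<forall>n\<ge>N. 0 \<le> (\<Prod>i<n. 1 - - q * (q\<^sup>2) ^ i)"
      using assms by (intro exI allI impI prod_nonneg) auto
  qed
  ultimately show ?thesis by simp
qed

text \<open>The triple products of the two series in \<open>theta_square_quintic\<close> contain the
  residues 1, 9 and 3, 7 modulo 10. Together they are \<open>qchi q\<close> without the class 5, and
  that class is \<open>qchi (q ^ 5)\<close>.\<close>

lemma theta_quintic:
  fixes q :: real
  assumes q: "0 < q" "q < 1"
  shows "(theta q / theta (q ^ 5)) ^ 2 = 1 + 4 * q * qchi q / qchi (q ^ 5) ^ 5"
proof -
  have q0: "q \<noteq> 0" "norm q < 1" using q by auto
  have q5: "0 < q ^ 5" "q ^ 5 < 1" using q by (auto simp: power_less_one_iff)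
  define E where "E = qpoch (q ^ 10) (q ^ 10)"
  define c where "c = (\<lambda>k. qpoch (- (q ^ k)) (q ^ 10))"
  have X: "(\<Sum>\<^sub>\<infinity>r::int. q powi (5 * (r * r) + 4 * r)) = E * c 9 * c 1"
    using infsumI[OF quadratic_theta_has_sum[OF q0, of 5 4]] by (simp add: E_def c_def)
  have Y: "(\<Sum>\<^sub>\<infinity>r::int. q powi (5 * (r * r) + (- 2) * r)) = E * c 3 * c 7"
    using infsumI[OF quadratic_theta_has_sum[OF q0, of 5 "- 2"]] by (simp add: E_def c_def)
  have "qchi q = (\<Prod>j<5. qpoch (- q * (q\<^sup>2) ^ j) ((q\<^sup>2) ^ 5))"
    unfolding qchi_def by (intro qpoch_split) (use q in \<open>auto simp: power_less_one_iff\<close>)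
  also have "\<dots> = (\<Prod>j<5. c (2 * j + 1))"
    by (simp add: c_def flip: power_mult)
  finally have chi: "qchi q = c 1 * c 3 * c 5 * c 7 * c 9"
    by (simp add: numeral_eq_Suc mult_ac)
  have c5: "qchi (q ^ 5) = c 5" by (simp add: qchi_def c_def flip: power_mult)
  have th: "theta (q ^ 5) = E * (c 5)\<^sup>2"
    using theta_product[of "q ^ 5"] q5 by (simp add: E_def c5 flip: power_mult)
  have nz: "E \<noteq> 0" "c 5 \<noteq> 0"
    using theta_pos[OF q5] th by auto
  have "theta q ^ 2 = theta (q ^ 5) ^ 2 + 4 * q * (E * c 9 * c 1) * (E * c 3 * c 7)"
    using theta_square_quintic[OF q] X Y by simp
  hence "(theta q / theta (q ^ 5)) ^ 2 = 1 + 4 * q * (E * c 9 * c 1) * (E * c 3 * c 7) / (E * (c 5)\<^sup>2) ^ 2"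
    using nz by (simp add: th power_divide add_divide_distrib)
  also have "4 * q * (E * c 9 * c 1) * (E * c 3 * c 7) / (E * (c 5)\<^sup>2) ^ 2 = 4 * q * qchi q / qchi (q ^ 5) ^ 5"
    unfolding chi c5 using nz by (simp add: divide_simps power2_eq_square numeral_eq_Suc)
  finally show ?thesis .
qed

section \<open>Recurrences behind the continued fraction\<close>

definition qfac_plus :: "real \<Rightarrow> nat \<Rightarrow> real" where
  "qfac_plus Q n = (\<Prod>i<n. 1 + Q ^ Suc i)"

definition odd_prod :: "real \<Rightarrow> nat \<Rightarrow> nat \<Rightarrow> real" where
  "odd_prod q k n = (\<Prod>i<n. 1 + q ^ (2 * k + 1 + 2 * i))"

text \<open>In standard notation q^(n^2+2kn+2sn) (-q^(2k+1); q^2)_n / ((q^2; q^2)_n (-q^2;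
  q^2)_(n+k)). For k = 0 the denominator is (q^4; q^4)_n. Larger \<open>k\<close> serves the deeper
  tails, and \<open>s\<close> in {0, 1} distinguishes odd from even levels.\<close>

definition cf_term :: "real \<Rightarrow> nat \<Rightarrow> nat \<Rightarrow> nat \<Rightarrow> real" where
  "cf_term q s k n = q ^ (n * n + 2 * k * n + 2 * s * n) * odd_prod q k n
    / (qfac (q\<^sup>2) n * qfac_plus (q\<^sup>2) (n + k))"

definition cf_sum :: "real \<Rightarrow> nat \<Rightarrow> nat \<Rightarrow> real" where
  "cf_sum q s k = (\<Sum>n. cf_term q s k n)"

lemma qfac_plus_Suc: "qfac_plus Q (Suc n) = qfac_plus Q n * (1 + Q ^ Suc n)"
  by (simp add: qfac_plus_def)

lemma qfac_plus_ge_1: "Q \<ge> 0 \<Longrightarrow> qfac_plus Q n \<ge> 1"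
  unfolding qfac_plus_def by (intro prod_ge_1) auto

lemma qfac_plus_mono:
  assumes "Q \<ge> 0"
  shows "qfac_plus Q k \<le> qfac_plus Q (n + k)"
proof (induction n)
  case (Suc n)
  have "qfac_plus Q (n + k) * 1 \<le> qfac_plus Q (n + k) * (1 + Q ^ Suc (n + k))"
    using assms qfac_plus_ge_1[OF assms, of "n + k"] by (intro mult_left_mono) auto
  thus ?case using Suc.IH by (simp add: qfac_plus_Suc)
qed simp

lemma odd_prod_Suc: "odd_prod q k (Suc n) = odd_prod q k n * (1 + q ^ (2 * k + 1 + 2 * n))"
  by (simp add: odd_prod_def)

lemma odd_prod_Suc_shift: "odd_prod q k (Suc n) = (1 + q ^ (2 * k + 1)) * odd_prod q (Suc k) n"
proof -
  have "odd_prod q k (Suc n) = (1 + q ^ (2 * k + 1)) * (\<Prod>i<n. 1 + q ^ (2 * k + 1 + 2 * Suc i))"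
    unfolding odd_prod_def by (subst prod.lessThan_Suc_shift) simp
  thus ?thesis by (simp add: odd_prod_def)
qed

context
  fixes q :: real
  assumes q: "\<bar>q\<bar> < 1"
begin

lemma abs_power_le_1: "\<bar>q\<bar> ^ n \<le> 1"
  using q by (intro power_le_one) auto

lemma odd_prod_nonneg: "odd_prod q k n \<ge> 0"
  unfolding odd_prod_def
proof (rule prod_nonneg)
  fix i
  have "\<bar>q ^ (2 * k + 1 + 2 * i)\<bar> \<le> 1" using abs_power_le_1 by (simp only: power_abs)
  thus "0 \<le> 1 + q ^ (2 * k + 1 + 2 * i)" by linarith
qed

lemma odd_prod_le: "odd_prod q k n \<le> 2 ^ n"
proof -
  have "odd_prod q k n \<le> (\<Prod>i<n. 2)"
    unfolding odd_prod_def
  proof (rule prod_mono)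
    fix i
    have "\<bar>q ^ (2 * k + 1 + 2 * i)\<bar> \<le> 1" using abs_power_le_1 by (simp only: power_abs)
    thus "0 \<le> 1 + q ^ (2 * k + 1 + 2 * i) \<and> 1 + q ^ (2 * k + 1 + 2 * i) \<le> 2" by linarith
  qed
  thus ?thesis by simp
qed

lemma norm_square_less_1: "norm (q\<^sup>2) < 1"
  using q by (simp add: abs_square_less_1)

text \<open>The weight \<open>qfac_plus (q\<^sup>2) k\<close> normalises the series for large
  \<open>k\<close>. The factor \<open>\<bar>q\<bar> ^ (2 * k * n)\<close> is kept in the bound
  because it is what kills all terms with n > 0 as k grows.\<close>

lemma cf_term_bound:
  obtains C where "C > 0"
    "\<And>s k n. \<bar>qfac_plus (q\<^sup>2) k * cf_term q s k n\<bar> \<le> \<bar>q\<bar> ^ (2 * k * n) * (C * (2 ^ n * \<bar>q\<bar> ^ (n * n)))"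
proof -
  obtain C where C: "C > 0" "\<And>k. norm (rqfac (q\<^sup>2) k) \<le> C"
    using rqfac_bounded[OF norm_square_less_1] by blast
  show ?thesis
  proof (rule that[OF C(1)])
    fix s k n
    have "\<bar>inverse (qfac (q\<^sup>2) n)\<bar> \<le> C" using C(2)[of "int n"] by (simp add: rqfac_of_nat)
    moreover have "\<bar>qfac_plus (q\<^sup>2) k / qfac_plus (q\<^sup>2) (n + k)\<bar> \<le> 1"
      using qfac_plus_mono[of "q\<^sup>2" k n] qfac_plus_ge_1[of "q\<^sup>2" k] by (simp add: divide_simps)
    moreover have "\<bar>odd_prod q k n\<bar> \<le> 2 ^ n" using odd_prod_nonneg[of k n] odd_prod_le[of k n] by simp
    moreover have "\<bar>q ^ (2 * s * n)\<bar> \<le> 1" using abs_power_le_1 by (simp only: power_abs)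
    ultimately have "\<bar>q ^ (2 * s * n)\<bar> * \<bar>odd_prod q k n\<bar> * (\<bar>inverse (qfac (q\<^sup>2) n)\<bar> * \<bar>qfac_plus (q\<^sup>2) k / qfac_plus (q\<^sup>2) (n + k)\<bar>)
        \<le> (1 * 2 ^ n) * (C * 1)"
      using C(1) by (intro mult_mono) auto
    hence "\<bar>q\<bar> ^ (2 * k * n) * \<bar>q\<bar> ^ (n * n) * (\<bar>q ^ (2 * s * n)\<bar> * \<bar>odd_prod q k n\<bar> * (\<bar>inverse (qfac (q\<^sup>2) n)\<bar> * \<bar>qfac_plus (q\<^sup>2) k / qfac_plus (q\<^sup>2) (n + k)\<bar>))
      \<le> \<bar>q\<bar> ^ (2 * k * n) * \<bar>q\<bar> ^ (n * n) * ((1 * 2 ^ n) * (C * 1))"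
      by (intro mult_left_mono) auto
    also have "\<dots> = \<bar>q\<bar> ^ (2 * k * n) * (C * (2 ^ n * \<bar>q\<bar> ^ (n * n)))" by simp
    finally show "\<bar>qfac_plus (q\<^sup>2) k * cf_term q s k n\<bar> \<le> \<bar>q\<bar> ^ (2 * k * n) * (C * (2 ^ n * \<bar>q\<bar> ^ (n * n)))"
      by (simp add: cf_term_def abs_mult power_add power_abs divide_inverse mult_ac)
  qed
qed

lemma summable_cf_majorant: "summable (\<lambda>n. C * (2 ^ n * \<bar>q\<bar> ^ (n * n)))"
  using q by (intro summable_mult summable_power_square) auto

lemma summable_norm_cf_term: "summable (\<lambda>n. norm (cf_term q s k n))"
proof -
  obtain C where C: "C > 0"
    "\<And>s k n. \<bar>qfac_plus (q\<^sup>2) k * cf_term q s k n\<bar> \<le> \<bar>q\<bar> ^ (2 * k * n) * (C * (2 ^ n * \<bar>q\<bar> ^ (n * n)))"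
    using cf_term_bound by blast
  show ?thesis
  proof (rule summable_comparison_test'[OF summable_cf_majorant[of C]])
    fix n
    have "\<bar>cf_term q s k n\<bar> \<le> \<bar>qfac_plus (q\<^sup>2) k\<bar> * \<bar>cf_term q s k n\<bar>"
      using qfac_plus_ge_1[of "q\<^sup>2" k] mult_right_mono[of 1 "qfac_plus (q\<^sup>2) k" "\<bar>cf_term q s k n\<bar>"] by simp
    also have "\<dots> \<le> \<bar>q\<bar> ^ (2 * k * n) * (C * (2 ^ n * \<bar>q\<bar> ^ (n * n)))"
      using C(2)[of k s n] by (simp add: abs_mult)
    also have "\<dots> \<le> 1 * (C * (2 ^ n * \<bar>q\<bar> ^ (n * n)))"
      using C(1) abs_power_le_1 by (intro mult_right_mono) auto
    finally show "norm (norm (cf_term q s k n)) \<le> C * (2 ^ n * \<bar>q\<bar> ^ (n * n))" by simp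
  qed
qed

lemma cf_term_sums: "cf_term q s k sums cf_sum q s k"
  unfolding cf_sum_def by (rule summable_sums[OF summable_norm_cancel[OF summable_norm_cf_term]])

text \<open>By Tannery's theorem only the term n = 0 survives, and that term is the reciprocal of
  the weight. This fixes the behaviour of the solution at infinity, which singles out the one
  belonging to the continued fraction.\<close>

lemma cf_sum_tendsto: "(\<lambda>k. qfac_plus (q\<^sup>2) k * cf_sum q s k) \<longlonglongrightarrow> 1"
proof -
  obtain C where C: "C > 0"
    "\<And>s k n. \<bar>qfac_plus (q\<^sup>2) k * cf_term q s k n\<bar> \<le> \<bar>q\<bar> ^ (2 * k * n) * (C * (2 ^ n * \<bar>q\<bar> ^ (n * n)))"
    using cf_term_bound by blast
  define M where "M = (\<lambda>n. C * (2 ^ n * \<bar>q\<bar> ^ (n * n)))"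
  have M: "summable M" unfolding M_def by (rule summable_cf_majorant)
  have bd: "\<bar>qfac_plus (q\<^sup>2) k * cf_term q s k n\<bar> \<le> M n" for k n
  proof -
    have "\<bar>q\<bar> ^ (2 * k * n) * M n \<le> 1 * M n"
      using C(1) abs_power_le_1 by (intro mult_right_mono) (auto simp: M_def)
    thus ?thesis using C(2)[of k s n] by (simp add: M_def)
  qed
  have "(\<lambda>k. \<Sum>n. qfac_plus (q\<^sup>2) k * cf_term q s k n) \<longlonglongrightarrow> (\<Sum>n. if n = 0 then 1 else 0)"
  proof (rule tannerys_theorem[THEN conjunct2, THEN conjunct2])
    show "\<forall>\<^sub>F (n, k) in at_top \<times>\<^sub>F sequentially. norm (qfac_plus (q\<^sup>2) k * cf_term q s k n) \<le> M n"
      using bd by (intro always_eventually) auto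
    fix n
    show "(\<lambda>k. qfac_plus (q\<^sup>2) k * cf_term q s k n) \<longlonglongrightarrow> (if n = 0 then 1 else 0)"
    proof (cases "n = 0")
      case True
      have "qfac_plus (q\<^sup>2) k \<noteq> 0" for k using qfac_plus_ge_1[of "q\<^sup>2" k] by auto
      thus ?thesis using True by (simp add: cf_term_def odd_prod_def)
    next
      case False
      have "(\<lambda>k. (\<bar>q\<bar> ^ (2 * n)) ^ k * M n) \<longlonglongrightarrow> 0 * M n"
        using q False by (intro tendsto_intros LIMSEQ_realpow_zero) (auto simp: power_less_one_iff)
      hence "(\<lambda>k. \<bar>q\<bar> ^ (2 * k * n) * M n) \<longlonglongrightarrow> 0" by (simp add: mult_ac flip: power_mult)
      hence "(\<lambda>k. qfac_plus (q\<^sup>2) k * cf_term q s k n) \<longlonglongrightarrow> 0"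
        by (rule Lim_null_comparison[rotated]) (use C(2)[of _ s n] in \<open>auto simp: M_def\<close>)
      thus ?thesis using False by simp
    qed
  qed (auto simp: M)
  moreover have "(\<Sum>n. qfac_plus (q\<^sup>2) k * cf_term q s k n) = qfac_plus (q\<^sup>2) k * cf_sum q s k" for k
    by (rule sums_unique[symmetric, OF sums_mult[OF cf_term_sums]])
  moreover have "(\<Sum>n. if n = 0 then 1 else 0 :: real) = 1"
    using sums_If_finite_set[of "{0}" "\<lambda>_. 1 :: real"] by (intro sums_unique[symmetric]) simp
  ultimately show ?thesis by simp
qed

lemma cf_term_1: "cf_term q 1 k n = cf_term q 0 k n * (q\<^sup>2) ^ n"
  by (simp add: cf_term_def power_add power_mult)

text \<open>Termwise: the difference of the terms for s = 0 and s = 1 carries 1 - q^(2n), which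
  cancels the last factor of \<open>qfac\<close> and allows an index shift; the first factor 1 +
  q^(2k+1) of \<open>odd_prod\<close> completes the partial numerator.\<close>

lemma cf_sum_rec_odd:
  "cf_sum q 0 k = cf_sum q 1 k + (q ^ (2 * k + 1) + q ^ (2 * (2 * k + 1))) * cf_sum q 0 (Suc k)"
proof -
  define c where "c = q ^ (2 * k + 1) + q ^ (2 * (2 * k + 1))"
  define d where "d = (\<lambda>n. cf_term q 0 k n - cf_term q 1 k n)"
  have "d (Suc n) = c * cf_term q 0 (Suc k) n" for n
  proof -
    define x y where "x = q ^ n" and "y = q ^ k"
    have nz: "qfac (q\<^sup>2) n \<noteq> 0" "1 - (q\<^sup>2) ^ Suc n \<noteq> 0" "qfac_plus (q\<^sup>2) (Suc n + k) \<noteq> 0"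
      using qfac_nonzero[OF norm_square_less_1] one_minus_power_nonzero[OF norm_square_less_1, of "Suc n"]
        qfac_plus_ge_1[of "q\<^sup>2" "Suc n + k"] by auto
    define K where "K = odd_prod q (Suc k) n / (qfac (q\<^sup>2) n * qfac_plus (q\<^sup>2) (Suc n + k)) * (q ^ (n * n + 2 * k * n))"
    have "d (Suc n) = q ^ (Suc n * Suc n + 2 * k * Suc n) * (1 - (q\<^sup>2) ^ Suc n) * odd_prod q k (Suc n)
        / (qfac (q\<^sup>2) (Suc n) * qfac_plus (q\<^sup>2) (Suc n + k))"
      unfolding d_def cf_term_1 by (simp add: cf_term_def algebra_simps diff_divide_distrib)
    also have "\<dots> = q ^ (Suc n * Suc n + 2 * k * Suc n) * (1 + q ^ (2 * k + 1)) *
       odd_prod q (Suc k) n / (qfac (q\<^sup>2) n * qfac_plus (q\<^sup>2) (Suc n + k))"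
      unfolding qfac_Suc odd_prod_Suc_shift using nz by simp
    also have "q ^ (Suc n * Suc n + 2 * k * Suc n) = q ^ (n * n + 2 * k * n) * (x\<^sup>2 * y\<^sup>2 * q)"
      by (simp add: x_def y_def power_add power_mult power2_eq_square power_mult_distrib)
    also have "(1 + q ^ (2 * k + 1)) = 1 + y\<^sup>2 * q"
      by (simp add: y_def power_mult power_mult_distrib flip: power_mult) (simp add: mult.commute)
    also have "q ^ (n * n + 2 * k * n) * (x\<^sup>2 * y\<^sup>2 * q) * (1 + y\<^sup>2 * q) *
       odd_prod q (Suc k) n / (qfac (q\<^sup>2) n * qfac_plus (q\<^sup>2) (Suc n + k)) = K * (x\<^sup>2 * y\<^sup>2 * q * (1 + y\<^sup>2 * q))"
      by (simp add: K_def)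
    also have "\<dots> = K * x\<^sup>2 * (y\<^sup>2 * q + (y\<^sup>2 * q)\<^sup>2)"
      by (simp add: algebra_simps power2_eq_square)
    also have "\<dots> = c * cf_term q 0 (Suc k) n"
    proof -
      have "c = y\<^sup>2 * q + (y\<^sup>2 * q)\<^sup>2"
      proof -
        have "q ^ (2 * k + 1) = y\<^sup>2 * q" by (simp add: y_def mult.commute flip: power_mult)
        moreover have "q ^ (2 * (2 * k + 1)) = (q ^ (2 * k + 1))\<^sup>2" by (simp only: power_mult[symmetric] mult.commute)
        ultimately show ?thesis by (simp only: c_def)
      qed
      moreover have "cf_term q 0 (Suc k) n = K * x\<^sup>2"
        by (simp add: cf_term_def K_def x_def power_add mult_ac flip: power_mult)
      ultimately show ?thesis by simp
    qed
    finally show ?thesis .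
  qed
  moreover have "d sums (cf_sum q 0 k - cf_sum q 1 k)"
    unfolding d_def by (intro sums_diff cf_term_sums)
  hence "(\<lambda>n. d (Suc n)) sums (cf_sum q 0 k - cf_sum q 1 k - d 0)"
    by (simp add: sums_Suc_iff)
  moreover have "d 0 = 0" by (simp add: d_def cf_term_def)
  moreover have "(\<lambda>n. c * cf_term q 0 (Suc k) n) sums (c * cf_sum q 0 (Suc k))"
    by (intro sums_mult cf_term_sums)
  ultimately have "cf_sum q 0 k - cf_sum q 1 k = c * cf_sum q 0 (Suc k)"
    by (simp add: sums_unique2)
  thus ?thesis by (simp add: c_def)
qed

text \<open>No single index shift works here. The two halves of the partial numerator are treated
  differently: the series multiplied by q^(4k+4) is moved up by one index, which is
  \<open>g\<close>, while the one multiplied by q^(2k+2) stays in place. Then the identity holds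
  term by term.\<close>

lemma cf_sum_rec_even:
  "cf_sum q 1 k = cf_sum q 0 (Suc k) + (q ^ (2 * k + 2) + q ^ (2 * (2 * k + 2))) * cf_sum q 1 (Suc k)"
proof -
  define c where "c = q ^ (2 * k + 2) + q ^ (2 * (2 * k + 2))"
  define g where "g = (\<lambda>n. case n of 0 \<Rightarrow> 0 | Suc n \<Rightarrow> q ^ (4 * k + 4) * cf_term q 1 (Suc k) n)"
  have eq: "cf_term q 1 k n - g n = cf_term q 0 (Suc k) n + q ^ (2 * k + 2) * cf_term q 1 (Suc k) n" for n
  proof (cases n)
    case 0
    define Q where "Q = (q\<^sup>2) ^ Suc k"
    have "q ^ (2 * k + 2) = Q" by (simp add: Q_def power_add power_mult power2_eq_square)
    moreover have "qfac_plus (q\<^sup>2) (Suc k) = qfac_plus (q\<^sup>2) k * (1 + Q)"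
      unfolding Q_def by (rule qfac_plus_Suc)
    moreover have "qfac_plus (q\<^sup>2) k > 0" "1 + Q > 0"
      using qfac_plus_ge_1[of "q\<^sup>2" k] by (auto simp: Q_def intro: add_pos_nonneg)
    ultimately show ?thesis
      by (simp add: 0 g_def cf_term_def odd_prod_def divide_simps)
  next
    case (Suc m)
    define x y where "x = q ^ m" and "y = q ^ k"
    define u v where "u = 1 - q\<^sup>2 * x\<^sup>2" and "v = 1 + x\<^sup>2 * y\<^sup>2 * q ^ 4"
    have uv: "(q\<^sup>2) ^ Suc m = q\<^sup>2 * x\<^sup>2" "(q\<^sup>2) ^ Suc (Suc m + k) = x\<^sup>2 * y\<^sup>2 * q ^ 4"
    proof -
      have "2 * Suc m = 2 + m * 2" "2 * Suc (Suc m + k) = m * 2 + k * 2 + 4" by simp_all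
      thus "(q\<^sup>2) ^ Suc m = q\<^sup>2 * x\<^sup>2" "(q\<^sup>2) ^ Suc (Suc m + k) = x\<^sup>2 * y\<^sup>2 * q ^ 4"
        unfolding power_mult[symmetric] x_def y_def by (simp_all only: power_add)
    qed
    have "0 \<le> x\<^sup>2 * y\<^sup>2 * q ^ 4" by simp
    hence v: "v \<noteq> 0" unfolding v_def by linarith
    have nz: "qfac (q\<^sup>2) m \<noteq> 0" "u \<noteq> 0" "qfac_plus (q\<^sup>2) (Suc m + k) \<noteq> 0"
      using qfac_nonzero[OF norm_square_less_1] one_minus_power_nonzero[OF norm_square_less_1, of "Suc m"]
        qfac_plus_ge_1[of "q\<^sup>2" "Suc m + k"] uv(1)
      by (auto simp: u_def)
    define K where "K = odd_prod q (Suc k) m / (qfac (q\<^sup>2) m * qfac_plus (q\<^sup>2) (Suc m + k)) * q ^ (m * m + 2 * k * m)"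
    define Z where "Z = x ^ 4 * y\<^sup>2 * q ^ 3"
    have e1: "q ^ (Suc m * Suc m + 2 * k * Suc m + 2 * 1 * Suc m) = q ^ (m * m + 2 * k * m) * Z"
    proof -
      have "Suc m * Suc m + 2 * k * Suc m + 2 * 1 * Suc m = (m * m + 2 * k * m) + (m * 4 + k * 2 + 3)"
        by (simp add: algebra_simps)
      thus ?thesis by (simp only: power_add power_mult Z_def x_def y_def)
    qed
    have "cf_term q 1 k (Suc m) = q ^ (m * m + 2 * k * m) * Z * ((1 + q ^ (2 * k + 1)) * odd_prod q (Suc k) m)
        / (qfac (q\<^sup>2) m * u * qfac_plus (q\<^sup>2) (Suc m + k))"
      unfolding cf_term_def e1 odd_prod_Suc_shift qfac_Suc u_def uv ..
    also have "1 + q ^ (2 * k + 1) = 1 + y\<^sup>2 * q"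
      by (simp add: y_def mult.commute flip: power_mult)
    finally have t1: "cf_term q 1 k (Suc m) = K * Z * (1 + y\<^sup>2 * q) / u"
      by (simp add: K_def mult_ac)
    have e2: "q ^ (Suc m * Suc m + 2 * Suc k * Suc m + 2 * 0 * Suc m) = q ^ (m * m + 2 * k * m) * Z"
      using e1 by (simp add: algebra_simps)
    have p: "odd_prod q (Suc k) (Suc m) = odd_prod q (Suc k) m * (1 + y\<^sup>2 * x\<^sup>2 * q ^ 3)"
    proof -
      have "2 * Suc k + 1 + 2 * m = k * 2 + m * 2 + 3" by simp
      thus ?thesis unfolding odd_prod_Suc x_def y_def by (simp only: power_add power_mult)
    qed
    have "qfac_plus (q\<^sup>2) (Suc m + Suc k) = qfac_plus (q\<^sup>2) (Suc m + k) * v"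
      using qfac_plus_Suc[of "q\<^sup>2" "Suc m + k"] by (simp only: uv v_def add_Suc_right)
    hence t2: "cf_term q 0 (Suc k) (Suc m) = K * Z * (1 + y\<^sup>2 * x\<^sup>2 * q ^ 3) / (u * v)"
      unfolding cf_term_def e2 p qfac_Suc uv by (simp add: K_def u_def mult_ac)
    have t3: "cf_term q 1 (Suc k) (Suc m) = K * Z * (1 + y\<^sup>2 * x\<^sup>2 * q ^ 3) / (u * v) * (q\<^sup>2 * x\<^sup>2)"
      by (simp only: cf_term_1 t2 uv)
    have t4: "g (Suc m) = K * Z * (y\<^sup>2 * q)"
    proof -
      have "4 * k + 4 + (m * m + 2 * Suc k * m + 2 * 1 * m) = (m * m + 2 * k * m) + (m * 4 + k * 4 + 4)"
        by (simp add: algebra_simps)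
      hence "q ^ (4 * k + 4) * q ^ (m * m + 2 * Suc k * m + 2 * 1 * m) = q ^ (m * m + 2 * k * m) * (x ^ 4 * y ^ 4 * q ^ 4)"
        unfolding power_add[symmetric] by (simp only: power_add power_mult x_def y_def)
      hence "g (Suc m) = q ^ (m * m + 2 * k * m) * (x ^ 4 * y ^ 4 * q ^ 4) * odd_prod q (Suc k) m
          / (qfac (q\<^sup>2) m * qfac_plus (q\<^sup>2) (m + Suc k))"
        by (simp add: g_def cf_term_def)
      thus ?thesis by (simp add: K_def Z_def numeral_eq_Suc mult_ac)
    qed
    have y2: "q ^ (2 * k + 2) = y\<^sup>2 * q\<^sup>2"
      by (simp only: y_def power_add power_mult mult.commute[of 2 k])
    have "K * Z * (1 + y\<^sup>2 * x\<^sup>2 * q ^ 3) / (u * v) + y\<^sup>2 * q\<^sup>2 * (K * Z * (1 + y\<^sup>2 * x\<^sup>2 * q ^ 3) / (u * v) * (q\<^sup>2 * x\<^sup>2))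
       = K * Z * (1 + y\<^sup>2 * x\<^sup>2 * q ^ 3) / (u * v) * v"
    proof -
      have "W + y\<^sup>2 * q\<^sup>2 * (W * (q\<^sup>2 * x\<^sup>2)) = W * v" for W
        by (simp add: v_def algebra_simps numeral_eq_Suc)
      thus ?thesis .
    qed
    also have "\<dots> = K * Z * ((1 + y\<^sup>2 * q) - y\<^sup>2 * q * u) / u"
    proof -
      have "(1 + y\<^sup>2 * q) - y\<^sup>2 * q * u = 1 + y\<^sup>2 * x\<^sup>2 * q ^ 3"
        by (simp add: u_def algebra_simps numeral_eq_Suc)
      thus ?thesis using v by simp
    qed
    also have "\<dots> = K * Z * (1 + y\<^sup>2 * q) / u - K * Z * (y\<^sup>2 * q)"
      using nz by (simp add: diff_divide_distrib right_diff_distrib)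
    finally show ?thesis unfolding Suc t1 t2 t3 t4 y2 by simp
  qed
  have "(\<lambda>n. g (Suc n)) sums (q ^ (4 * k + 4) * cf_sum q 1 (Suc k))"
    unfolding g_def by (simp only: nat.case) (intro sums_mult cf_term_sums)
  hence "g sums (q ^ (4 * k + 4) * cf_sum q 1 (Suc k))"
    using sums_Suc_iff[of g] by (simp add: g_def)
  hence "(\<lambda>n. cf_term q 1 k n - g n) sums (cf_sum q 1 k - q ^ (4 * k + 4) * cf_sum q 1 (Suc k))"
    by (intro sums_diff cf_term_sums)
  moreover have "(\<lambda>n. cf_term q 0 (Suc k) n + q ^ (2 * k + 2) * cf_term q 1 (Suc k) n) sums
      (cf_sum q 0 (Suc k) + q ^ (2 * k + 2) * cf_sum q 1 (Suc k))"
    by (intro sums_add sums_mult cf_term_sums)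
  ultimately have "cf_sum q 1 k - q ^ (4 * k + 4) * cf_sum q 1 (Suc k) =
      cf_sum q 0 (Suc k) + q ^ (2 * k + 2) * cf_sum q 1 (Suc k)"
    unfolding eq by (rule sums_unique2)
  moreover have e4: "2 * (2 * k + 2) = 4 * k + 4" by simp
  ultimately show ?thesis unfolding e4 distrib_right by linarith
qed

end

section \<open>Convergence of the continued fraction\<close>

lemma prod_tendsto_0:
  fixes f :: "nat \<Rightarrow> real"
  assumes "f \<longlonglongrightarrow> 0" and nn: "\<And>n. f n \<ge> 0"
  shows "(\<lambda>n. \<Prod>i<n. f i) \<longlonglongrightarrow> 0"
proof -
  have "eventually (\<lambda>n. f n < 1/2) sequentially"
    using assms by (intro order_tendstoD) auto
  then obtain N where N: "\<And>n. n \<ge> N \<Longrightarrow> f n < 1/2" by (auto simp: eventually_sequentially)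
  have "summable (\<lambda>n. \<Prod>i<n. f i)"
  proof (rule summable_ratio_test[of "1/2" N])
    fix n assume "N \<le> n"
    hence "(\<Prod>i<n. f i) * f n \<le> (\<Prod>i<n. f i) * (1/2)"
      using N[of n] nn by (intro mult_left_mono prod_nonneg) auto
    moreover have "(\<Prod>i<n. f i) \<ge> 0" using nn by (intro prod_nonneg) auto
    ultimately show "norm (\<Prod>i<Suc n. f i) \<le> 1/2 * norm (\<Prod>i<n. f i)"
      using nn[of n] by (simp add: abs_mult)
  qed auto
  thus ?thesis by (rule summable_LIMSEQ_zero)
qed

text \<open>Interleaves the two families so that both recurrences become one: level 2k+1 is s = 0
  and level 2k+2 is s = 1, both with parameter k. Levels start at 1; at 0 the truncated subtraction
  gives a value without meaning for the recurrence.\<close>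

definition cf_seq :: "real \<Rightarrow> nat \<Rightarrow> real" where
  "cf_seq q m = cf_sum q (if even m then 1 else 0) ((m - 1) div 2)"

lemma partial_numerator_ge: "q ^ m + q ^ (2 * m) \<ge> - (1/4 :: real)"
proof -
  have "0 \<le> (q ^ m + 1/2)\<^sup>2" by simp
  thus ?thesis by (simp add: power2_sum power_divide power_mult[symmetric] mult.commute)
qed

text \<open>1/2 is the fixed point of t -> 1 - (1/4)/t, so the bound reproduces itself at every
  level; in particular no denominator vanishes.\<close>

lemma cf_tail_ge: "cf_tail q n m \<ge> 1/2"
proof (induction n arbitrary: m)
  case (Suc n)
  have "(q ^ m + q ^ (2 * m)) / cf_tail q n (Suc m) \<ge> - 1/2"
    using Suc[of "Suc m"] partial_numerator_ge[of q m] by (simp add: field_simps)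
  thus ?case unfolding cf_tail.simps by linarith
qed simp

context
  fixes q :: real
  assumes q: "\<bar>q\<bar> < 1"
begin

lemma cf_seq_rec:
  assumes "m \<ge> 1"
  shows "cf_seq q m = cf_seq q (m + 1) + (q ^ m + q ^ (2 * m)) * cf_seq q (m + 2)"
proof (cases "even m")
  case True
  then obtain j where j: "m = 2 * j" by (elim evenE)
  with assms obtain k where "j = Suc k" by (cases j) auto
  hence "m = 2 * k + 2" using j by simp
  thus ?thesis using cf_sum_rec_even[OF q, of k] by (simp add: cf_seq_def)
next
  case False
  then obtain k where "m = 2 * k + 1" by (elim oddE)
  thus ?thesis using cf_sum_rec_odd[OF q, of k] by (simp add: cf_seq_def)
qed

lemma cf_seq_eventually:
  "eventually (\<lambda>m. cf_seq q (m + 1) > 0 \<and> cf_seq q m \<ge> cf_seq q (m + 1) / 2) sequentially"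
proof -
  define P where "P = qfac_plus (q\<^sup>2)"
  have P1: "P k \<ge> 1" for k unfolding P_def by (rule qfac_plus_ge_1) simp
  have Pm: "P k \<le> P (Suc k)" for k
    unfolding P_def using qfac_plus_mono[of "q\<^sup>2" k 1] by simp
  have "eventually (\<lambda>k. \<bar>P k * cf_sum q s k - 1\<bar> < 1/4) sequentially" for s
    using tendstoD[OF cf_sum_tendsto[OF q, of s], of "1/4"] by (simp add: P_def dist_real_def)
  from eventually_conj[OF this[of 0] this[of 1]] obtain N where
    N: "\<forall>k\<ge>N. \<bar>P k * cf_sum q 0 k - 1\<bar> < 1/4 \<and> \<bar>P k * cf_sum q 1 k - 1\<bar> < 1/4"
    unfolding eventually_sequentially by blast
  show ?thesis
  proof (rule eventually_sequentiallyI[of "2 * N + 2"])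
    fix m assume m: "2 * N + 2 \<le> m"
    \<comment> \<open>\<open>p\<close> and \<open>p'\<close> are weights at neighbouring levels: p b
      / 2 <= p' b / 2 < 5/8 < 3/4 < p a.\<close>
    have quarter: "b > 0 \<and> a \<ge> b / 2"
      if "\<bar>p * a - 1\<bar> < 1/4" "\<bar>p' * b - 1\<bar> < 1/4" "1 \<le> p" "p \<le> p'" for a b p p' :: real
    proof -
      have "p * a > 3/4" "p' * b > 3/4" "p' * b < 5/4" using that by linarith+
      moreover have b: "b > 0"
      proof (rule ccontr)
        assume "\<not> b > 0"
        hence "p' * b \<le> 0" using that by (intro mult_nonneg_nonpos) auto
        thus False using calculation by linarith
      qed
      moreover have "p * b \<le> p' * b" using that b by (intro mult_right_mono) auto
      moreover have "p * (b / 2) = p * b / 2" by simp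
      ultimately have "p * (b / 2) \<le> p * a" by linarith
      thus ?thesis using b that by simp
    qed
    show "cf_seq q (m + 1) > 0 \<and> cf_seq q m \<ge> cf_seq q (m + 1) / 2"
    proof (cases "even m")
      case True
      then obtain j where "m = 2 * j" by (elim evenE)
      moreover then obtain k where "j = Suc k" using m by (cases j) auto
      ultimately have k: "m = 2 * Suc k" by simp
      have "cf_seq q m = cf_sum q 1 k" "cf_seq q (m + 1) = cf_sum q 0 (Suc k)"
        by (auto simp: k cf_seq_def)
      moreover have "N \<le> k" "N \<le> Suc k" using m k by auto
      ultimately show ?thesis
        using quarter[of "P k" "cf_sum q 1 k" "P (Suc k)" "cf_sum q 0 (Suc k)"] N P1[of k] Pm[of k] by simp
    next
      case False
      then obtain k where k: "m = 2 * k + 1" by (elim oddE)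
      have "cf_seq q m = cf_sum q 0 k" "cf_seq q (m + 1) = cf_sum q 1 k"
        by (auto simp: k cf_seq_def)
      moreover have "N \<le> k" using m k by auto
      ultimately show ?thesis
        using quarter[of "P k" "cf_sum q 0 k" "P k" "cf_sum q 1 k"] N P1[of k] by simp
    qed
  qed
qed

text \<open>Descending induction from the range where the limit behaviour decides. With f =
  \<open>cf_seq q\<close>, f(m) >= f(m+1) - f(m+2)/4 and f(m+2) <= 2 f(m+1) give f(m) >= f(m+1)/2,
  so the ratio bound 1/2 propagates down to level 1.\<close>

lemma cf_seq_pos:
  assumes "m \<ge> 1"
  shows "cf_seq q (m + 1) > 0" "cf_seq q m \<ge> cf_seq q (m + 1) / 2"
proof -
  obtain N where N: "\<forall>m\<ge>N. cf_seq q (m + 1) > 0 \<and> cf_seq q m \<ge> cf_seq q (m + 1) / 2"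
    using cf_seq_eventually unfolding eventually_sequentially by blast
  have "cf_seq q (m + 1) > 0 \<and> cf_seq q m \<ge> cf_seq q (m + 1) / 2"
  proof (cases "m \<le> N")
    case True
    thus ?thesis using assms
    proof (induction m rule: inc_induct)
      case base
      show ?case using N by simp
    next
      case (step k)
      hence IH: "cf_seq q (k + 2) > 0" "cf_seq q (k + 1) \<ge> cf_seq q (k + 2) / 2" by simp_all
      have "(q ^ k + q ^ (2 * k)) * cf_seq q (k + 2) \<ge> (- (1/4)) * cf_seq q (k + 2)"
        using IH(1) partial_numerator_ge[of q k] by (intro mult_right_mono) auto
      thus ?case using IH cf_seq_rec[of k] step by simp
    qed
  qed (use N in auto)
  thus "cf_seq q (m + 1) > 0" "cf_seq q m \<ge> cf_seq q (m + 1) / 2" by auto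
qed

lemma cf_tail_tendsto:
  "(\<lambda>n. cf_tail q n 1) \<longlonglongrightarrow> cf_sum q 0 0 / cf_sum q 1 0"
proof -
  define a where "a = (\<lambda>m. q ^ m + q ^ (2 * m))"
  \<comment> \<open>The ratios satisfy the recursion of the infinite tails exactly, so they are the
    candidates for the limits.\<close>
  define e where "e = (\<lambda>m. cf_seq q m / cf_seq q (m + 1))"
  have e_ge: "e m \<ge> 1/2" if "m \<ge> 1" for m
    using cf_seq_pos[OF that] by (simp add: e_def field_simps)
  have e_rec: "e m = 1 + a m / e (m + 1)" if "m \<ge> 1" for m
  proof -
    have "cf_seq q (m + 1) > 0" "cf_seq q (m + 2) > 0" using cf_seq_pos(1)[of m] cf_seq_pos(1)[of "m + 1"] that by auto
    thus ?thesis using cf_seq_rec[OF that] by (simp add: e_def a_def add_divide_distrib)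
  qed
  have a_le: "\<bar>a m\<bar> \<le> 2" for m
  proof -
    have "\<bar>q ^ m\<bar> \<le> 1" "\<bar>q ^ (2 * m)\<bar> \<le> 1"
      using abs_power_le_1[OF q] by (simp_all only: power_abs)
    thus ?thesis unfolding a_def by linarith
  qed
  have e_le: "\<bar>1 - e m\<bar> \<le> 4" if "m \<ge> 1" for m
  proof -
    have "\<bar>a m / e (m + 1)\<bar> \<le> 2 / (1/2)"
      unfolding abs_divide using a_le[of m] e_ge[of "m + 1"] by (intro frac_le) auto
    thus ?thesis using e_rec[OF that] by simp
  qed
  \<comment> \<open>Each level multiplies the error by at most 4|a|, since both denominators are at
    least 1/2. Early factors may exceed 1, but a tends to 0 and hence so does the product. The final
    4 bounds the error of the tail cut to 1.\<close>
  have bound: "\<bar>cf_tail q n m - e m\<bar> \<le> (\<Prod>i<n. 4 * \<bar>a (m + i)\<bar>) * 4" if "m \<ge> 1" for n m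
    using that
  proof (induction n arbitrary: m)
    case 0
    thus ?case using e_le[of m] by simp
  next
    case (Suc n)
    define c where "c = cf_tail q n (m + 1)"
    have c: "c \<ge> 1/2" unfolding c_def by (rule cf_tail_ge)
    have e: "e (m + 1) \<ge> 1/2" by (rule e_ge) simp
    have "cf_tail q (Suc n) m - e m = a m / c - a m / e (m + 1)"
      using e_rec[OF Suc.prems] by (simp add: a_def c_def)
    also have "\<dots> = a m * (e (m + 1) - c) / (c * e (m + 1))"
      using c e by (simp add: field_simps)
    finally have "\<bar>cf_tail q (Suc n) m - e m\<bar> = \<bar>a m\<bar> * \<bar>e (m + 1) - c\<bar> / (c * e (m + 1))"
      using c e by (simp add: abs_mult)
    also have "\<dots> \<le> \<bar>a m\<bar> * \<bar>e (m + 1) - c\<bar> / ((1/2) * (1/2))"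
      using c e by (intro divide_left_mono mult_mono) auto
    also have "\<dots> = 4 * \<bar>a m\<bar> * \<bar>c - e (m + 1)\<bar>" by (simp add: abs_minus_commute)
    also have "\<dots> \<le> 4 * \<bar>a m\<bar> * ((\<Prod>i<n. 4 * \<bar>a (m + 1 + i)\<bar>) * 4)"
      using Suc.IH[of "m + 1"] by (intro mult_left_mono) (auto simp: c_def)
    also have "\<dots> = (\<Prod>i<Suc n. 4 * \<bar>a (m + i)\<bar>) * 4"
      by (subst prod.lessThan_Suc_shift) simp
    finally show ?case .
  qed
  have "(\<lambda>n. 4 * \<bar>a (1 + n)\<bar>) \<longlonglongrightarrow> 4 * \<bar>0 + 0\<bar>"
  proof -
    have "(\<lambda>n. q ^ n) \<longlonglongrightarrow> 0" using q by (intro LIMSEQ_power_zero) auto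
    moreover have "(\<lambda>n. (q ^ 2) ^ n) \<longlonglongrightarrow> 0" using norm_square_less_1[OF q] by (rule LIMSEQ_power_zero)
    ultimately have "a \<longlonglongrightarrow> 0 + 0" unfolding a_def power_mult by (intro tendsto_add) auto
    hence "(\<lambda>n. a (1 + n)) \<longlonglongrightarrow> 0 + 0" by (simp add: filterlim_sequentially_Suc)
    thus ?thesis by (intro tendsto_intros)
  qed
  hence "(\<lambda>n. \<Prod>i<n. 4 * \<bar>a (1 + i)\<bar>) \<longlonglongrightarrow> 0" by (intro prod_tendsto_0) auto
  hence "(\<lambda>n. (\<Prod>i<n. 4 * \<bar>a (1 + i)\<bar>) * 4) \<longlonglongrightarrow> 0" by (auto intro: tendsto_mult_left_zero)
  hence "(\<lambda>n. cf_tail q n 1 - e 1) \<longlonglongrightarrow> 0"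
    by (rule Lim_null_comparison[rotated]) (use bound[of 1] in auto)
  hence "(\<lambda>n. cf_tail q n 1) \<longlonglongrightarrow> e 1" by (simp add: LIM_zero_iff)
  thus ?thesis by (simp add: e_def cf_seq_def)
qed

lemma V_conv_tendsto_cf_sum: "V_conv q \<longlonglongrightarrow> root 3 q * (cf_sum q 1 0 / cf_sum q 0 0)"
  and cf_sum_nonzero: "cf_sum q 0 0 \<noteq> 0"
proof -
  have "cf_seq q 1 \<ge> cf_seq q 2 / 2" "cf_seq q 2 > 0" using cf_seq_pos[of 1] by (simp_all add: numeral_2_eq_2)
  hence pos: "cf_sum q 0 0 > 0" "cf_sum q 1 0 > 0" by (simp_all add: cf_seq_def)
  thus "cf_sum q 0 0 \<noteq> 0" by simp
  have "(\<lambda>n. root 3 q / cf_tail q n 1) \<longlonglongrightarrow> root 3 q / (cf_sum q 0 0 / cf_sum q 1 0)"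
    using pos by (intro tendsto_divide tendsto_const cf_tail_tendsto) auto
  thus "V_conv q \<longlonglongrightarrow> root 3 q * (cf_sum q 1 0 / cf_sum q 0 0)"
    using pos by (simp add: V_conv_def[abs_def])
qed

end

section \<open>The continued fraction as a quotient of theta functions\<close>

lemma alternating_powi_neg_one: "(- 1 :: real) powi (- 1 - r) = - ((- 1) powi r)"
proof -
  have "(- 1 :: real) powi r * (- 1) powi r = ((- 1) * (- 1)) powi r"
    by (rule power_int_mult_distrib[symmetric])
  hence "(- 1 :: real) powi r * (- 1) powi r = 1" by simp
  hence "inverse ((- 1 :: real) powi r) = (- 1) powi r" by (metis inverse_unique)
  thus ?thesis by (simp add: power_int_diff divide_inverse)
qed

lemma has_sum_diff:
  fixes f g :: "'i \<Rightarrow> real"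
  assumes "(f has_sum a) A" "(g has_sum b) A"
  shows "((\<lambda>x. f x - g x) has_sum a - b) A"
  using has_sum_add[OF assms(1) has_sum_cmult_right[OF assms(2), of "- 1"]] by simp

context
  fixes Q :: real
  assumes Q: "Q \<noteq> 0" "\<bar>Q\<bar> < 1"
begin

text \<open>The kernel of Bailey's transform with a = 1, symmetric in \<open>r\<close> and zero for
  |r| > n.\<close>

definition bailey :: "nat \<Rightarrow> int \<Rightarrow> real" where
  "bailey n r = rqfac Q (int n - r) * rqfac Q (int n + r)"

lemma bailey_neg: "bailey n (- r) = bailey n r"
  by (simp add: bailey_def)

lemma bailey_eq_0: "\<bar>r\<bar> > int n \<Longrightarrow> bailey n r = 0"
  by (cases "r > 0") (auto simp: bailey_def)

lemma summable_on_times_bailey: "(\<lambda>r. f r * bailey n r) summable_on UNIV"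
proof (rule finite_nonzero_values_imp_summable_on)
  have "{x \<in> UNIV. f x * bailey n x \<noteq> 0} \<subseteq> {- int n..int n}"
    using bailey_eq_0[of n] by force
  thus "finite {x \<in> UNIV. f x * bailey n x \<noteq> 0}" by (rule finite_subset) simp
qed

text \<open>The beta side of a Bailey pair whose alpha side is (-1)^r Q^(r^2+sr); it has a closed
  form for s = 0 and s = 1.\<close>

definition gauss_sum :: "nat \<Rightarrow> nat \<Rightarrow> real" where
  "gauss_sum s n = (\<Sum>\<^sub>\<infinity>r. (- 1) powi r * Q powi (r * r + int s * r) * bailey n r)"

lemma gauss_sum_has_sum:
  "((\<lambda>r. (- 1) powi r * Q powi (r * r + int s * r) * bailey n r) has_sum gauss_sum s n) UNIV"
  unfolding gauss_sum_def by (intro has_sum_infsum summable_on_times_bailey)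

text \<open>The difference of the two sides is the sum of \<open>f\<close>, and \<open>f\<close>
  changes sign under r -> -1 - r, so that sum equals its own negative.\<close>

lemma gauss_sum_1: "gauss_sum 1 n = Q ^ n * gauss_sum 0 n"
proof -
  have nQ: "norm Q < 1" using Q by simp
  define f where "f = (\<lambda>r. (- 1) powi r * Q powi (r * r + r) * (rqfac Q (int n - r - 1) * rqfac Q (int n + r)))"
  have eq: "f r = (- 1) powi r * Q powi (r * r + int 1 * r) * bailey n r
      - Q ^ n * ((- 1) powi r * Q powi (r * r + int 0 * r) * bailey n r)" for r
  proof -
    have "rqfac Q (int n - r - 1) = (1 - Q powi (int n - r)) * rqfac Q (int n - r)"
      by (rule rqfac_diff_one[OF nQ])
    moreover have "Q powi (r * r + r) * Q powi (int n - r) = Q ^ n * Q powi (r * r)"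
      using Q by (simp add: power_int_add power_int_diff)
    moreover have "s * A * ((1 - X) * a * b) = s * A * (a * b) - P * (s * B * (a * b))"
      if "A * X = P * B" for s A X a b P B :: real
    proof -
      have "s * A * ((1 - X) * a * b) = s * A * (a * b) - s * (A * X) * (a * b)" by (simp add: algebra_simps)
      thus ?thesis unfolding that by (simp add: mult_ac)
    qed
    ultimately show ?thesis by (simp add: f_def bailey_def)
  qed
  have f: "(f has_sum gauss_sum 1 n - Q ^ n * gauss_sum 0 n) UNIV"
    by (subst has_sum_cong[OF eq])
       (rule has_sum_diff[OF gauss_sum_has_sum[of 1 n] has_sum_cmult_right[OF gauss_sum_has_sum[of 0 n], of "Q ^ n"]])
  have "((\<lambda>r. f (- 1 - r)) has_sum gauss_sum 1 n - Q ^ n * gauss_sum 0 n) UNIV"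
    using f by (subst has_sum_reindex_bij_witness[of _ "\<lambda>r. - 1 - r" "\<lambda>r. - 1 - r"]) auto
  moreover have "f (- 1 - r) = - f r" for r
  proof -
    have "(- 1 - r) * (- 1 - r) + (- 1 - r) = r * r + r" by (simp add: algebra_simps)
    moreover have "int n - (- 1 - r) - 1 = int n + r" "int n + (- 1 - r) = int n - r - 1" by simp_all
    ultimately show ?thesis unfolding f_def by (simp only: alternating_powi_neg_one) simp
  qed
  ultimately have "(f has_sum - (gauss_sum 1 n - Q ^ n * gauss_sum 0 n)) UNIV"
    by (simp add: has_sum_uminus)
  from has_sum_unique[OF f this] show ?thesis by simp
qed

text \<open>Lowering N = n+1 to n multiplies the kernel by (1 - Q^(N-r))(1 - Q^(N+r)). The terms in
  Q^r and Q^(-r) both sum to \<open>gauss_sum 1 N\<close>, which \<open>gauss_sum_1\<close> reduces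
  to \<open>gauss_sum 0 N\<close>: 1 + Q^(2N) - 2 Q^(2N).\<close>

lemma gauss_sum_Suc: "gauss_sum 0 n = (1 - (Q\<^sup>2) ^ Suc n) * gauss_sum 0 (Suc n)"
proof -
  have nQ: "norm Q < 1" using Q by simp
  define N where "N = Suc n"
  define g where "g = (\<lambda>s r. (- 1) powi r * Q powi (r * r + s * r) * bailey N r)"
  have g0: "(g 0 has_sum gauss_sum 0 N) UNIV" and g1: "(g 1 has_sum gauss_sum 1 N) UNIV"
    using gauss_sum_has_sum[of 0 N] gauss_sum_has_sum[of 1 N] by (simp_all add: g_def)
  have "g (- 1) r = g 1 (- r)" for r
    by (simp add: g_def bailey_neg power_int_minus flip: power_int_inverse)
  hence g1': "(g (- 1) has_sum gauss_sum 1 N) UNIV"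
    using has_sum_reindex_bij_witness[of UNIV uminus uminus UNIV "g 1" "g (- 1)" "gauss_sum 1 N" "gauss_sum 1 N"] g1 by auto
  have "(- 1) powi r * Q powi (r * r + int 0 * r) * bailey n r =
      (1 + (Q ^ N)\<^sup>2) * g 0 r - Q ^ N * g 1 r - Q ^ N * g (- 1) r" for r
  proof -
    define y where "y = Q powi r"
    have y: "y \<noteq> 0" using Q by (simp add: y_def)
    have 1: "rqfac Q (int n - r) = (1 - Q ^ N / y) * rqfac Q (int N - r)"
      using rqfac_diff_one[OF nQ, of "int N - r"] Q
      by (simp add: y_def power_int_diff) (simp add: N_def)
    have 2: "rqfac Q (int n + r) = (1 - Q ^ N * y) * rqfac Q (int N + r)"
      using rqfac_diff_one[OF nQ, of "int N + r"] Q
      by (simp add: y_def power_int_add) (simp add: N_def algebra_simps)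
    have 3: "g 1 r = g 0 r * y" "g (- 1) r = g 0 r / y"
      using Q by (simp_all add: g_def y_def power_int_add power_int_diff power_int_minus divide_inverse)
    have "(- 1) powi r * Q powi (r * r + int 0 * r) * bailey n r = g 0 r * ((1 - Q ^ N / y) * (1 - Q ^ N * y))"
      by (simp add: bailey_def g_def 1 2)
    also have "(1 - Q ^ N / y) * (1 - Q ^ N * y) = 1 + (Q ^ N)\<^sup>2 - Q ^ N * y - Q ^ N / y"
      using y by (simp add: algebra_simps power2_eq_square)
    finally show ?thesis unfolding 3 by (simp add: algebra_simps)
  qed
  moreover have "((\<lambda>r. (1 + (Q ^ N)\<^sup>2) * g 0 r - Q ^ N * g 1 r - Q ^ N * g (- 1) r) has_sum
      (1 + (Q ^ N)\<^sup>2) * gauss_sum 0 N - Q ^ N * gauss_sum 1 N - Q ^ N * gauss_sum 1 N) UNIV"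
    by (intro has_sum_diff has_sum_cmult_right g0 g1 g1')
  ultimately have "gauss_sum 0 n = (1 + (Q ^ N)\<^sup>2) * gauss_sum 0 N - Q ^ N * gauss_sum 1 N - Q ^ N * gauss_sum 1 N"
    using has_sum_unique[OF gauss_sum_has_sum[of 0 n]] by simp
  also have "\<dots> = (1 - (Q ^ N)\<^sup>2) * gauss_sum 0 N"
    unfolding gauss_sum_1 by (simp add: algebra_simps power2_eq_square)
  also have "(Q ^ N)\<^sup>2 = (Q\<^sup>2) ^ N" by (simp only: power_mult[symmetric] mult.commute)
  finally show ?thesis by (simp add: N_def)
qed

lemma gauss_sum_0: "gauss_sum 0 n = inverse (qfac (Q\<^sup>2) n)"
proof (induction n)
  case 0
  have "((\<lambda>r. (- 1) powi r * Q powi (r * r + int 0 * r) * bailey 0 r) has_sum 1) UNIV"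
    using bailey_eq_0[of 0]
    by (intro has_sum_finite_neutralI[of "{0}"]) (auto simp: bailey_def rqfac_def)
  from has_sum_unique[OF gauss_sum_has_sum this] show ?case by simp
next
  case (Suc n)
  have "norm (Q\<^sup>2) < 1" using Q by (simp add: abs_square_less_1)
  hence "1 - (Q\<^sup>2) ^ Suc n \<noteq> 0" by (rule one_minus_power_nonzero) simp
  moreover have "inverse (qfac (Q\<^sup>2) n) = (1 - (Q\<^sup>2) ^ Suc n) * gauss_sum 0 (Suc n)"
    using Suc gauss_sum_Suc[of n] by simp
  ultimately show ?case by (simp add: qfac_Suc del: power_Suc)
qed

end

text \<open>The delta sequence of the transform: the terms of \<open>cf_sum q s 0\<close> are
  \<open>hterm\<close> times \<open>gauss_sum\<close>.\<close>

definition hterm :: "real \<Rightarrow> nat \<Rightarrow> real" where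
  "hterm q n = q ^ (n * n) * odd_prod q 0 n"

lemma hterm_Suc: "hterm q (Suc n) = hterm q n * (q ^ (2 * n + 1) * (1 + q ^ (2 * n + 1)))"
proof -
  have "Suc n * Suc n = n * n + (2 * n + 1)" by simp
  thus ?thesis unfolding hterm_def odd_prod_Suc by (simp only: power_add) (simp add: mult_ac)
qed

lemma qfac_square: "qfac (Q\<^sup>2) n = qfac Q n * qfac_plus Q n"
proof (induction n)
  case (Suc n)
  have "1 - (Q\<^sup>2) ^ Suc n = (1 - Q ^ Suc n) * (1 + Q ^ Suc n)"
  proof -
    have "(Q\<^sup>2) ^ Suc n = (Q ^ Suc n)\<^sup>2" by (simp only: power_mult[symmetric] mult.commute)
    thus ?thesis by (simp only:) (simp add: algebra_simps power2_eq_square)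
  qed
  thus ?case by (simp only: qfac_Suc qfac_plus_Suc Suc mult_ac)
qed (simp add: qfac_plus_def)

context
  fixes q :: real
  assumes q: "q \<noteq> 0" "\<bar>q\<bar> < 1"
begin

lemma q_square: "q\<^sup>2 \<noteq> 0" "\<bar>q\<^sup>2\<bar> < 1" "norm (q\<^sup>2) < 1"
  using q by (auto simp: abs_square_less_1)

lemma norm_hterm_le: "\<bar>hterm q n\<bar> \<le> 2 ^ n * \<bar>q\<bar> ^ (n * n)"
  using odd_prod_nonneg[OF q(2), of 0 n] odd_prod_le[OF q(2), of 0 n]
  by (simp add: hterm_def abs_mult power_abs mult_right_mono mult.commute[of "\<bar>q\<bar> ^ (n * n)"])

lemma summable_hterm_majorant: "summable (\<lambda>n. C * (2 ^ n * \<bar>q\<bar> ^ (n * n)))"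
  using q by (intro summable_mult summable_power_square) auto

definition bailey_transform :: "int \<Rightarrow> real" where
  "bailey_transform r = (\<Sum>n. hterm q n * bailey (q\<^sup>2) n r)"

lemma hterm_rqfac_summable: "summable (\<lambda>n. norm (hterm q n * (rqfac (q\<^sup>2) (f n) * rqfac (q\<^sup>2) (g n))))"
proof -
  obtain C where C: "C > 0" "\<And>k. norm (rqfac (q\<^sup>2) k) \<le> C"
    using rqfac_bounded[OF q_square(3)] by blast
  show ?thesis
  proof (rule summable_comparison_test'[OF summable_hterm_majorant[of "C * C"]])
    fix n
    have "\<bar>hterm q n\<bar> * (\<bar>rqfac (q\<^sup>2) (f n)\<bar> * \<bar>rqfac (q\<^sup>2) (g n)\<bar>) \<le> 2 ^ n * \<bar>q\<bar> ^ (n * n) * (C * C)"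
      using C norm_hterm_le[of n] by (intro mult_mono) auto
    thus "norm (norm (hterm q n * (rqfac (q\<^sup>2) (f n) * rqfac (q\<^sup>2) (g n)))) \<le> C * C * (2 ^ n * \<bar>q\<bar> ^ (n * n))"
      by (simp add: abs_mult mult_ac)
  qed
qed

lemma bailey_transform_sums: "(\<lambda>n. hterm q n * bailey (q\<^sup>2) n r) sums bailey_transform r"
  unfolding bailey_transform_def bailey_def[OF q_square(1,2)]
  by (intro summable_sums summable_norm_cancel[OF hterm_rqfac_summable])

lemma bailey_transform_Suc: "bailey_transform (r + 1) = q powi (2 * r + 1) * bailey_transform r"
proof -
  define Q where "Q = q\<^sup>2"
  define y where "y = q powi r"
  have y: "y \<noteq> 0" using q by (simp add: y_def)
  have nQ: "norm Q < 1" "Q \<noteq> 0" using q_square by (auto simp: Q_def)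
  have Qp: "Q powi k = (q powi k)\<^sup>2" for k
    by (simp add: Q_def power2_eq_square power_int_mult_distrib)
  define z where "z = q powi (2 * r + 1)"
  have z: "z = y\<^sup>2 * q" using q by (simp add: z_def y_def power_int_add power_int_mult mult.commute power2_eq_square)
  \<comment> \<open>certificate for the contiguous relation, found by creative telescoping\<close>
  define g where "g = (\<lambda>n. - (1 - z) * (hterm q n * (rqfac Q (int n - 1 - r) * rqfac Q (int n + r))))"
  have step: "hterm q n * bailey Q n (r + 1) - z * (hterm q n * bailey Q n r) = g (Suc n) - g n" for n
  proof -
    define x a b h where "x = q ^ n" and "a = rqfac Q (int n - r)" and "b = rqfac Q (int n + r + 1)" and "h = hterm q n"
    have a1: "rqfac Q (int n - 1 - r) = (1 - x\<^sup>2 / y\<^sup>2) * a"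
    proof -
      have "q powi (int n - r) = x / y" using q by (simp add: x_def y_def power_int_diff)
      thus ?thesis using rqfac_diff_one[OF nQ(1), of "int n - r"]
        by (simp add: a_def Qp power_divide algebra_simps)
    qed
    have b1: "rqfac Q (int n + r) = (1 - x\<^sup>2 * y\<^sup>2 * q\<^sup>2) * b"
    proof -
      have "q powi (int n + r + 1) = x * y * q" using q by (simp add: x_def y_def power_int_add)
      thus ?thesis using rqfac_diff_one[OF nQ(1), of "int n + r + 1"]
        by (simp add: b_def Qp power_mult_distrib)
    qed
    have B1: "bailey Q n (r + 1) = (1 - x\<^sup>2 / y\<^sup>2) * a * b"
    proof -
      have "int n - (r + 1) = int n - 1 - r" "int n + (r + 1) = int n + r + 1" by simp_all
      thus ?thesis unfolding bailey_def[OF q_square(1,2), folded Q_def] by (simp only: a1 b_def[symmetric])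
    qed
    have B0: "bailey Q n r = a * ((1 - x\<^sup>2 * y\<^sup>2 * q\<^sup>2) * b)"
      unfolding bailey_def[OF q_square(1,2), folded Q_def] b1 a_def ..
    have gS: "g (Suc n) = - (1 - z) * (h * (x\<^sup>2 * q * (1 + x\<^sup>2 * q)) * (a * b))"
    proof -
      have "int (Suc n) - 1 - r = int n - r" "int (Suc n) + r = int n + r + 1" by simp_all
      moreover have "q ^ (2 * n + 1) = x\<^sup>2 * q" by (simp add: x_def mult.commute flip: power_mult)
      ultimately show ?thesis unfolding g_def hterm_Suc by (simp only: h_def a_def b_def)
    qed
    have gn: "g n = - (1 - z) * (h * ((1 - x\<^sup>2 / y\<^sup>2) * a * ((1 - x\<^sup>2 * y\<^sup>2 * q\<^sup>2) * b)))"
      unfolding g_def a1 b1 h_def ..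
    have id: "(1 - X * i) - Y * q * (1 - X * Y * q\<^sup>2) =
        - (1 - Y * q) * (X * q * (1 + X * q) - (1 - X * i) * (1 - X * Y * q\<^sup>2))"
      if "Y * i = 1" for X Y i
    proof -
      have "(1 - X * i) - Y * q * (1 - X * Y * q\<^sup>2) +
        (1 - Y * q) * (X * q * (1 + X * q) - (1 - X * i) * (1 - X * Y * q\<^sup>2)) =
        (1 - Y * i) * (X * q + X\<^sup>2 * q\<^sup>2 - X\<^sup>2 * Y * q ^ 3)"
        by (simp add: algebra_simps power2_eq_square power3_eq_cube)
      thus ?thesis unfolding mult_minus_left eq_neg_iff_add_eq_0 using that by simp
    qed
    have id': "(1 - x\<^sup>2 / y\<^sup>2) - y\<^sup>2 * q * (1 - x\<^sup>2 * y\<^sup>2 * q\<^sup>2) =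
        - (1 - y\<^sup>2 * q) * (x\<^sup>2 * q * (1 + x\<^sup>2 * q) - (1 - x\<^sup>2 / y\<^sup>2) * (1 - x\<^sup>2 * y\<^sup>2 * q\<^sup>2))"
      using id[of "y\<^sup>2" "1 / y\<^sup>2" "x\<^sup>2"] y by simp
    have rearrange: "h * (a * b) * (- (1 - w) * (U - V * W)) =
        - (1 - w) * (h * U * (a * b)) - (- (1 - w) * (h * (V * a * (W * b))))" for w U V W
      by (simp add: algebra_simps)
    have "hterm q n * bailey Q n (r + 1) - z * (hterm q n * bailey Q n r) =
        h * (a * b) * ((1 - x\<^sup>2 / y\<^sup>2) - y\<^sup>2 * q * (1 - x\<^sup>2 * y\<^sup>2 * q\<^sup>2))"
      unfolding B0 B1 z h_def[symmetric] by (simp add: algebra_simps)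
    also have "\<dots> = g (Suc n) - g n"
      unfolding gS gn z id' by (rule rearrange)
    finally show ?thesis .
  qed
  have "g 0 = 0" by (cases "r < 0") (auto simp: g_def)
  have "g \<longlonglongrightarrow> - (1 - z) * 0"
    unfolding g_def Q_def
    by (intro tendsto_mult tendsto_const summable_LIMSEQ_zero summable_norm_cancel[OF hterm_rqfac_summable])
  hence "(\<lambda>n. g (Suc n) - g n) sums (0 - g 0)"
    by (intro telescope_sums) simp
  hence "(\<lambda>n. g (Suc n) - g n) sums 0" using \<open>g 0 = 0\<close> by simp
  from sums_unique2[OF this] have "s = 0" if "(\<lambda>n. g (Suc n) - g n) sums s" for s using that by simp
  moreover have "(\<lambda>n. g (Suc n) - g n) sums (bailey_transform (r + 1) - z * bailey_transform r)"
    unfolding step[symmetric] Q_def by (intro sums_diff sums_mult bailey_transform_sums)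
  ultimately have "bailey_transform (r + 1) - z * bailey_transform r = 0" .
  thus ?thesis by (simp add: z_def)
qed

lemma bailey_transform_eq: "bailey_transform r = q powi (r * r) * bailey_transform 0"
proof (induction r rule: int_induct[of _ 0])
  case (step1 i)
  have "(i + 1) * (i + 1) = (2 * i + 1) + i * i" by (simp add: algebra_simps)
  thus ?case using step1 bailey_transform_Suc[of i] q by (simp add: power_int_add)
next
  case (step2 i)
  have "q powi (i * i) * bailey_transform 0 = q powi (2 * (i - 1) + 1) * bailey_transform (i - 1)"
    using step2 bailey_transform_Suc[of "i - 1"] by simp
  moreover have "i * i = (2 * (i - 1) + 1) + (i - 1) * (i - 1)" by (simp add: algebra_simps)
  hence "q powi (i * i) = q powi (2 * (i - 1) + 1) * q powi ((i - 1) * (i - 1))"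
    by (simp only: power_int_add[OF disjI1[OF q(1)]])
  ultimately have "q powi (2 * (i - 1) + 1) * bailey_transform (i - 1) =
      q powi (2 * (i - 1) + 1) * (q powi ((i - 1) * (i - 1)) * bailey_transform 0)"
    by (simp only: mult.assoc)
  moreover have "q powi (2 * (i - 1) + 1) \<noteq> 0" using q by simp
  ultimately show ?case using mult_left_cancel by blast
qed simp

text \<open>Bailey's transform: the double series of \<open>hterm\<close>, alpha and the kernel is
  summed in both orders. Summing over \<open>r\<close> first gives the terms of
  \<open>cf_sum\<close>, summing over \<open>n\<close> first gives a theta series.\<close>

lemma cf_sum_bailey:
  "cf_sum q s 0 = bailey_transform 0 * (\<Sum>\<^sub>\<infinity>r. (- 1) powi r * q powi (3 * (r * r) + 2 * (int s * r)))"
  if s: "s = 0 \<or> s = 1"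
proof -
  define Q where "Q = q\<^sup>2"
  define F where "F = (\<lambda>n r. hterm q n * ((- 1) powi r * Q powi (r * r + int s * r) * bailey Q n r))"
  obtain C where C: "C > 0" "\<And>k. norm (rqfac Q k) \<le> C"
    using rqfac_bounded[OF q_square(3)] unfolding Q_def by blast
  have Qpos: "0 < Q" "Q < 1" using q_square by (auto simp: Q_def)
  \<comment> \<open>Absolute convergence from a product majorant, with quadratic decay in
    \<open>n\<close> from \<open>hterm\<close> and in \<open>r\<close> from Q^(r^2+sr).\<close>
  have F: "(\<lambda>(n, r). F n r) summable_on UNIV \<times> UNIV"
  proof -
    define M where "M = (\<lambda>n. C * C * (2 ^ n * \<bar>q\<bar> ^ (n * n)))"
    define N where "N = (\<lambda>r::int. (Q ^ s) powi r * Q powi (r * r))"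
    have "M summable_on UNIV"
      unfolding M_def using summable_hterm_majorant C(1)
      by (intro summable_nonneg_imp_summable_on) auto
    moreover have "N summable_on UNIV"
      unfolding N_def using Qpos by (intro summable_on_powi_square) auto
    ultimately have "(\<lambda>(n, r). M n * N r) summable_on UNIV \<times> UNIV"
      using C(1) Qpos
      by (intro has_sum_imp_summable[OF has_sum_times_real[OF has_sum_infsum has_sum_infsum]])
         (auto simp: M_def N_def)
    hence "(\<lambda>p. norm ((\<lambda>(n, r). F n r) p)) summable_on UNIV \<times> UNIV"
    proof (rule Infinite_Sum.abs_summable_on_comparison_test')
      fix p :: "nat \<times> int"
      obtain n r where p: "p = (n, r)" by (cases p)
      have "\<bar>bailey Q n r\<bar> \<le> C * C"
        unfolding bailey_def[OF q_square(1,2), folded Q_def] abs_mult using C by (intro mult_mono) auto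
      moreover have "\<bar>(- 1) powi r * Q powi (r * r + int s * r)\<bar> = N r"
        using Qpos by (simp add: N_def abs_mult power_int_abs power_int_add power_int_power mult.commute)
      ultimately have "\<bar>hterm q n\<bar> * (\<bar>(- 1) powi r * Q powi (r * r + int s * r)\<bar> * \<bar>bailey Q n r\<bar>)
          \<le> (2 ^ n * \<bar>q\<bar> ^ (n * n)) * (N r * (C * C))"
        using norm_hterm_le[of n] Qpos C(1) by (intro mult_mono) (auto simp: N_def)
      thus "norm ((\<lambda>(n, r). F n r) p) \<le> (\<lambda>(n, r). M n * N r) p"
        by (simp add: p F_def M_def abs_mult mult_ac)
    qed
    thus ?thesis by (rule abs_summable_summable)
  qed
  have inner: "(\<Sum>\<^sub>\<infinity>r. F n r) = cf_term q s 0 n" for n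
  proof -
    have "(\<Sum>\<^sub>\<infinity>r. F n r) = hterm q n * gauss_sum Q s n"
      unfolding F_def using gauss_sum_has_sum[OF q_square(1,2), folded Q_def, of s n]
      by (intro infsumI has_sum_cmult_right)
    moreover have "gauss_sum Q s n = Q ^ (s * n) * inverse (qfac (Q\<^sup>2) n)"
      using s gauss_sum_0[OF q_square(1,2)] gauss_sum_1[OF q_square(1,2)] by (auto simp: Q_def)
    moreover have "q ^ (n * n + 2 * 0 * n + 2 * s * n) = q ^ (n * n) * Q ^ (s * n)"
      by (simp add: Q_def power_add mult.assoc flip: power_mult)
    ultimately show ?thesis
      unfolding cf_term_def hterm_def Q_def[symmetric] by (simp add: qfac_square divide_inverse mult_ac)
  qed
  have outer: "(\<Sum>\<^sub>\<infinity>n. F n r) = bailey_transform 0 * ((- 1) powi r * q powi (3 * (r * r) + 2 * (int s * r)))" for r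
  proof -
    have "summable (\<lambda>n. norm (hterm q n * bailey Q n r))"
      unfolding Q_def bailey_def[OF q_square(1,2)] by (rule hterm_rqfac_summable)
    hence "((\<lambda>n. hterm q n * bailey Q n r) has_sum bailey_transform r) UNIV"
      using bailey_transform_sums[of r] unfolding Q_def by (rule norm_summable_imp_has_sum)
    from has_sum_cmult_right[OF this, of "(- 1) powi r * Q powi (r * r + int s * r)"]
    have "(\<Sum>\<^sub>\<infinity>n. F n r) = (- 1) powi r * Q powi (r * r + int s * r) * bailey_transform r"
      unfolding F_def by (intro infsumI) (simp add: mult_ac)
    moreover have "Q powi (r * r + int s * r) * q powi (r * r) = q powi (3 * (r * r) + 2 * (int s * r))"
    proof -
      have "Q powi k = q powi (2 * k)" for k by (simp add: Q_def power_int_power)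
      moreover have "3 * (r * r) + 2 * (int s * r) = 2 * (r * r + int s * r) + r * r" by simp
      ultimately show ?thesis by (simp only: power_int_add[OF disjI1[OF q(1)]])
    qed
    ultimately show ?thesis by (simp add: bailey_transform_eq[of r] mult_ac)
  qed
  have "(cf_term q s 0 has_sum cf_sum q s 0) UNIV"
    unfolding cf_sum_def
    by (rule norm_summable_imp_has_sum[OF summable_norm_cf_term[OF q(2)] cf_term_sums[OF q(2), unfolded cf_sum_def]])
  hence "cf_sum q s 0 = (\<Sum>\<^sub>\<infinity>n. \<Sum>\<^sub>\<infinity>r. F n r)"
    unfolding inner by (simp add: infsumI)
  also have "\<dots> = (\<Sum>\<^sub>\<infinity>r. \<Sum>\<^sub>\<infinity>n. F n r)"
    by (rule infsum_swap_banach[OF F])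
  finally show ?thesis unfolding outer by (simp add: infsum_cmult_right')
qed

end

theorem V_conv_tendsto_theta:
  fixes x :: real
  assumes x: "0 < x" "x < 1"
  shows "V_conv (- x) \<longlonglongrightarrow> - (root 3 x * theta6 x / theta (x ^ 3))"
proof -
  have q: "- x \<noteq> 0" "\<bar>- x\<bar> < 1" using x by auto
  \<comment> \<open>At q = -x the sign from the Bailey pair meets the sign of the power: r + 3r^2 is
    even, so both theta series have positive terms.\<close>
  have sgn: "(- 1 :: real) powi r * (- x) powi (3 * (r * r) + 2 * k) = x powi (3 * (r * r) + 2 * k)" for r k :: int
  proof -
    have "(- x) powi m = (- 1) powi m * x powi m" for m
      using power_int_mult_distrib[of "- 1" x m] by simp
    moreover have "(- 1 :: real) powi r * (- 1) powi (3 * (r * r) + 2 * k) = 1"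
    proof -
      have "even (r + (3 * (r * r) + 2 * k))" by simp
      hence "(- 1 :: real) powi (r + (3 * (r * r) + 2 * k)) = 1" by (simp add: power_int_minus_left)
      thus ?thesis by (simp add: power_int_add)
    qed
    ultimately show ?thesis by (simp add: mult.assoc[symmetric])
  qed
  have 0: "cf_sum (- x) 0 0 = bailey_transform (- x) 0 * theta (x ^ 3)"
    using cf_sum_bailey[OF q, of 0] sgn[of _ 0] by (simp add: theta_def power_int_power)
  have 1: "cf_sum (- x) 1 0 = bailey_transform (- x) 0 * theta6 x"
    using cf_sum_bailey[OF q, of 1] sgn by (simp add: theta6_def)
  \<comment> \<open>The common factor is nonzero because it divides the nonzero
    \<open>cf_sum (- x) 0 0\<close>; its value stays unknown.\<close>
  have "bailey_transform (- x) 0 \<noteq> 0" using cf_sum_nonzero[OF q(2)] 0 by auto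
  moreover have "V_conv (- x) \<longlonglongrightarrow> root 3 (- x) * (cf_sum (- x) 1 0 / cf_sum (- x) 0 0)"
    by (rule V_conv_tendsto_cf_sum[OF q(2)])
  ultimately show ?thesis unfolding 0 1 by (simp add: real_root_minus)
qed

section \<open>Theta inversion\<close>

lemma sum_nontrivial_root_of_unity:
  fixes w :: "'a :: field_char_0"
  assumes "w \<noteq> 1" "w ^ (2 * h + 1) = 1"
  shows "(\<Sum>k = - int h..int h. w powi k) = 0"
proof -
  have "w \<noteq> 0" using assms(2) by (intro notI) simp
  define S where "S = (\<Sum>k = - int h..int h. w powi k)"
  have "w * S = (\<Sum>k = - int h..int h. w powi (k + 1))"
    using \<open>w \<noteq> 0\<close> by (simp add: S_def sum_distrib_left power_int_add mult.commute)
  also have "\<dots> = (\<Sum>k = - int h + 1..int h + 1. w powi k)"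
    by (rule sum.reindex_bij_witness[of _ "\<lambda>k. k - 1" "\<lambda>k. k + 1"]) auto
  also have "\<dots> = (\<Sum>k = - int h + 1..int h. w powi k) + w powi (int h + 1)"
  proof -
    have "{- int h + 1..int h + 1} = insert (int h + 1) {- int h + 1..int h}" by auto
    thus ?thesis by simp
  qed
  also have "w powi (int h + 1) = w powi (- int h)"
  proof -
    have "int h + 1 = int (2 * h + 1) + (- int h)" by simp
    hence "w powi (int h + 1) = w powi (int (2 * h + 1)) * w powi (- int h)"
      by (simp only: power_int_add[OF disjI1[OF \<open>w \<noteq> 0\<close>]])
    thus ?thesis using assms(2) by (simp only: power_int_of_nat mult_1_left)
  qed
  also have "(\<Sum>k = - int h + 1..int h. w powi k) + w powi (- int h) = S"
  proof -
    have "{- int h..int h} = insert (- int h) {- int h + 1..int h}" by auto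
    thus ?thesis by (simp add: S_def)
  qed
  finally have "(w - 1) * S = 0" by (simp add: left_diff_distrib)
  thus ?thesis using assms(1) by (simp add: S_def)
qed

text \<open>The coefficient of z^i in (z + 2 + 1/z)^m, extended by 0 so that it can be summed over
  all integers.\<close>

definition central_binomial :: "nat \<Rightarrow> int \<Rightarrow> real" where
  "central_binomial m i = (if \<bar>i\<bar> \<le> int m then real ((2 * m) choose nat (int m + i)) else 0)"

lemma two_cos_power:
  "complex_of_real ((2 * cos \<theta>) ^ (2 * m)) =
    (\<Sum>i = - int m..int m. of_real (central_binomial m i) * cis (2 * \<theta>) powi i)"
proof -
  have "complex_of_real (2 * cos \<theta>) = cis \<theta> + cis (- \<theta>)"
    by (simp add: complex_eq_iff)
  hence "complex_of_real ((2 * cos \<theta>) ^ (2 * m)) = (cis \<theta> + cis (- \<theta>)) ^ (2 * m)"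
    by (simp only: of_real_power)
  also have "\<dots> = (\<Sum>j\<le>2 * m. of_nat ((2 * m) choose j) * cis \<theta> ^ j * cis (- \<theta>) ^ (2 * m - j))"
    by (rule binomial_ring)
  also have "\<dots> = (\<Sum>j\<le>2 * m. of_real (central_binomial m (int j - int m)) * cis (2 * \<theta>) powi (int j - int m))"
  proof (rule sum.cong[OF refl])
    fix j assume j: "j \<in> {..2 * m}"
    have "cis \<theta> ^ j * cis (- \<theta>) ^ (2 * m - j) = cis (real j * \<theta> + real (2 * m - j) * - \<theta>)"
      by (simp only: Complex.DeMoivre cis_mult)
    also have "real j * \<theta> + real (2 * m - j) * - \<theta> = of_int (int j - int m) * (2 * \<theta>)"
      using j by (simp add: of_nat_diff algebra_simps)
    also have "cis (of_int (int j - int m) * (2 * \<theta>)) = cis (2 * \<theta>) powi (int j - int m)"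
      by (simp add: cis_power_int)
    finally have "cis \<theta> ^ j * cis (- \<theta>) ^ (2 * m - j) = cis (2 * \<theta>) powi (int j - int m)" .
    moreover have "central_binomial m (int j - int m) = real ((2 * m) choose j)"
      using j by (auto simp: central_binomial_def)
    ultimately show "of_nat ((2 * m) choose j) * cis \<theta> ^ j * cis (- \<theta>) ^ (2 * m - j) =
      of_real (central_binomial m (int j - int m)) * cis (2 * \<theta>) powi (int j - int m)"
      by (simp add: mult.assoc)
  qed
  also have "\<dots> = (\<Sum>i = - int m..int m. of_real (central_binomial m i) * cis (2 * \<theta>) powi i)"
    by (rule sum.reindex_bij_witness[of _ "\<lambda>i. nat (i + int m)" "\<lambda>j. int j - int m"]) auto
  finally show ?thesis .
qed

text \<open>Expand the cosine power in l-th roots of unity and sum over k: only exponents divisible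
  by l survive. An odd l makes the range of k symmetric about 0.\<close>

lemma polya_finite_theta:
  fixes h m :: nat
  defines "l \<equiv> 2 * h + 1"
  shows "(\<Sum>k = - int h..int h. (2 * cos (pi * of_int k / l)) ^ (2 * m)) =
    l * (\<Sum>\<^sub>\<infinity>\<nu>. central_binomial m (int l * \<nu>))"
proof -
  define z where "z = (\<lambda>k::int. cis (2 * (pi * of_int k / l)))"
  have l: "l > 0" by (simp add: l_def)
  have swap: "z k powi i = z i powi k" for k i
    by (simp add: z_def cis_power_int mult_ac)
  have root: "z i ^ l = 1" for i
  proof -
    have "z i ^ l = cis (2 * pi * of_int i)"
      using l by (simp add: z_def Complex.DeMoivre mult_ac)
    thus ?thesis by simp
  qed
  have one: "z i = 1 \<longleftrightarrow> int l dvd i" for i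
  proof
    assume "z i = 1"
    hence "cos (2 * (pi * of_int i / l)) = 1" by (simp add: z_def complex_eq_iff)
    then obtain x :: int where "2 * (pi * of_int i / l) = of_int x * 2 * pi"
      unfolding cos_one_2pi_int by blast
    hence "of_int i = (of_int (int l * x) :: real)" using l by (simp add: field_simps)
    hence "i = int l * x" by (simp only: of_int_eq_iff)
    thus "int l dvd i" by simp
  next
    assume "int l dvd i"
    then obtain x where "i = int l * x" by auto
    hence "2 * (pi * of_int i / l) = 2 * pi * of_int x" using l by simp
    thus "z i = 1" by (simp add: z_def)
  qed
  have inner: "(\<Sum>k = - int h..int h. z i powi k) = (if int l dvd i then of_nat l else 0)" for i
  proof (cases "int l dvd i")
    case True
    hence "z i = 1" using one by blast
    thus ?thesis using True by (simp add: l_def)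
  next
    case False
    thus ?thesis using sum_nontrivial_root_of_unity[of "z i" h] root[of i] one[of i] by (simp add: l_def)
  qed
  have "complex_of_real (\<Sum>k = - int h..int h. (2 * cos (pi * of_int k / l)) ^ (2 * m)) =
      (\<Sum>k = - int h..int h. \<Sum>i = - int m..int m. of_real (central_binomial m i) * z k powi i)"
    unfolding of_real_sum two_cos_power z_def ..
  also have "\<dots> = (\<Sum>i = - int m..int m. of_real (central_binomial m i) * (\<Sum>k = - int h..int h. z i powi k))"
    unfolding sum_distrib_left by (subst sum.swap) (simp only: swap)
  also have "\<dots> = complex_of_real (\<Sum>i = - int m..int m. central_binomial m i * (if int l dvd i then l else 0))"
    unfolding inner of_real_sum by (intro sum.cong) auto
  finally have "(\<Sum>k = - int h..int h. (2 * cos (pi * of_int k / l)) ^ (2 * m)) =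
      (\<Sum>i = - int m..int m. central_binomial m i * (if int l dvd i then l else 0))"
    by (simp only: of_real_eq_iff)
  also have "\<dots> = (\<Sum>\<^sub>\<infinity>i\<in>{- int m..int m}. central_binomial m i * (if int l dvd i then l else 0))"
    by simp
  also have "\<dots> = (\<Sum>\<^sub>\<infinity>i\<in>range (\<lambda>\<nu>. int l * \<nu>). l * central_binomial m i)"
    by (rule infsum_cong_neutral) (auto simp: central_binomial_def dvd_def)
  also have "\<dots> = (\<Sum>\<^sub>\<infinity>\<nu>. l * central_binomial m (int l * \<nu>))"
    using l by (subst infsum_reindex) (auto simp: inj_on_def o_def)
  also have "\<dots> = l * (\<Sum>\<^sub>\<infinity>\<nu>. central_binomial m (int l * \<nu>))"
    by (rule infsum_cmult_right')
  finally show ?thesis .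
qed

section \<open>Gaussian bounds for cosines and binomial coefficients\<close>

lemma cos_le_exp:
  assumes "\<bar>x\<bar> \<le> pi / 2"
  shows "cos x \<le> exp (- x\<^sup>2 / 2)"
proof -
  \<comment> \<open>This is the sign of the derivative of cos t * exp(t^2/2), which therefore
    decreases from its value 1 at 0.\<close>
  have A: "t * cos t \<le> sin t" if t: "0 \<le> t" "t \<le> pi / 2" for t :: real
  proof -
    have "(\<lambda>t. sin t - t * cos t) 0 \<le> (\<lambda>t. sin t - t * cos t) t"
    proof (rule DERIV_nonneg_imp_nondecreasing[OF t(1)])
      fix y assume y: "0 \<le> y" "y \<le> t"
      have "((\<lambda>t. sin t - t * cos t) has_real_derivative y * sin y) (at y)"
        by (auto intro!: derivative_eq_intros)
      moreover have "y * sin y \<ge> 0" using y t by (intro mult_nonneg_nonneg sin_ge_zero) auto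
      ultimately show "\<exists>D. ((\<lambda>t. sin t - t * cos t) has_real_derivative D) (at y) \<and> 0 \<le> D" by blast
    qed
    thus ?thesis by simp
  qed
  have B: "cos t * exp (t\<^sup>2 / 2) \<le> 1" if t: "0 \<le> t" "t \<le> pi / 2" for t :: real
  proof -
    have "(\<lambda>t. cos t * exp (t\<^sup>2 / 2)) t \<le> (\<lambda>t. cos t * exp (t\<^sup>2 / 2)) 0"
    proof (rule DERIV_nonpos_imp_nonincreasing[OF t(1)])
      fix y assume y: "0 \<le> y" "y \<le> t"
      have "((\<lambda>t. cos t * exp (t\<^sup>2 / 2)) has_real_derivative exp (y\<^sup>2 / 2) * (y * cos y - sin y)) (at y)"
        by (auto intro!: derivative_eq_intros simp: algebra_simps)
      moreover have "exp (y\<^sup>2 / 2) * (y * cos y - sin y) \<le> 0"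
        using A[of y] y t by (intro mult_nonneg_nonpos) auto
      ultimately show "\<exists>D. ((\<lambda>t. cos t * exp (t\<^sup>2 / 2)) has_real_derivative D) (at y) \<and> D \<le> 0" by blast
    qed
    thus ?thesis by simp
  qed
  have "cos \<bar>x\<bar> * exp (\<bar>x\<bar>\<^sup>2 / 2) \<le> 1" using assms by (intro B) auto
  thus ?thesis by (simp add: exp_minus field_simps)
qed

lemma cos_ge_quadratic: "1 - x\<^sup>2 / 2 \<le> cos (x :: real)"
proof -
  have "cos x = 1 - 2 * sin (x / 2) ^ 2" using cos_double_sin[of "x / 2"] by simp
  moreover have "\<bar>sin (x / 2)\<bar> \<le> \<bar>x / 2\<bar>" by (rule abs_sin_x_le_abs_x)
  hence "sin (x / 2) ^ 2 \<le> (x / 2)\<^sup>2" by (simp only: abs_le_square_iff)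
  ultimately show ?thesis by (simp add: power_divide)
qed

lemma exp_le_one_minus:
  fixes x :: real
  assumes "0 \<le> x" "x \<le> 1 / 2"
  shows "exp (- x - 2 * x\<^sup>2) \<le> 1 - x"
proof -
  have "exp (- x - 2 * x\<^sup>2) \<le> exp (ln (1 - x))"
    using ln_one_minus_pos_lower_bound[OF assms] by simp
  thus ?thesis using assms by simp
qed

lemma binomial_ratio_step:
  assumes "j < m"
  shows "real ((2 * m) choose (m + Suc j)) =
    real ((2 * m) choose (m + j)) * (1 - (2 * real j + 1) / (real m + real j + 1))"
proof -
  have "Suc (m + j) * ((2 * m) choose Suc (m + j)) = (2 * m - (m + j)) * ((2 * m) choose (m + j))"
    by (simp only: binomial_absorb_comp binomial_absorption)
  hence "real (Suc (m + j)) * real ((2 * m) choose Suc (m + j)) = real (2 * m - (m + j)) * real ((2 * m) choose (m + j))"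
    by (simp only: of_nat_mult[symmetric])
  moreover have "real (2 * m - (m + j)) = real m - real j" using assms by (simp add: of_nat_diff)
  ultimately show ?thesis by (simp add: field_simps)
qed

text \<open>Multiply the step ratios: 1 - x <= exp(-x), and the odd numbers 2i+1 below j add up to
  j^2. The separate bound \<open>J\<close> keeps the denominator fixed during the induction.\<close>

lemma binomial_ratio_upper:
  assumes "j \<le> J" "J \<le> m"
  shows "real ((2 * m) choose (m + j)) \<le> real ((2 * m) choose m) * exp (- (real j)\<^sup>2 / (real m + real J))"
  using assms(1)
proof (induction j)
  case (Suc j)
  define x where "x = (2 * real j + 1) / (real m + real j + 1)"
  have J: "real m + real J > 0" using Suc.prems assms by simp
  define D where "D = real m + real J"
  have "1 - x \<le> exp (- x)" using exp_ge_add_one_self[of "- x"] by simp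
  also have "\<dots> \<le> exp (- (2 * real j + 1) / (real m + real J))"
  proof -
    have "(2 * real j + 1) / (real m + real J) \<le> x"
      unfolding x_def using Suc.prems by (intro frac_le) auto
    thus ?thesis by (simp only: exp_le_cancel_iff minus_divide_left[symmetric] neg_le_iff_le)
  qed
  finally have "real ((2 * m) choose (m + Suc j)) \<le> real ((2 * m) choose (m + j)) * exp (- (2 * real j + 1) / (real m + real J))"
    using Suc.prems assms(2) by (subst binomial_ratio_step) (auto simp: x_def intro!: mult_left_mono)
  also have "\<dots> \<le> real ((2 * m) choose m) * exp (- (real j)\<^sup>2 / (real m + real J)) * exp (- (2 * real j + 1) / (real m + real J))"
    using Suc by (intro mult_right_mono) auto
  also have "\<dots> = real ((2 * m) choose m) * exp (- (real (Suc j))\<^sup>2 / (real m + real J))"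
  proof -
    have "- (real j)\<^sup>2 / D + - (2 * real j + 1) / D = - (real (Suc j))\<^sup>2 / D"
      unfolding add_divide_distrib[symmetric] by (simp add: power2_eq_square algebra_simps)
    thus ?thesis unfolding mult.assoc exp_add[symmetric] by (simp only: D_def)
  qed
  finally show ?case .
qed simp

text \<open>The converse estimate uses exp(-x - 2x^2) <= 1 - x for x <= 1/2, guaranteed by
  \<open>4 * J \<le> m\<close>. The quadratic loss becomes the correction factor 1 + 4J/m, which
  tends to 1 in the application.\<close>

lemma binomial_ratio_lower:
  assumes "j \<le> J" "4 * J \<le> m" "m > 0"
  shows "real ((2 * m) choose m) * exp (- (real j)\<^sup>2 / real m * (1 + 4 * real J / real m)) \<le> real ((2 * m) choose (m + j))"
  using assms(1)
proof (induction j)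
  case (Suc j)
  define x where "x = (2 * real j + 1) / (real m + real j + 1)"
  define y where "y = (2 * real j + 1) / real m"
  have y: "0 \<le> x" "x \<le> y" "y \<le> 2 * real J / real m" "2 * real J / real m \<le> 1 / 2"
  proof -
    show "0 \<le> x" by (simp add: x_def)
    show "x \<le> y" unfolding x_def y_def using assms by (intro frac_le) auto
    show "y \<le> 2 * real J / real m" unfolding y_def using Suc.prems assms by (intro divide_right_mono) auto
    show "2 * real J / real m \<le> 1 / 2" using assms by (simp add: field_simps)
  qed
  have "x * (1 + 2 * x) \<le> y * (1 + 4 * real J / real m)"
    using y by (intro mult_mono) auto
  hence "- (y * (1 + 4 * real J / real m)) \<le> - x - 2 * x\<^sup>2" by (simp add: algebra_simps power2_eq_square)
  hence "exp (- (y * (1 + 4 * real J / real m))) \<le> exp (- x - 2 * x\<^sup>2)" by simp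
  also have "\<dots> \<le> 1 - x" using y by (intro exp_le_one_minus) auto
  finally have e: "exp (- (y * (1 + 4 * real J / real m))) \<le> 1 - x" .
  have "- (real (Suc j))\<^sup>2 / real m * (1 + 4 * real J / real m) =
      - (real j)\<^sup>2 / real m * (1 + 4 * real J / real m) + - (y * (1 + 4 * real J / real m))"
  proof -
    have "- (real (Suc j))\<^sup>2 / real m = - (real j)\<^sup>2 / real m - y"
      using assms by (simp add: y_def field_simps power2_eq_square)
    thus ?thesis by (simp add: left_diff_distrib)
  qed
  hence "real ((2 * m) choose m) * exp (- (real (Suc j))\<^sup>2 / real m * (1 + 4 * real J / real m)) =
      (real ((2 * m) choose m) * exp (- (real j)\<^sup>2 / real m * (1 + 4 * real J / real m))) * exp (- (y * (1 + 4 * real J / real m)))"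
    by (simp only: exp_add mult.assoc)
  also have "\<dots> \<le> real ((2 * m) choose (m + j)) * (1 - x)"
    using Suc e y by (intro mult_mono) auto
  also have "\<dots> = real ((2 * m) choose (m + Suc j))"
    using Suc.prems assms by (subst binomial_ratio_step) (auto simp: x_def)
  finally show ?case .
qed simp

text \<open>An exact relation to the partial Wallis products, giving the asymptotics of the central
  binomial coefficient without Stirling's formula.\<close>

lemma central_binomial_wallis:
  "(real ((2 * n) choose n) / 4 ^ n)\<^sup>2 * (2 * real n + 1) * (\<Prod>k=1..n. (4 * real k ^ 2) / (4 * real k ^ 2 - 1)) = 1"
proof (induction n)
  case (Suc n)
  define b where "b = real ((2 * n) choose n) / 4 ^ n"
  have "real ((2 * Suc n) choose Suc n) = real ((2 * n) choose n) * (2 * (2 * real n + 1) / (real n + 1))"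
  proof -
    have "Suc n * ((2 * Suc n) choose Suc n) = 2 * (2 * n + 1) * ((2 * n) choose n)"
    proof -
      have "Suc n * (Suc n * ((2 * Suc n) choose Suc n)) = Suc n * (2 * (2 * n + 1) * ((2 * n) choose n))"
      proof -
        have a: "Suc n * ((2 * Suc n) choose Suc n) = 2 * Suc n * (Suc (2 * n) choose n)"
          using Suc_times_binomial[of n "Suc (2 * n)"] by simp
        have b: "Suc n * (Suc (2 * n) choose n) = Suc (2 * n) * ((2 * n) choose n)"
          using binomial_absorb_comp[of "Suc (2 * n)" n] by simp
        have "Suc n * (2 * Suc n * (Suc (2 * n) choose n)) = Suc n * (2 * (Suc n * (Suc (2 * n) choose n)))"
          by (simp only: mult_ac)
        thus ?thesis unfolding a b by simp
      qed
      thus ?thesis by (simp only: mult_cancel1) simp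
    qed
    hence "real (Suc n) * real ((2 * Suc n) choose Suc n) = 2 * (2 * real n + 1) * real ((2 * n) choose n)"
      by (metis (no_types, lifting) of_nat_mult of_nat_numeral of_nat_add of_nat_1)
    thus ?thesis by (simp add: field_simps)
  qed
  moreover have "real ((2 * Suc n) choose Suc n) / 4 ^ Suc n = b * ((2 * real n + 1) / (2 * (real n + 1)))"
    if "real ((2 * Suc n) choose Suc n) = real ((2 * n) choose n) * (2 * (2 * real n + 1) / (real n + 1))"
  proof -
    have *: "c * (2 * u / v) / (4 * p) = c / p * (u / (2 * v))" for c u v p :: real by simp
    show ?thesis unfolding that b_def power_Suc by (rule *)
  qed
  moreover have "4 * real (Suc n) ^ 2 - 1 = (2 * real n + 1) * (2 * real n + 3)"
    by (simp add: algebra_simps power2_eq_square)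
  moreover have "(\<Prod>k=1..Suc n. (4 * real k ^ 2) / (4 * real k ^ 2 - 1)) =
    (\<Prod>k=1..n. (4 * real k ^ 2) / (4 * real k ^ 2 - 1)) * (4 * real (Suc n) ^ 2 / (4 * real (Suc n) ^ 2 - 1))"
    by simp
  ultimately have "(real ((2 * Suc n) choose Suc n) / 4 ^ Suc n)\<^sup>2 * (2 * real (Suc n) + 1) * (\<Prod>k=1..Suc n. (4 * real k ^ 2) / (4 * real k ^ 2 - 1)) =
    (b * ((2 * real n + 1) / (2 * (real n + 1))))\<^sup>2 * (2 * real n + 3) *
     ((\<Prod>k=1..n. (4 * real k ^ 2) / (4 * real k ^ 2 - 1)) * (4 * (real n + 1) ^ 2 / ((2 * real n + 1) * (2 * real n + 3))))"
    by (simp add: add.commute)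
  also have "\<dots> = b\<^sup>2 * (2 * real n + 1) * (\<Prod>k=1..n. (4 * real k ^ 2) / (4 * real k ^ 2 - 1))"
  proof -
    have *: "(b * (u / (2 * v)))\<^sup>2 * w * (P * (4 * v ^ 2 / (u * w))) = b\<^sup>2 * u * P" if "u > 0" "v > 0" "w > 0" for u v w P :: real
      using that by (simp add: field_simps power2_eq_square)
    show ?thesis by (rule *) auto
  qed
  finally show ?case unfolding b_def Suc .
qed simp

lemma central_binomial_tendsto:
  "(\<lambda>n. real ((2 * n) choose n) / 4 ^ n * sqrt (2 * real n + 1)) \<longlonglongrightarrow> sqrt (2 / pi)"
proof -
  define P where "P = (\<lambda>n. \<Prod>k=1..n. (4 * real k ^ 2) / (4 * real k ^ 2 - 1))"
  have "(\<lambda>n. sqrt (inverse (P n))) \<longlonglongrightarrow> sqrt (inverse (pi / 2))"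
    unfolding P_def by (intro tendsto_real_sqrt tendsto_inverse wallis) auto
  moreover have "sqrt (inverse (P n)) = real ((2 * n) choose n) / 4 ^ n * sqrt (2 * real n + 1)" for n
  proof -
    have "(real ((2 * n) choose n) / 4 ^ n)\<^sup>2 * (2 * real n + 1) * P n = 1"
      using central_binomial_wallis[of n] by (simp only: P_def)
    hence "P n * ((real ((2 * n) choose n) / 4 ^ n)\<^sup>2 * (2 * real n + 1)) = 1"
      by (simp only: mult.commute[of "P n"])
    hence "inverse (P n) = (real ((2 * n) choose n) / 4 ^ n)\<^sup>2 * (2 * real n + 1)"
      by (rule inverse_unique)
    thus ?thesis by (simp add: real_sqrt_mult)
  qed
  ultimately show ?thesis by (simp add: inverse_eq_divide)
qed

lemma central_binomial_abs:
  assumes "\<bar>i\<bar> \<le> int m"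
  shows "central_binomial m i = real ((2 * m) choose (m + nat \<bar>i\<bar>))"
proof (cases "i \<ge> 0")
  case False
  have "nat (int m + i) = 2 * m - (m + nat \<bar>i\<bar>)" using assms False by simp
  thus ?thesis using assms binomial_symmetric[of "m + nat \<bar>i\<bar>" "2 * m"]
    by (simp add: central_binomial_def nat_le_iff)
qed (use assms in \<open>simp add: central_binomial_def nat_add_distrib\<close>)

lemma central_binomial_le:
  "central_binomial m i \<le> real ((2 * m) choose m) * exp (- (of_int i)\<^sup>2 / (real m + \<bar>of_int i\<bar>))"
proof (cases "\<bar>i\<bar> \<le> int m")
  case True
  from central_binomial_abs[OF True] show ?thesis using binomial_ratio_upper[of "nat \<bar>i\<bar>" "nat \<bar>i\<bar>" m] True by (simp add: nat_le_iff)
qed (simp add: central_binomial_def)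

lemma central_binomial_ge:
  assumes "4 * \<bar>i\<bar> \<le> int m" "m > 0"
  shows "real ((2 * m) choose m) * exp (- (of_int i)\<^sup>2 / real m * (1 + 4 * \<bar>of_int i\<bar> / real m)) \<le> central_binomial m i"
proof -
  have True: "\<bar>i\<bar> \<le> int m" using assms by simp
  from central_binomial_abs[OF True] show ?thesis using binomial_ratio_lower[of "nat \<bar>i\<bar>" "nat \<bar>i\<bar>" m] assms by (simp add: nat_le_iff)
qed

section \<open>Passage to the limit in Polya's identity\<close>

lemma summable_on_exp_square:
  fixes c :: real
  assumes "c > 0"
  shows "(\<lambda>k::int. exp (- c * (of_int k)\<^sup>2)) summable_on UNIV"
proof -
  have "(\<lambda>k::int. 1 powi k * exp (- c) powi (k * k)) summable_on UNIV"
    using assms by (intro summable_on_powi_square) auto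
  thus ?thesis by (simp add: exp_power_int power2_eq_square mult_ac)
qed

context
  fixes s :: real
  assumes s: "s > 0"
begin

text \<open>The scaling that balances both sides: m/l^2 tends to s. With l = 2h+1 and |k| <= h the
  angles pi k/l stay within [-pi/2, pi/2], where the cosine is nonnegative and below its Gaussian
  bound.\<close>

definition lseq :: "nat \<Rightarrow> nat" where "lseq h = 2 * h + 1"
definition mseq :: "nat \<Rightarrow> nat" where "mseq h = nat \<lfloor>s * (real (lseq h))\<^sup>2\<rfloor>"

lemma lseq_pos: "real (lseq h) \<ge> 1"
  by (simp add: lseq_def)

lemma mseq_bounds: "real (mseq h) \<le> s * (real (lseq h))\<^sup>2" "s * (real (lseq h))\<^sup>2 - 1 \<le> real (mseq h)"
  using s by (simp_all add: mseq_def)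

lemma lseq_at_top: "filterlim (\<lambda>h. real (lseq h)) at_top sequentially"
  unfolding lseq_def
  by (intro filterlim_compose[OF filterlim_real_sequentially] filterlim_subseq) (auto simp: strict_mono_def)

lemma mseq_ratio: "(\<lambda>h. real (mseq h) / (real (lseq h))\<^sup>2) \<longlonglongrightarrow> s"
proof (rule tendsto_sandwich)
  have "(\<lambda>h. s - 1 / (real (lseq h))\<^sup>2) \<longlonglongrightarrow> s - 0"
    using lseq_at_top
    by (intro tendsto_diff tendsto_const real_tendsto_divide_at_top filterlim_pow_at_top) auto
  thus "(\<lambda>h. s - 1 / (real (lseq h))\<^sup>2) \<longlonglongrightarrow> s" by simp
  show "\<forall>\<^sub>F h in sequentially. s - 1 / (real (lseq h))\<^sup>2 \<le> real (mseq h) / (real (lseq h))\<^sup>2"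
  proof (intro always_eventually allI)
    fix h
    have "s - 1 / (real (lseq h))\<^sup>2 = (s * (real (lseq h))\<^sup>2 - 1) / (real (lseq h))\<^sup>2"
      using lseq_pos[of h] by (simp add: diff_divide_distrib)
    also have "\<dots> \<le> real (mseq h) / (real (lseq h))\<^sup>2"
      by (intro divide_right_mono mseq_bounds) auto
    finally show "s - 1 / (real (lseq h))\<^sup>2 \<le> real (mseq h) / (real (lseq h))\<^sup>2" .
  qed
  show "\<forall>\<^sub>F h in sequentially. real (mseq h) / (real (lseq h))\<^sup>2 \<le> s"
  proof (intro always_eventually allI)
    fix h
    have "0 < (real (lseq h))\<^sup>2" using lseq_pos[of h] by simp
    thus "real (mseq h) / (real (lseq h))\<^sup>2 \<le> s"
      using mseq_bounds(1)[of h] by (simp only: pos_divide_le_eq)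
  qed
qed auto

lemma lseq_inverse: "(\<lambda>h. c / real (lseq h)) \<longlonglongrightarrow> 0"
  by (rule real_tendsto_divide_at_top[OF tendsto_const lseq_at_top])

lemma mseq_at_top: "filterlim mseq at_top sequentially"
proof -
  have "filterlim (\<lambda>h. real (mseq h)) at_top sequentially"
  proof (rule filterlim_at_top_mono)
    have "filterlim (\<lambda>h. s * (real (lseq h))\<^sup>2) at_top sequentially"
      using s by (intro filterlim_tendsto_pos_mult_at_top[OF tendsto_const] filterlim_pow_at_top lseq_at_top) auto
    thus "filterlim (\<lambda>h. - 1 + s * (real (lseq h))\<^sup>2) at_top sequentially"
      by (intro filterlim_tendsto_add_at_top[OF tendsto_const])
    show "\<forall>\<^sub>F h in sequentially. - 1 + s * (real (lseq h))\<^sup>2 \<le> real (mseq h)"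
      using mseq_bounds(2) by (intro always_eventually) auto
  qed
  thus ?thesis by (simp add: filterlim_sequentially_iff_filterlim_real)
qed

lemma prefactor_tendsto:
  "(\<lambda>h. real (lseq h) * (real ((2 * mseq h) choose mseq h) / 4 ^ mseq h)) \<longlonglongrightarrow> 1 / sqrt (pi * s)"
proof -
  have "(\<lambda>h. real ((2 * mseq h) choose mseq h) / 4 ^ mseq h * sqrt (2 * real (mseq h) + 1)) \<longlonglongrightarrow> sqrt (2 / pi)"
    by (rule filterlim_compose[OF central_binomial_tendsto mseq_at_top])
  moreover have "(\<lambda>h. sqrt (2 * (real (mseq h) / (real (lseq h))\<^sup>2) + 1 / real (lseq h) * (1 / real (lseq h)))) \<longlonglongrightarrow> sqrt (2 * s + 0 * 0)"
    by (intro tendsto_intros mseq_ratio lseq_inverse)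
  hence "(\<lambda>h. sqrt (2 * (real (mseq h) / (real (lseq h))\<^sup>2) + 1 / real (lseq h) * (1 / real (lseq h)))) \<longlonglongrightarrow> sqrt (2 * s)"
    by simp
  ultimately have "(\<lambda>h. (real ((2 * mseq h) choose mseq h) / 4 ^ mseq h * sqrt (2 * real (mseq h) + 1))
      / sqrt (2 * (real (mseq h) / (real (lseq h))\<^sup>2) + 1 / real (lseq h) * (1 / real (lseq h)))) \<longlonglongrightarrow> sqrt (2 / pi) / sqrt (2 * s)"
    using s by (intro tendsto_divide) auto
  moreover have "sqrt (2 * (real (mseq h) / (real (lseq h))\<^sup>2) + 1 / real (lseq h) * (1 / real (lseq h))) =
      sqrt (2 * real (mseq h) + 1) / real (lseq h)" for h
  proof -
    have "2 * (real (mseq h) / (real (lseq h))\<^sup>2) + 1 / real (lseq h) * (1 / real (lseq h)) = (2 * real (mseq h) + 1) / (real (lseq h))\<^sup>2"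
      by (simp add: add_divide_distrib power2_eq_square)
    thus ?thesis by (simp add: real_sqrt_divide)
  qed
  moreover have "(real ((2 * mseq h) choose mseq h) / 4 ^ mseq h * sqrt (2 * real (mseq h) + 1)) / (sqrt (2 * real (mseq h) + 1) / real (lseq h))
      = real (lseq h) * (real ((2 * mseq h) choose mseq h) / 4 ^ mseq h)" for h
  proof -
    have "sqrt (2 * real (mseq h) + 1) \<noteq> 0" by (simp add: add_nonneg_eq_0_iff)
    thus ?thesis by simp
  qed
  moreover have "sqrt (2 / pi) / sqrt (2 * s) = 1 / sqrt (pi * s)"
    by (simp add: real_sqrt_divide real_sqrt_mult)
  ultimately show ?thesis by (simp add: mult.commute)
qed

lemma cos_sum_tendsto:
  "(\<lambda>h. \<Sum>k = - int h..int h. cos (pi * of_int k / real (lseq h)) ^ (2 * mseq h)) \<longlonglongrightarrow> theta (exp (- (pi\<^sup>2 * s)))"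
proof -
  define r where "r = (\<lambda>h. real (mseq h) / (real (lseq h))\<^sup>2)"
  have r: "r \<longlonglongrightarrow> s" unfolding r_def by (rule mseq_ratio)
  define \<theta> where "\<theta> = (\<lambda>(k::int) h. pi * of_int k / real (lseq h))"
  define F where "F = (\<lambda>k h. if \<bar>k\<bar> \<le> int h then cos (\<theta> k h) ^ (2 * mseq h) else 0)"
  have sq: "real (mseq h) * (\<theta> k h)\<^sup>2 = (pi * of_int k)\<^sup>2 * r h" for h k
    by (simp add: \<theta>_def r_def power_divide)
  have range: "\<bar>\<theta> k h\<bar> \<le> pi / 2" if "\<bar>k\<bar> \<le> int h" for k h
  proof -
    have "\<bar>of_int k\<bar> \<le> real h" using that by linarith
    hence "\<bar>of_int k\<bar> / real (lseq h) \<le> 1 / 2" by (simp add: lseq_def field_simps)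
    hence "pi * (\<bar>of_int k\<bar> / real (lseq h)) \<le> pi * (1 / 2)" by (intro mult_left_mono) auto
    thus ?thesis by (simp add: \<theta>_def abs_mult)
  qed
  have up: "F k h \<le> exp (- ((pi * of_int k)\<^sup>2 * r h))" and nn: "0 \<le> F k h" for k h
  proof -
    have "F k h \<le> exp (- ((pi * of_int k)\<^sup>2 * r h)) \<and> 0 \<le> F k h"
    proof (cases "\<bar>k\<bar> \<le> int h")
      case True
      have "0 \<le> cos (\<theta> k h)" using range[OF True] by (intro cos_ge_zero) auto
      hence "cos (\<theta> k h) ^ (2 * mseq h) \<le> exp (- (\<theta> k h)\<^sup>2 / 2) ^ (2 * mseq h)"
        using cos_le_exp[OF range[OF True]] by (intro power_mono) auto
      also have "\<dots> = exp (- (real (mseq h) * (\<theta> k h)\<^sup>2))" by (simp flip: exp_of_nat_mult)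
      finally show ?thesis using True \<open>0 \<le> cos (\<theta> k h)\<close> by (simp add: F_def sq)
    qed (simp add: F_def)
    thus "F k h \<le> exp (- ((pi * of_int k)\<^sup>2 * r h))" "0 \<le> F k h" by auto
  qed
  have "(\<lambda>h. \<Sum>\<^sub>\<infinity>k. F k h) \<longlonglongrightarrow> (\<Sum>\<^sub>\<infinity>k. exp (- ((pi * of_int k)\<^sup>2 * s)))"
  proof (rule infsum_dominated_convergence)
    show "(\<lambda>k::int. exp (- (pi\<^sup>2 * (s / 2)) * (of_int k)\<^sup>2)) summable_on UNIV"
      using s by (intro summable_on_exp_square) auto
    \<comment> \<open>\<open>r h\<close> only tends to \<open>s\<close>; retreating to
      \<open>s / 2\<close> leaves room for a majorant independent of \<open>h\<close>.\<close>
    have "eventually (\<lambda>h. r h > s / 2) sequentially"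
      using r s by (intro order_tendstoD) auto
    thus "\<forall>\<^sub>F h in sequentially. \<forall>k. norm (F k h) \<le> exp (- (pi\<^sup>2 * (s / 2)) * (of_int k)\<^sup>2)"
    proof eventually_elim
      case (elim h)
      show ?case
      proof
        fix k
        have "(pi * of_int k)\<^sup>2 * (s / 2) \<le> (pi * of_int k)\<^sup>2 * r h"
          using elim by (intro mult_left_mono) auto
        hence "exp (- ((pi * of_int k)\<^sup>2 * r h)) \<le> exp (- ((pi * of_int k)\<^sup>2 * (s / 2)))" by simp
        with up[of k h] have "F k h \<le> exp (- ((pi * of_int k)\<^sup>2 * (s / 2)))" by linarith
        thus "norm (F k h) \<le> exp (- (pi\<^sup>2 * (s / 2)) * (of_int k)\<^sup>2)"
          using nn[of k h] by (simp add: power_mult_distrib mult_ac)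
      qed
    qed
    fix k :: int
    show "F k \<longlonglongrightarrow> exp (- ((pi * of_int k)\<^sup>2 * s))"
    \<comment> \<open>The lower function comes from cos t >= 1 - y >= exp(-y - 2y^2) with y = t^2/2;
      raised to the power 2m it is exp(-m t^2 - m t^4), and t tends to 0 while m t^2 stays
      bounded.\<close>
    proof (rule tendsto_sandwich[where
          f = "\<lambda>h. exp (- ((pi * of_int k)\<^sup>2 * r h) - (pi * of_int k)\<^sup>2 * r h * (\<theta> k h)\<^sup>2)"])
      show "\<forall>\<^sub>F h in sequentially. F k h \<le> exp (- ((pi * of_int k)\<^sup>2 * r h))"
        using up by (intro always_eventually) auto
      show "(\<lambda>h. exp (- ((pi * of_int k)\<^sup>2 * r h))) \<longlonglongrightarrow> exp (- ((pi * of_int k)\<^sup>2 * s))"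
        by (intro tendsto_intros r)
      have \<theta>0: "\<theta> k \<longlonglongrightarrow> 0" unfolding \<theta>_def by (rule lseq_inverse)
      have "(\<lambda>h. exp (- ((pi * of_int k)\<^sup>2 * r h) - (pi * of_int k)\<^sup>2 * r h * (\<theta> k h)\<^sup>2)) \<longlonglongrightarrow>
          exp (- ((pi * of_int k)\<^sup>2 * s) - (pi * of_int k)\<^sup>2 * s * 0\<^sup>2)"
        by (intro tendsto_intros r \<theta>0)
      thus "(\<lambda>h. exp (- ((pi * of_int k)\<^sup>2 * r h) - (pi * of_int k)\<^sup>2 * r h * (\<theta> k h)\<^sup>2)) \<longlonglongrightarrow>
          exp (- ((pi * of_int k)\<^sup>2 * s))" by simp
      have "(\<lambda>h. (\<theta> k h)\<^sup>2 / 2) \<longlonglongrightarrow> 0\<^sup>2 / 2" by (intro tendsto_intros \<theta>0) auto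
      hence "eventually (\<lambda>h. (\<theta> k h)\<^sup>2 / 2 < 1 / 2) sequentially" by (rule order_tendstoD) simp
      moreover have "eventually (\<lambda>h. h \<ge> nat \<bar>k\<bar>) sequentially" by (rule eventually_ge_at_top)
      ultimately show "\<forall>\<^sub>F h in sequentially. exp (- ((pi * of_int k)\<^sup>2 * r h) - (pi * of_int k)\<^sup>2 * r h * (\<theta> k h)\<^sup>2) \<le> F k h"
      proof eventually_elim
        case (elim h)
        define y where "y = (\<theta> k h)\<^sup>2 / 2"
        have y: "0 \<le> y" "y \<le> 1 / 2" using elim(1) by (auto simp: y_def)
        have "exp (- y - 2 * y\<^sup>2) \<le> cos (\<theta> k h)"
          using exp_le_one_minus[OF y] cos_ge_quadratic[of "\<theta> k h"] by (simp add: y_def)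
        hence "exp (- y - 2 * y\<^sup>2) ^ (2 * mseq h) \<le> cos (\<theta> k h) ^ (2 * mseq h)"
          by (intro power_mono) auto
        moreover have "exp (- y - 2 * y\<^sup>2) ^ (2 * mseq h) =
            exp (- (real (mseq h) * (\<theta> k h)\<^sup>2) - real (mseq h) * (\<theta> k h)\<^sup>2 * (\<theta> k h)\<^sup>2)"
          unfolding exp_of_nat_mult[symmetric] y_def by (simp add: algebra_simps power2_eq_square)
        moreover have "F k h = cos (\<theta> k h) ^ (2 * mseq h)" using elim(2) by (simp add: F_def nat_le_iff)
        ultimately show ?case by (simp only: sq)
      qed
    qed
  qed auto
  moreover have "(\<Sum>\<^sub>\<infinity>k. F k h) = (\<Sum>k = - int h..int h. cos (pi * of_int k / real (lseq h)) ^ (2 * mseq h))" for h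
  proof -
    have "(\<Sum>\<^sub>\<infinity>k. F k h) = (\<Sum>\<^sub>\<infinity>k\<in>{- int h..int h}. cos (pi * of_int k / real (lseq h)) ^ (2 * mseq h))"
      by (rule infsum_cong_neutral) (auto simp: F_def \<theta>_def)
    thus ?thesis by simp
  qed
  moreover have "(\<Sum>\<^sub>\<infinity>k::int. exp (- ((pi * of_int k)\<^sup>2 * s))) = theta (exp (- (pi\<^sup>2 * s)))"
    by (simp add: theta_def exp_power_int power_mult_distrib power2_eq_square mult_ac)
  ultimately show ?thesis by simp
qed

lemma binomial_sum_tendsto:
  "(\<lambda>h. \<Sum>\<^sub>\<infinity>\<nu>. central_binomial (mseq h) (int (lseq h) * \<nu>) / real ((2 * mseq h) choose mseq h)) \<longlonglongrightarrow> theta (exp (- (1 / s)))"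
proof -
  define r where "r = (\<lambda>h. real (mseq h) / (real (lseq h))\<^sup>2)"
  have r: "r \<longlonglongrightarrow> s" unfolding r_def by (rule mseq_ratio)
  define R where "R = (\<lambda>\<nu> h. central_binomial (mseq h) (int (lseq h) * \<nu>) / real ((2 * mseq h) choose mseq h))"
  \<comment> \<open>The error term of the binomial bounds after rescaling: with i = l \<nu> the
    exponent i^2/(m + |i|) becomes \<nu>^2/(r + d).\<close>
  define d where "d = (\<lambda>(\<nu>::int) h. \<bar>of_int \<nu>\<bar> / real (lseq h))"
  have d: "d \<nu> \<longlonglongrightarrow> 0" for \<nu> unfolding d_def by (rule lseq_inverse)
  have C: "real ((2 * m) choose m) > 0" for m by simp
  have l: "real (lseq h) > 0" for h using lseq_pos[of h] by simp
  have rpos: "eventually (\<lambda>h. r h > 0) sequentially" using r s by (intro order_tendstoD) auto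
  have up: "R \<nu> h \<le> exp (- (of_int \<nu>)\<^sup>2 / (r h + d \<nu> h))" for \<nu> h
  proof -
    have "R \<nu> h \<le> exp (- (of_int (int (lseq h) * \<nu>))\<^sup>2 / (real (mseq h) + \<bar>of_int (int (lseq h) * \<nu>)\<bar>))"
      unfolding R_def using central_binomial_le[of "mseq h" "int (lseq h) * \<nu>"] C[of "mseq h"]
      by (simp add: pos_divide_le_eq mult.commute)
    also have "- (of_int (int (lseq h) * \<nu>))\<^sup>2 / (real (mseq h) + \<bar>of_int (int (lseq h) * \<nu>)\<bar>) = - (of_int \<nu>)\<^sup>2 / (r h + d \<nu> h)"
    proof -
      have "- (L * v)\<^sup>2 / (M + \<bar>L * v\<bar>) = - v\<^sup>2 / (M / L\<^sup>2 + \<bar>v\<bar> / L)" if "L > 0" for L v M :: real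
      proof -
        have "M / L\<^sup>2 + \<bar>v\<bar> / L = (M + \<bar>L * v\<bar>) / L\<^sup>2"
          using that by (simp add: abs_mult add_divide_distrib power2_eq_square)
        thus ?thesis by (simp add: power_mult_distrib mult.commute)
      qed
      from this[OF l[of h]] show ?thesis by (simp add: r_def d_def)
    qed
    finally show ?thesis .
  qed
  have "(\<lambda>h. \<Sum>\<^sub>\<infinity>\<nu>. R \<nu> h) \<longlonglongrightarrow> (\<Sum>\<^sub>\<infinity>\<nu>. exp (- (of_int \<nu>)\<^sup>2 / s))"
  proof (rule infsum_dominated_convergence)
    show "(\<lambda>\<nu>::int. exp (- (1 / (2 * s)) * (of_int \<nu>)\<^sup>2)) summable_on UNIV"
      using s by (intro summable_on_exp_square) auto
    show "\<forall>\<^sub>F h in sequentially. \<forall>\<nu>. norm (R \<nu> h) \<le> exp (- (1 / (2 * s)) * (of_int \<nu>)\<^sup>2)"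
      using rpos
    proof eventually_elim
      case (elim h)
      show ?case
      proof
        fix \<nu>
        have "0 \<le> R \<nu> h" by (simp add: R_def central_binomial_def)
        moreover have "R \<nu> h \<le> exp (- (1 / (2 * s)) * (of_int \<nu>)\<^sup>2)"
        proof (cases "\<bar>int (lseq h) * \<nu>\<bar> \<le> int (mseq h)")
          \<comment> \<open>Only these \<nu> have nonzero coefficients, and for them d <= r <= s. So
            r + d <= 2s, the origin of the majorant exp(-\<nu>^2/(2s)).\<close>
          case True
          have "real_of_int \<bar>int (lseq h) * \<nu>\<bar> \<le> real_of_int (int (mseq h))"
            using True by (simp only: of_int_le_iff)
          hence "real (lseq h) * \<bar>of_int \<nu>\<bar> \<le> real (mseq h)" by (simp add: abs_mult)
          hence "real (lseq h) * \<bar>of_int \<nu>\<bar> / (real (lseq h))\<^sup>2 \<le> real (mseq h) / (real (lseq h))\<^sup>2"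
            by (intro divide_right_mono) auto
          hence "d \<nu> h \<le> r h" using l[of h] by (simp add: d_def r_def power2_eq_square)
          moreover have "r h \<le> s"
            using mseq_bounds(1)[of h] l[of h] by (simp add: r_def pos_divide_le_eq)
          moreover have "0 \<le> d \<nu> h" by (simp add: d_def)
          ultimately have "(of_int \<nu>)\<^sup>2 / (2 * s) \<le> (of_int \<nu>)\<^sup>2 / (r h + d \<nu> h)"
            using elim s by (intro divide_left_mono) auto
          hence "exp (- (of_int \<nu>)\<^sup>2 / (r h + d \<nu> h)) \<le> exp (- (1 / (2 * s)) * (of_int \<nu>)\<^sup>2)" by simp
          with up[of \<nu> h] show ?thesis by linarith
        qed (simp add: R_def central_binomial_def)
        ultimately show "norm (R \<nu> h) \<le> exp (- (1 / (2 * s)) * (of_int \<nu>)\<^sup>2)" by simp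
      qed
    qed
    fix \<nu> :: int
    show "R \<nu> \<longlonglongrightarrow> exp (- (of_int \<nu>)\<^sup>2 / s)"
    proof (rule tendsto_sandwich[where
          f = "\<lambda>h. exp (- (of_int \<nu>)\<^sup>2 / r h * (1 + 4 * (d \<nu> h / r h)))"])
      show "\<forall>\<^sub>F h in sequentially. R \<nu> h \<le> exp (- (of_int \<nu>)\<^sup>2 / (r h + d \<nu> h))"
        using up by (intro always_eventually) auto
      have "(\<lambda>h. exp (- (of_int \<nu>)\<^sup>2 / (r h + d \<nu> h))) \<longlonglongrightarrow> exp (- (of_int \<nu>)\<^sup>2 / (s + 0))"
        using s by (intro tendsto_intros r d) auto
      thus "(\<lambda>h. exp (- (of_int \<nu>)\<^sup>2 / (r h + d \<nu> h))) \<longlonglongrightarrow> exp (- (of_int \<nu>)\<^sup>2 / s)" by simp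
      have "(\<lambda>h. exp (- (of_int \<nu>)\<^sup>2 / r h * (1 + 4 * (d \<nu> h / r h)))) \<longlonglongrightarrow> exp (- (of_int \<nu>)\<^sup>2 / s * (1 + 4 * (0 / s)))"
        using s by (intro tendsto_intros r d) auto
      thus "(\<lambda>h. exp (- (of_int \<nu>)\<^sup>2 / r h * (1 + 4 * (d \<nu> h / r h)))) \<longlonglongrightarrow> exp (- (of_int \<nu>)\<^sup>2 / s)" by simp
      have "(\<lambda>h. r h - 4 * d \<nu> h) \<longlonglongrightarrow> s - 4 * 0" by (intro tendsto_intros r d)
      hence "eventually (\<lambda>h. r h - 4 * d \<nu> h > 0) sequentially" using s by (intro order_tendstoD) auto
      with rpos show "\<forall>\<^sub>F h in sequentially. exp (- (of_int \<nu>)\<^sup>2 / r h * (1 + 4 * (d \<nu> h / r h))) \<le> R \<nu> h"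
      proof eventually_elim
        case (elim h)
        define L where "L = real (lseq h)"
        define M where "M = real (mseq h)"
        have L: "L > 0" using l by (simp add: L_def)
        have M: "M > 0" using elim(1) L by (simp add: r_def M_def L_def zero_less_divide_iff)
        have rh: "r h = M / L\<^sup>2" and dh: "d \<nu> h = \<bar>of_int \<nu>\<bar> / L" by (simp_all add: r_def d_def L_def M_def)
        have "4 * (\<bar>of_int \<nu>\<bar> / L) < M / L\<^sup>2" using elim(2) by (simp add: rh dh)
        hence "4 * (\<bar>of_int \<nu>\<bar> / L) * L\<^sup>2 < M" using L by (simp only: pos_less_divide_eq zero_less_power)
        hence le: "4 * (L * \<bar>of_int \<nu>\<bar>) \<le> M" using L by (simp add: power2_eq_square mult_ac)
        have "real_of_int (4 * \<bar>int (lseq h) * \<nu>\<bar>) \<le> real_of_int (int (mseq h))"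
          using le by (simp add: L_def M_def abs_mult)
        hence "4 * \<bar>int (lseq h) * \<nu>\<bar> \<le> int (mseq h)" by (simp only: of_int_le_iff)
        moreover have "mseq h > 0" using M by (simp add: M_def)
        ultimately have "exp (- (of_int (int (lseq h) * \<nu>))\<^sup>2 / M * (1 + 4 * \<bar>of_int (int (lseq h) * \<nu>)\<bar> / M)) \<le> R \<nu> h"
          unfolding R_def M_def using central_binomial_ge[of "int (lseq h) * \<nu>" "mseq h"] C[of "mseq h"]
          by (simp add: pos_le_divide_eq mult.commute)
        moreover have "- (of_int (int (lseq h) * \<nu>))\<^sup>2 / M * (1 + 4 * \<bar>of_int (int (lseq h) * \<nu>)\<bar> / M) =
            - (of_int \<nu>)\<^sup>2 / r h * (1 + 4 * (d \<nu> h / r h))"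
          unfolding rh dh using L M by (simp add: abs_mult power_mult_distrib power2_eq_square L_def[symmetric] mult_ac)
        ultimately show ?case by simp
      qed
    qed
  qed auto
  moreover have "(\<Sum>\<^sub>\<infinity>\<nu>::int. exp (- (of_int \<nu>)\<^sup>2 / s)) = theta (exp (- (1 / s)))"
    by (simp add: theta_def exp_power_int power2_eq_square)
  ultimately show ?thesis by (simp add: R_def)
qed

text \<open>Polya's identity divided by 4^m: the cosine side tends to the left theta, the binomial
  side splits into the prefactor l C(2m,m)/4^m and the normalised sum.\<close>

lemma theta_inversion_aux: "theta (exp (- (pi\<^sup>2 * s))) = 1 / sqrt (pi * s) * theta (exp (- (1 / s)))"
proof (rule LIMSEQ_unique[OF cos_sum_tendsto])
  have "(\<Sum>k = - int h..int h. cos (pi * of_int k / real (lseq h)) ^ (2 * mseq h)) =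
      real (lseq h) * (real ((2 * mseq h) choose mseq h) / 4 ^ mseq h) *
      (\<Sum>\<^sub>\<infinity>\<nu>. central_binomial (mseq h) (int (lseq h) * \<nu>) / real ((2 * mseq h) choose mseq h))" for h
  proof -
    define c where "c = real ((2 * mseq h) choose mseq h)"
    have c: "c \<noteq> 0" by (simp add: c_def)
    have "4 ^ mseq h * (\<Sum>k = - int h..int h. cos (pi * of_int k / real (lseq h)) ^ (2 * mseq h)) =
        (\<Sum>k = - int h..int h. (2 * cos (pi * of_int k / real (lseq h))) ^ (2 * mseq h))"
      by (simp add: sum_distrib_left power_mult_distrib power_mult)
    also have "\<dots> = real (lseq h) * (\<Sum>\<^sub>\<infinity>\<nu>. central_binomial (mseq h) (int (lseq h) * \<nu>))"
      unfolding lseq_def by (rule polya_finite_theta)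
    also have "\<dots> = real (lseq h) * (c * (\<Sum>\<^sub>\<infinity>\<nu>. central_binomial (mseq h) (int (lseq h) * \<nu>) / c))"
      using c by (simp only: infsum_cmult_right'[symmetric]) simp
    finally show ?thesis unfolding c_def[symmetric] by (simp add: field_simps)
  qed
  thus "(\<lambda>h. \<Sum>k = - int h..int h. cos (pi * of_int k / real (lseq h)) ^ (2 * mseq h)) \<longlonglongrightarrow>
      1 / sqrt (pi * s) * theta (exp (- (1 / s)))"
    by (simp only:) (intro tendsto_mult prefactor_tendsto binomial_sum_tendsto)
qed

end

theorem theta_inversion:
  fixes t :: real
  assumes "t > 0"
  shows "theta (exp (- (pi * t))) = theta (exp (- (pi / t))) / sqrt t"
  using theta_inversion_aux[of "t / pi"] assms by (simp add: power2_eq_square)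

section \<open>Evaluations\<close>

text \<open>The value of the fraction at \<open>- x\<close>, as supplied by
  \<open>V_conv_tendsto_theta\<close>; all evaluations concern this closed form.\<close>

definition cubic_cf :: "real \<Rightarrow> real" where
  "cubic_cf x = - (root 3 x * theta6 x / theta (x ^ 3))"

lemma V_conv_tendsto_cubic_cf:
  assumes "0 < x" "x < 1"
  shows "V_conv (- x) \<longlonglongrightarrow> cubic_cf x"
  unfolding cubic_cf_def by (rule V_conv_tendsto_theta[OF assms])

lemma power_unit_interval: "0 < x \<Longrightarrow> x < 1 \<Longrightarrow> n > 0 \<Longrightarrow> 0 < x ^ n \<and> x ^ n < (1::real)"
  by (simp add: power_less_one_iff)

lemma cubic_cf_cube:
  assumes x: "0 < x" "x < 1"
  shows "1 - 8 * cubic_cf x ^ 3 = theta x ^ 4 / theta (x ^ 3) ^ 4"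
proof -
  have p: "theta (x ^ 3) > 0" using power_unit_interval[OF x, of 3] by (intro theta_pos) auto
  have "cubic_cf x ^ 3 = - (x * theta6 x ^ 3 / theta (x ^ 3) ^ 3)"
    using x by (simp add: cubic_cf_def power_mult_distrib power_divide)
  moreover have "1 - 8 * (- (A / T ^ 3)) = (T ^ 3 + 8 * A) * T / T ^ 4" if "T > 0" for A T :: real
  proof -
    have "T ^ 4 = T ^ 3 * T" by (simp add: numeral_eq_Suc)
    hence "(T ^ 3 + 8 * A) * T / T ^ 4 = (T ^ 3 + 8 * A) / T ^ 3" using that by simp
    thus ?thesis using that by (simp add: add_divide_distrib)
  qed
  ultimately have "1 - 8 * cubic_cf x ^ 3 = (theta (x ^ 3) ^ 3 + 8 * (x * theta6 x ^ 3)) * theta (x ^ 3) / theta (x ^ 3) ^ 4"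
    using p by simp
  hence "1 - 8 * cubic_cf x ^ 3 = (theta (x ^ 3) ^ 3 + 8 * x * theta6 x ^ 3) * theta (x ^ 3) / theta (x ^ 3) ^ 4"
    by (simp only: mult.assoc)
  thus ?thesis unfolding theta_cubic[OF x] .
qed

lemma cubic_cf_of_cube:
  assumes x: "0 < x" "x < 1"
  shows "1 - 2 * cubic_cf (x ^ 3) = theta x / theta (x ^ 9)"
proof -
  have p: "theta (x ^ 9) > 0" using power_unit_interval[OF x, of 9] by (intro theta_pos) auto
  have "cubic_cf (x ^ 3) = - (x * theta6 (x ^ 3) / theta (x ^ 9))"
    using x by (simp add: cubic_cf_def odd_real_root_power_cancel flip: power_mult)
  thus ?thesis using theta_dissection_3[of x] x p by (simp add: field_simps)
qed

text \<open>The form free of theta functions: it shows the sign, and it makes the elimination for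
  sqrt 5 a matter of monomials in values of \<open>qchi\<close>.\<close>

lemma cubic_cf_qchi:
  assumes x: "0 < x" "x < 1"
  shows "cubic_cf x = - (root 3 x * qchi x / qchi (x ^ 3) ^ 3)"
proof -
  have x3: "0 < x ^ 3" "x ^ 3 < 1" using power_unit_interval[OF x, of 3] by auto
  have p: "theta (x ^ 3) > 0" "qchi (x ^ 3) > 0" using theta_pos[OF x3] qchi_pos[OF x3] by auto
  define E where "E = qpoch (x ^ 6) (x ^ 6)"
  have th: "theta (x ^ 3) = E * (qchi (x ^ 3))\<^sup>2"
    using theta_product[of "x ^ 3"] x3 by (simp add: E_def flip: power_mult)
  have "theta6 x = E * qchi x / qchi (x ^ 3)"
    using theta6_product[of x] x p(2) by (simp add: E_def nonzero_eq_divide_eq)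
  moreover have "E \<noteq> 0" using th p by auto
  ultimately show ?thesis
    unfolding cubic_cf_def th using p(2) by (simp add: power2_eq_square power3_eq_cube)
qed

lemma cubic_cf_neg:
  assumes x: "0 < x" "x < 1"
  shows "cubic_cf x < 0"
proof -
  have "qchi x > 0" by (rule qchi_pos[OF x])
  moreover have "qchi (x ^ 3) > 0" using power_unit_interval[OF x, of 3] by (intro qchi_pos) auto
  ultimately show ?thesis using x by (simp add: cubic_cf_qchi)
qed

text \<open>A crude numerical bound, inherited from the bound 1/2 on the truncated tails; it later
  selects the right root for sqrt 5.\<close>

lemma cubic_cf_ge:
  assumes x: "0 < x" "x < 1"
  shows "cubic_cf x \<ge> - 2 * root 3 x"
proof (rule LIMSEQ_le_const[OF V_conv_tendsto_cubic_cf[OF x]])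
  have "- 2 * root 3 x \<le> V_conv (- x) n" for n
  proof -
    have "root 3 x / cf_tail (- x) n 1 \<le> root 3 x / (1 / 2)"
      using cf_tail_ge[of "- x" n 1] x by (intro divide_left_mono) auto
    thus ?thesis by (simp add: V_conv_def real_root_minus)
  qed
  thus "\<exists>N. \<forall>n\<ge>N. - 2 * root 3 x \<le> V_conv (- x) n" by blast
qed

definition nome :: "real \<Rightarrow> real" where
  "nome a = exp (- (pi * a))"

lemma nome_unit: "a > 0 \<Longrightarrow> 0 < nome a" "a > 0 \<Longrightarrow> nome a < 1"
  by (simp_all add: nome_def)

lemma nome_power: "nome a ^ n = nome (real n * a)"
  by (simp add: nome_def mult_ac flip: exp_of_nat_mult)

lemma theta_nome_pos: "a > 0 \<Longrightarrow> theta (nome a) > 0"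
  by (intro theta_pos nome_unit)

lemma theta_nome_inversion: "a > 0 \<Longrightarrow> theta (nome a) = theta (nome (1 / a)) / sqrt a"
  using theta_inversion[of a] by (simp add: nome_def)

lemma cubic_cf_nome: "a > 0 \<Longrightarrow> 1 - 2 * cubic_cf (nome a) = theta (nome (a / 3)) / theta (nome (3 * a))"
  using cubic_cf_of_cube[of "nome (a / 3)"] nome_unit[of "a / 3"] by (simp add: nome_power)

lemma cubic_cf_nome_cube:
  "a > 0 \<Longrightarrow> 1 - 8 * cubic_cf (nome a) ^ 3 = (theta (nome a) / theta (nome (3 * a))) ^ 4"
  using cubic_cf_cube[of "nome a"] nome_unit[of a] by (simp add: nome_power power_divide)

text \<open>Both factors are fourth powers of theta quotients. Inversion maps the parameters a and
  3a to 1/a and 1/(3a), so the quotients cancel up to (sqrt 3)^4 = 9.\<close>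

lemma cubic_cf_modular:
  assumes a: "a > 0"
  shows "(8 * cubic_cf (nome a) ^ 3 - 1) * (8 * cubic_cf (nome (1 / (3 * a))) ^ 3 - 1) = 9"
proof -
  define A B where "A = theta (nome (1 / a))" and "B = theta (nome (1 / (3 * a)))"
  have pos: "A > 0" "B > 0" using a by (auto simp: A_def B_def intro: theta_nome_pos)
  have 1: "1 - 8 * cubic_cf (nome a) ^ 3 = ((A / sqrt a) / (B / sqrt (3 * a))) ^ 4"
    using cubic_cf_nome_cube[OF a] theta_nome_inversion[OF a] theta_nome_inversion[of "3 * a"] a
    by (simp add: A_def B_def)
  have 2: "1 - 8 * cubic_cf (nome (1 / (3 * a))) ^ 3 = (B / A) ^ 4"
    using cubic_cf_nome_cube[of "1 / (3 * a)"] a by (simp add: A_def B_def)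
  have 3: "((A / sqrt a) / (B / sqrt (3 * a))) * (B / A) = sqrt 3"
    using pos a by (simp add: real_sqrt_mult)
  have 4: "(sqrt 3) ^ 4 = (9 :: real)"
    using power_mult[of "sqrt 3" 2 2] by simp
  have "(1 - 8 * cubic_cf (nome a) ^ 3) * (1 - 8 * cubic_cf (nome (1 / (3 * a))) ^ 3) = 9"
    unfolding 1 2 power_mult_distrib[symmetric] 3 4 ..
  moreover have "(X - 1) * (Y - 1) = (1 - X) * (1 - Y)" for X Y :: real by (simp add: algebra_simps)
  ultimately show ?thesis by (simp only:)
qed

section \<open>Values obtained from inversion and the cubic relations alone\<close>

lemma cube_eq_real:
  assumes "(x::real) ^ 3 = y ^ 3"
  shows "x = y"
proof -
  have cancel: "root 3 (z ^ 3) = z" for z :: real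
    by (rule odd_real_root_power_cancel) simp
  have "root 3 (x ^ 3) = root 3 (y ^ 3)" by (simp only: assms)
  thus ?thesis by (simp only: cancel)
qed

text \<open>The relation at a = 1 involves the nomes with parameters 1/3 and 3, which inversion
  exchanges.\<close>

lemma cubic_cf_1: "cubic_cf (nome 1) = (1 - sqrt 3) / 2"
proof -
  have "theta (nome (1 / 3)) = theta (nome 3) / sqrt (1 / 3)"
    using theta_nome_inversion[of "1 / 3"] by simp
  hence "1 - 2 * cubic_cf (nome 1) = sqrt 3"
    using cubic_cf_nome[of 1] theta_nome_pos[of 3] by (simp add: real_sqrt_divide)
  thus ?thesis by simp
qed

lemma cubic_cf_third: "cubic_cf (nome (1 / 3)) = - 1 / root 3 (2 * (sqrt 3 - 1))"
proof -
  define s where "s = sqrt 3"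
  have s: "s * s = 3" "s > 1" by (auto simp: s_def)
  have "8 * cubic_cf (nome 1) ^ 3 = (1 - s) ^ 3"
    by (simp add: cubic_cf_1 s_def power_divide)
  also have "(1 - s) ^ 3 = 10 - 6 * s" 
  proof -
    have "(1 - s) ^ 3 - (10 - 6 * s) = (s * s - 3) * (3 - s)"
      by (simp add: algebra_simps power3_eq_cube)
    thus ?thesis using s(1) by simp
  qed
  finally have "8 * cubic_cf (nome 1) ^ 3 = 10 - 6 * s" .
  moreover define X where "X = cubic_cf (nome (1 / 3)) ^ 3"
  ultimately have "(9 - 6 * s) * (8 * X - 1) = 9"
    using cubic_cf_modular[of 1] by simp
  \<comment> \<open>Rationalisation by the conjugate of 9 - 6 sqrt 3, whose norm is -27.\<close>
  moreover have "(9 - 6 * s) * (9 + 6 * s) * (8 * X - 1) = 9 * (9 + 6 * s)"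
    if "(9 - 6 * s) * (8 * X - 1) = 9"
  proof -
    have "(9 - 6 * s) * (9 + 6 * s) * (8 * X - 1) = (9 - 6 * s) * (8 * X - 1) * (9 + 6 * s)"
      by (simp only: mult_ac)
    thus ?thesis using that by (simp only:)
  qed
  moreover have "(9 - 6 * s) * (9 + 6 * s) = - 27" using s(1) by (simp add: algebra_simps)
  ultimately have "- 27 * (8 * X - 1) = 9 * (9 + 6 * s)" by simp
  hence "X = - (1 + s) / 4" by simp
  moreover have "- (1 + s) / 4 * (2 * (s - 1)) = - 1" using s(1) by (simp add: algebra_simps)
  ultimately have "X * (2 * (s - 1)) = - 1" by (simp only:)
  hence "X = - (1 / (2 * (s - 1)))" using s(2) by (simp add: field_simps)
  hence "X = (- 1 / root 3 (2 * (s - 1))) ^ 3" using s(2) by (simp add: power_divide)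
  thus ?thesis unfolding X_def s_def by (rule cube_eq_real)
qed

text \<open>1/sqrt 3 is the fixed point of a -> 1/(3a), so the modular relation becomes a square;
  the sign of the fraction discards the root 1/2.\<close>

lemma cubic_cf_inv_sqrt3_cube: "cubic_cf (nome (1 / sqrt 3)) ^ 3 = - 1 / 4"
proof -
  define X where "X = cubic_cf (nome (1 / sqrt 3)) ^ 3"
  have "1 / (3 * (1 / sqrt 3)) = 1 / sqrt 3"
    by (simp add: field_simps)
  hence "(8 * X - 1) * (8 * X - 1) = 9"
    using cubic_cf_modular[of "1 / sqrt 3"] by (simp add: X_def)
  hence "(4 * X + 1) * (2 * X - 1) = 0" by (simp add: algebra_simps)
  moreover have "X < 0"
    using cubic_cf_neg[of "nome (1 / sqrt 3)"] by (simp add: X_def nome_unit)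
  ultimately have "4 * X + 1 = 0" by auto
  thus ?thesis by (simp add: X_def)
qed

lemma cubic_cf_inv_sqrt3: "cubic_cf (nome (1 / sqrt 3)) = - 1 / root 3 4"
proof (rule cube_eq_real)
  show "cubic_cf (nome (1 / sqrt 3)) ^ 3 = (- 1 / root 3 4) ^ 3"
    unfolding cubic_cf_inv_sqrt3_cube by (simp add: power_divide)
qed

lemma root_3_4: "root 3 4 = (root 3 2)\<^sup>2"
proof -
  have "root 3 4 = root 3 (2\<^sup>2)" by simp
  thus ?thesis by (simp only: real_root_power)
qed

lemma
  defines "c \<equiv> root 3 2"
  shows cubic_cf_sqrt3: "cubic_cf (nome (sqrt 3)) = (1 - root 3 4) / (2 + root 3 4)"
    and cubic_cf_sqrt3_cube: "8 * cubic_cf (nome (sqrt 3)) ^ 3 - 1 = - 27 / (1 + c) ^ 4"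
proof -
  have c: "c ^ 3 = 2" "c > 0" by (auto simp: c_def)
  have d: "root 3 4 = c\<^sup>2" by (simp add: c_def root_3_4)
  define w where "w = cubic_cf (nome (sqrt 3))"
  define u where "u = 1 - 2 * w"
  have u_pos: "u > 0"
    using cubic_cf_neg[of "nome (sqrt 3)"] by (simp add: u_def w_def nome_unit)
  define A B C where "A = theta (nome (1 / sqrt 3))" and "B = theta (nome (sqrt 3))"
    and "C = theta (nome (3 * sqrt 3))"
  have pos: "A > 0" "B > 0" "C > 0" by (auto simp: A_def B_def C_def intro: theta_nome_pos)
  have arg: "3 * (1 / sqrt 3) = sqrt 3" "sqrt 3 / 3 = 1 / sqrt 3" by (simp_all add: field_simps)
  have 1: "(A / B) ^ 4 = 3"
    using cubic_cf_nome_cube[of "1 / sqrt 3"] unfolding arg cubic_cf_inv_sqrt3_cube by (simp add: A_def B_def)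
  have 2: "u = A / C"
    using cubic_cf_nome[of "sqrt 3"] unfolding arg by (simp add: A_def C_def u_def w_def)
  have 3: "1 - 8 * w ^ 3 = (B / C) ^ 4"
    using cubic_cf_nome_cube[of "sqrt 3"] by (simp add: B_def C_def w_def)
  \<comment> \<open>The parameters 1/sqrt 3, sqrt 3 and 3 sqrt 3 form a chain with ratio 3. Its
    first quotient is known, its second and the whole are expressed by \<open>w\<close>, which
    yields an equation for \<open>w\<close> alone.\<close>
  have "A / C = (A / B) * (B / C)" using pos by simp
  hence u4: "u ^ 4 = 3 * (1 - 8 * w ^ 3)"
    unfolding 2 3 by (simp only: power_mult_distrib 1)
  have w: "w = (1 - u) / 2" by (simp add: u_def)
  have "u * (u ^ 3 - 3 * (u\<^sup>2 - 3 * u + 3)) = 0"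
    using u4 unfolding w by (simp add: field_simps power2_eq_square power3_eq_cube numeral_eq_Suc)
  hence "u ^ 3 = 3 * (u\<^sup>2 - 3 * u + 3)" using u_pos by simp
  \<comment> \<open>Adding 27 - 27u + 9u^2 - u^3 = (3 - u)^3 in place of the quadratic shows that
    the cubic is 2 u^3 = (3 - u)^3, solvable by a real cube root.\<close>
  hence "(c * u) ^ 3 = (3 - u) ^ 3"
    unfolding power_mult_distrib c(1) by (simp add: power2_eq_square power3_eq_cube algebra_simps)
  hence "c * u = 3 - u" by (rule cube_eq_real)
  hence u: "u = 3 / (1 + c)" using c(2) by (simp add: field_simps)
  show "8 * cubic_cf (nome (sqrt 3)) ^ 3 - 1 = - 27 / (1 + c) ^ 4"
    using u4 unfolding u w_def[symmetric] by (simp add: power_divide)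
  have "w = (c - 2) / (2 * (1 + c))" unfolding w u using c(2) by (simp add: field_simps)
  moreover have "(c - 2) * (2 + c\<^sup>2) = (1 - c\<^sup>2) * (2 * (1 + c))"
    using c(1) by (simp add: power2_eq_square power3_eq_cube algebra_simps)
  moreover have "2 + c\<^sup>2 > 0" by (simp add: add_pos_nonneg)
  ultimately show "cubic_cf (nome (sqrt 3)) = (1 - root 3 4) / (2 + root 3 4)"
    unfolding d w_def[symmetric] using c(2) by (simp add: frac_eq_eq)
qed

lemma cubic_cf_inv_3_sqrt3:
  "cubic_cf (nome (1 / (3 * sqrt 3))) = - 1 / root 3 ((1 / 3) * (root 3 4 - 1) ^ 4 + 1)"
proof (rule cube_eq_real)
  define c where "c = root 3 2"
  have c: "c ^ 3 = 2" "c > 0" by (auto simp: c_def)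
  have d: "root 3 4 = c\<^sup>2" by (simp add: c_def root_3_4)
  define X where "X = cubic_cf (nome (1 / (3 * sqrt 3))) ^ 3"
  have "- 27 / (1 + c) ^ 4 * (8 * X - 1) = 9"
    using cubic_cf_modular[of "sqrt 3"] unfolding cubic_cf_sqrt3_cube c_def X_def by simp
  hence "- 3 * (8 * X - 1) = (1 + c) ^ 4" using c(2) by (simp add: field_simps)
  moreover have c3: "c * (c * c) = 2" "c * (c * (c * z)) = 2 * z" for z
    using c(1) by (simp_all add: power3_eq_cube mult.assoc[symmetric])
  have "(1 + c) ^ 4 = 9 + 6 * c + 6 * (c * c)" "(c\<^sup>2 - 1) ^ 4 = 12 * c - 15"
    by (simp_all add: numeral_eq_Suc algebra_simps c3)
  ultimately have "X = - (1 + c + c * c) / 4" "(c\<^sup>2 - 1) ^ 4 = 12 * c - 15" by simp_all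
  \<comment> \<open>The second factor is 4(c - 1), and (c - 1)(1 + c + c^2) = c^3 - 1 = 1.\<close>
  moreover have "- (1 + c + c * c) / 4 * ((1 / 3) * (12 * c - 15) + 1) = - 1" by (simp add: algebra_simps c3)
  ultimately have "X * ((1 / 3) * (c\<^sup>2 - 1) ^ 4 + 1) = - 1" by (simp only:)
  moreover have D: "(1 / 3) * (c\<^sup>2 - 1) ^ 4 + 1 > 0" by (simp add: add_nonneg_pos)
  ultimately have "X = - (1 / ((1 / 3) * (c\<^sup>2 - 1) ^ 4 + 1))" by (simp add: field_simps)
  thus "X = (- 1 / root 3 ((1 / 3) * (root 3 4 - 1) ^ 4 + 1)) ^ 3"
    unfolding d using D by (simp add: power_divide)
qed

section \<open>Values involving sqrt 5\<close>

lemma sqrt5_less: "sqrt 5 < 2237 / 1000"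
  by (rule real_less_lsqrt) (auto simp: power2_eq_square)

text \<open>Excludes the spurious quintic factor. After u = (z + 23)/20 and scaling by 20^5, minus
  the polynomial has only positive coefficients in z. The tightest is the constant one, which is why
  sqrt 5 < 2237/1000 is needed.\<close>

lemma quintic_factor_neg:
  fixes u :: real
  assumes "u > 23 / 20"
  defines "r \<equiv> sqrt 5"
  shows "- 27 + (27 - 18 * r) * u + (27 * r - 63) * u\<^sup>2 + (99 - 3 * r) * u ^ 3 + (3 * r - 48) * u ^ 4 - 5 * r * u ^ 5 < 0"
    (is "?P < 0")
proof -
  have r: "r < 2237 / 1000" "r > 0"
    using sqrt5_less by (simp_all add: r_def)
  define z where "z = 20 * u - 23"
  have z: "z > 0" using assms(1) by (simp add: z_def)
  define c where "c = 40490160 - 18032345 * r"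
  define d where "d = 2740080 - 1075655 * r"
  have z2: "(z + 23)\<^sup>2 = z\<^sup>2 + 46 * z + 529"
    by (simp add: power2_eq_square algebra_simps)
  have z3: "(z + 23) ^ 3 = z ^ 3 + 69 * z\<^sup>2 + 1587 * z + 12167"
    by (simp add: power2_eq_square power3_eq_cube algebra_simps)
  have "(z + 23) ^ 4 = (z + 23) ^ 3 * (z + 23)" by (simp add: numeral_eq_Suc)
  hence z4: "(z + 23) ^ 4 = z ^ 4 + 92 * z ^ 3 + 3174 * z\<^sup>2 + 48668 * z + 279841"
    unfolding z3 by (simp add: algebra_simps numeral_eq_Suc)
  have "(z + 23) ^ 5 = (z + 23) ^ 4 * (z + 23)" by (simp add: numeral_eq_Suc)
  hence z5: "(z + 23) ^ 5 = z ^ 5 + 115 * z ^ 4 + 5290 * z ^ 3 + 121670 * z\<^sup>2 + 1399205 * z + 6436343"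
    unfolding z4 by (simp add: algebra_simps numeral_eq_Suc)
  define P where "P = ?P"
  define W where "W = c + d * z + (818640 + 284710 * r) * z\<^sup>2 + (48720 + 22130 * r) * z ^ 3
       + (960 + 515 * r) * z ^ 4 + 5 * r * z ^ 5"
  have "3200000 * P = - 86400000 + (4320000 - 2880000 * r) * (20 * u) + (216000 * r - 504000) * (20 * u)\<^sup>2
     + (39600 - 1200 * r) * (20 * u) ^ 3 + (60 * r - 960) * (20 * u) ^ 4 - 5 * r * (20 * u) ^ 5"
    unfolding P_def by (simp add: power_mult_distrib algebra_simps)
  also have "20 * u = z + 23" by (simp add: z_def)
  also have "- 86400000 + (4320000 - 2880000 * r) * (z + 23) + (216000 * r - 504000) * (z + 23)\<^sup>2
     + (39600 - 1200 * r) * (z + 23) ^ 3 + (60 * r - 960) * (z + 23) ^ 4 - 5 * r * (z + 23) ^ 5 = - W"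
    unfolding W_def c_def d_def z2 z3 z4 z5 by (simp add: algebra_simps)
  finally have "3200000 * P = - W" .
  moreover have "c > 0" "d > 0" using r by (simp_all add: c_def d_def)
  hence "W > 0" unfolding W_def
    using r z by (intro add_pos_pos mult_pos_pos) auto
  ultimately have "P < 0" by linarith
  thus ?thesis by (simp only: P_def)
qed

lemma
  shows cubic_cf_sqrt5: "cubic_cf (nome (sqrt 5)) = (3 - sqrt 5) * (sqrt 3 - sqrt 5) / 4"
    and cubic_cf_inv_sqrt5: "cubic_cf (nome (1 / sqrt 5)) = (sqrt 3 + sqrt 5) * (sqrt 5 - 3) / 4"
proof -
  define r where "r = sqrt 5"
  have r: "r * r = 5" "r > 2" "r < 2237 / 1000"
    using sqrt5_less by (auto simp: r_def intro!: real_less_rsqrt)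
  define v w where "v = cubic_cf (nome r)" and "w = cubic_cf (nome (1 / r))"
  define u where "u = 1 - 2 * v"
  \<comment> \<open>One base for all nomes: the parameters 1/r, 3/r, r and 3r are the powers 3, 9,
    15 and 45 of \<open>h\<close>, because 5/r = r.\<close>
  define h where "h = nome (1 / (3 * r))"
  have h: "0 < h" "h < 1" using r by (auto simp: h_def intro: nome_unit)
  have hp: "0 < h ^ n" "h ^ n < 1" if "n > 0" for n using power_unit_interval[OF h that] by auto
  have arg: "h ^ n = nome (real n * r / 15)" for n
  proof -
    have "real n * (1 / (3 * r)) = real n * r / 15" using r by (simp add: field_simps)
    thus ?thesis by (simp only: h_def nome_power)
  qed
  have inv: "1 / r = r / 5" using r by (simp add: field_simps)
  have n3: "nome (1 / r) = h ^ 3" unfolding arg inv by simp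
  have n15: "nome r = h ^ 15" unfolding arg by simp
  have neg: "v < 0" "w < 0" using r by (auto simp: v_def w_def intro!: cubic_cf_neg nome_unit)
  have u1: "u > 1" using neg by (simp add: u_def)
  define a b c where "a = qchi (h ^ 15)" and "b = qchi (h ^ 45)" and "c = qchi (h ^ 9)"
  define e where "e = qchi (h ^ 3)"
  have pos: "a > 0" "b > 0" "c > 0" "e > 0"
  proof -
    have "qchi (h ^ n) > 0" if "n > 0" for n using hp[OF that] by (rule qchi_pos)
    thus "a > 0" "b > 0" "c > 0" "e > 0" by (simp_all add: a_def b_def c_def e_def)
  qed
  have tpos: "theta (h ^ n) > 0" if "n > 0" for n using hp[OF that] by (rule theta_pos)
  have v: "v = - (h ^ 5 * a / b ^ 3)"
  proof -
    have "root 3 (h ^ 15) = h ^ 5" using odd_real_root_power_cancel[of 3 "h ^ 5"] by (simp flip: power_mult)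
    thus ?thesis using cubic_cf_qchi[OF hp, of 15] by (simp add: v_def n15 a_def b_def flip: power_mult)
  qed
  have w: "w = - (h * e / c ^ 3)"
  proof -
    have "root 3 (h ^ 3) = h" by (rule odd_real_root_power_cancel) simp
    thus ?thesis using cubic_cf_qchi[OF hp, of 3] by (simp add: w_def n3 e_def c_def flip: power_mult)
  qed
  have u: "u = theta (h ^ 5) / theta (h ^ 45)"
    using cubic_cf_of_cube[OF hp, of 5] by (simp add: u_def v_def n15 flip: power_mult)
  have w': "1 - 2 * w = theta h / theta (h ^ 9)"
    using cubic_cf_of_cube[OF h] by (simp add: w_def n3)
  have i1: "theta h = sqrt (3 * r) * theta (h ^ 45)"
  proof -
    have "theta (nome (3 * r)) = theta h / sqrt (3 * r)"
      using theta_nome_inversion[of "3 * r"] r by (simp add: h_def)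
    moreover have "nome (3 * r) = h ^ 45" unfolding arg by simp
    ultimately show ?thesis using r by simp
  qed
  have i2: "theta (h ^ 5) = sqrt (3 / r) * theta (h ^ 9)"
  proof -
    have "3 / r = real 9 * r / 15" "1 / (3 / r) = real 5 * r / 15" using r by (simp_all add: field_simps)
    hence "nome (3 / r) = h ^ 9" "nome (1 / (3 / r)) = h ^ 5" unfolding arg by (simp_all only:)
    moreover have "theta (nome (3 / r)) = theta (nome (1 / (3 / r))) / sqrt (3 / r)"
      using r by (intro theta_nome_inversion) simp
    ultimately have "theta (h ^ 9) = theta (h ^ 5) / sqrt (3 / r)" by (simp only:)
    thus ?thesis using r by simp
  qed
  have i3: "theta (h ^ 3) = sqrt r * theta (h ^ 15)"
  proof -
    have "theta (nome r) = theta (nome (1 / r)) / sqrt r" using r by (intro theta_nome_inversion) simp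
    thus ?thesis using r unfolding n3 n15 by simp
  qed
  have uw: "u * (1 - 2 * w) = 3"
  proof -
    have "u * (1 - 2 * w) = (sqrt (3 / r) * sqrt (3 * r)) * (theta (h ^ 9) / theta (h ^ 9)) * (theta (h ^ 45) / theta (h ^ 45))"
      unfolding u w' i1 i2 by simp
    also have "sqrt (3 / r) * sqrt (3 * r) = 3"
    proof -
      have "sqrt (3 / r) * sqrt (3 * r) = sqrt (3 / r * (3 * r))" by (rule real_sqrt_mult[symmetric])
      also have "3 / r * (3 * r) = 3\<^sup>2" using r by simp
      finally show ?thesis by simp
    qed
    finally show ?thesis using tpos[of 9] tpos[of 45] by simp
  qed
  have q1: "r - 1 = 4 * h ^ 3 * e / a ^ 5"
  proof -
    have "(theta (h ^ 3) / theta (h ^ 15))\<^sup>2 = 1 + 4 * h ^ 3 * e / a ^ 5"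
      using theta_quintic[OF hp, of 3] by (simp add: a_def e_def flip: power_mult)
    moreover have "(theta (h ^ 3) / theta (h ^ 15))\<^sup>2 = r"
      using i3 tpos[of 15] r by simp
    ultimately show ?thesis by simp
  qed
  have q2: "r * u\<^sup>2 / 3 - 1 = 4 * h ^ 9 * c / b ^ 5"
  proof -
    have 1: "(theta (h ^ 9) / theta (h ^ 45))\<^sup>2 = 1 + 4 * h ^ 9 * c / b ^ 5"
      using theta_quintic[OF hp, of 9] by (simp add: c_def b_def flip: power_mult)
    have "u\<^sup>2 = 3 / r * (theta (h ^ 9) / theta (h ^ 45))\<^sup>2"
      using r by (simp add: u i2 power_divide power_mult_distrib)
    hence 2: "r * u\<^sup>2 / 3 = (theta (h ^ 9) / theta (h ^ 45))\<^sup>2" using r by simp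
    show ?thesis unfolding 2 1 by simp
  qed
  define Y where "Y = r * u\<^sup>2 / 3 - 1"
  have "Y > 0" using q2 h pos by (simp add: Y_def)
  \<comment> \<open>\<open>Y > 0\<close> means r u^2 > 3, while 2.237 * 1.15^2 is still below
    3.\<close>
  have u_lower: "u > 23 / 20"
  proof (rule ccontr)
    assume "\<not> u > 23 / 20"
    hence "u\<^sup>2 \<le> (23 / 20)\<^sup>2" using u1 by (intro power_mono) auto
    hence "r * u\<^sup>2 \<le> 2237 / 1000 * (23 / 20)\<^sup>2" using r by (intro mult_mono) auto
    thus False using \<open>Y > 0\<close> by (simp add: Y_def power2_eq_square)
  qed
  \<comment> \<open>By \<open>cubic_cf_ge\<close>, u <= 1 + 4 h^5, and h^5 = exp(-pi r/3) <= exp(-2)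
    <= 1/5.\<close>
  have u_upper: "u < 2"
  proof -
    have "2 \<le> pi * (r / 3)"
    proof -
      have "3 * (2 / 3) \<le> pi * (r / 3)" using pi_gt3 r by (intro mult_mono) auto
      thus ?thesis by simp
    qed
    hence "exp 2 \<le> exp (pi * (r / 3))" by simp
    moreover have "5 \<le> exp (2 :: real)" using exp_lower_Taylor_quadratic[of 2] by simp
    ultimately have "5 \<le> exp (pi * (r / 3))" by linarith
    hence "inverse (exp (pi * (r / 3))) \<le> inverse 5" by (intro le_imp_inverse_le) auto
    hence "h ^ 5 \<le> 1 / 5" unfolding arg by (simp add: nome_def exp_minus)
    moreover have "root 3 (h ^ 15) = h ^ 5" using odd_real_root_power_cancel[of 3 "h ^ 5"] by (simp flip: power_mult)
    ultimately show ?thesis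
      using cubic_cf_ge[OF hp, of 15] by (simp add: u_def v_def n15)
  qed
  \<comment> \<open>The monomials match: (c/b^5)^3 * (e/c^3) = e/b^15 = (e/a^5) * (a/b^3)^5, and
    both sides carry h^28. Thus every value of \<open>qchi\<close> disappears.\<close>
  have rel: "Y ^ 3 * w = 16 * (r - 1) * v ^ 5"
  proof -
    have "Y ^ 3 = 64 * h ^ 27 * c ^ 3 / b ^ 15"
      unfolding Y_def q2 by (simp add: power_divide power_mult_distrib flip: power_mult)
    hence "Y ^ 3 * w = - (64 * (h ^ 27 * h) * e / b ^ 15)" unfolding w using pos by simp
    moreover have "v ^ 5 = - (h ^ 25 * a ^ 5 / b ^ 15)"
      unfolding v by (simp add: power_divide power_mult_distrib flip: power_mult)
    hence "16 * (r - 1) * v ^ 5 = - (64 * (h ^ 3 * h ^ 25) * e / b ^ 15)" unfolding q1 using pos by simp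
    moreover have "h ^ 27 * h = h ^ 3 * h ^ 25" by (simp flip: power_add power_Suc2)
    ultimately show ?thesis by simp
  qed
  have vu: "v = (1 - u) / 2" by (simp add: u_def)
  have wu: "u * w = (u - 3) / 2" using uw by (simp add: field_simps)
  have F0: "Y ^ 3 * (3 - u) - (r - 1) * u * (u - 1) ^ 5 = 0"
  proof -
    have "Y ^ 3 * (u * w) = 16 * (r - 1) * u * v ^ 5" using rel by (simp add: mult_ac)
    moreover have "((1 - u) / 2) ^ 5 = - ((u - 1) ^ 5 / 32)"
    proof -
      have "(1 - u) / 2 = - ((u - 1) / 2)" by (simp add: field_simps)
      moreover have "(- ((u - 1) / 2)) ^ 5 = - (((u - 1) / 2) ^ 5)" by (rule power_minus_odd) simp
      moreover have "((u - 1) / 2) ^ 5 = (u - 1) ^ 5 / 32" by (simp add: power_divide)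
      ultimately show ?thesis by (simp only:)
    qed
    ultimately have "Y ^ 3 * ((u - 3) / 2) = 16 * (r - 1) * u * - ((u - 1) ^ 5 / 32)"
      unfolding wu vu by (simp only:)
    moreover have "P * (3 - u) - S * u * T = (- 2) * (P * ((u - 3) / 2) - 16 * S * u * (- (T / 32)))" for P S T
      by (simp add: field_simps)
    ultimately show ?thesis by simp
  qed
  have Y27: "27 * Y ^ 3 = (r * u\<^sup>2 - 3) ^ 3"
  proof -
    have "Y = (r * u\<^sup>2 - 3) / 3" by (simp add: Y_def diff_divide_distrib)
    moreover have "27 * (X / 3) ^ 3 = X ^ 3" for X :: real by (simp add: power_divide)
    ultimately show ?thesis by (simp only:)
  qed
  have "(27 * P) * (3 - u) - 27 * W = 27 * (P * (3 - u) - W)" for P W by (simp add: algebra_simps)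
  from this[of "Y ^ 3" "(r - 1) * u * (u - 1) ^ 5"]
  have zero: "(r * u\<^sup>2 - 3) ^ 3 * (3 - u) - 27 * ((r - 1) * u * (u - 1) ^ 5) = 0"
    by (simp only: Y27 F0 mult_zero_right)
  define G where "G = - 27 + (27 - 18 * r) * u + (27 * r - 63) * u\<^sup>2 + (99 - 3 * r) * u ^ 3 + (3 * r - 48) * u ^ 4 - 5 * r * u ^ 5"
  \<comment> \<open>A factorisation over the field generated by sqrt 5. The constant term 3 of the
    quadratic reflects \<open>uw\<close>: its second root will be 1 - 2w.\<close>
  have "(r * u\<^sup>2 - 3) ^ 3 * (3 - u) - 27 * ((r - 1) * u * (u - 1) ^ 5) = (u\<^sup>2 - (3 * r - 3) * u + 3) * G"
  proof -
    have r2: "r * (r * z) = 5 * z" for z using r(1) by (simp add: mult.assoc[symmetric])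
    show ?thesis unfolding G_def by (simp add: algebra_simps numeral_eq_Suc r(1) r2)
  qed
  with zero have "(u\<^sup>2 - (3 * r - 3) * u + 3) * G = 0" by (simp only:)
  moreover have "G < 0"
    unfolding r_def G_def by (rule quintic_factor_neg[OF u_lower])
  hence "G \<noteq> 0" by simp
  ultimately have quad: "u\<^sup>2 - (3 * r - 3) * u + 3 = 0"
    by (simp only: mult_eq_0_iff simp_thms)
  define s where "s = sqrt 3"
  have s: "s * s = 3" by (simp add: s_def)
  have s_lower: "s > 17 / 10"
    unfolding s_def by (rule real_less_rsqrt) (simp add: power2_eq_square)
  define x1 x2 where "x1 = (3 * (r - 1) - s * (3 - r)) / 2" and "x2 = (3 * (r - 1) + s * (3 - r)) / 2"
  have rs: "r * (r * z) = 5 * z" "s * (s * z) = 3 * z" for z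
    using r(1) s by (simp_all add: mult.assoc[symmetric])
  have x12: "x1 * x2 = 3" "x1 + x2 = 3 * r - 3"
    unfolding x1_def x2_def by (simp_all add: field_simps r(1) s rs)
  have "(u - x1) * (u - x2) = u\<^sup>2 - (x1 + x2) * u + x1 * x2"
    by (simp add: algebra_simps power2_eq_square)
  hence "(u - x1) * (u - x2) = 0" unfolding x12 using quad by simp
  \<comment> \<open>Numerically x1 is about 1.19 and x2 about 2.52, so the bound u < 2 decides
    between them.\<close>
  moreover have "x2 > 2"
  proof -
    have "17 / 10 * (763 / 1000) \<le> s * (3 - r)" using r s_lower by (intro mult_mono) auto
    moreover have "r > 223 / 100" unfolding r_def by (rule real_less_rsqrt) (simp add: power2_eq_square)
    ultimately show ?thesis by (simp add: x2_def)
  qed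
  ultimately have ux: "u = x1" using u_upper by auto
  have "u * (1 - 2 * w) = u * x2" using uw x12(1) by (simp only: ux)
  hence "1 - 2 * w = x2" using u1 by simp
  hence "w = (1 - x2) / 2" by simp
  also have "\<dots> = (s + r) * (r - 3) / 4" unfolding x2_def by (simp add: field_simps r(1))
  finally show "cubic_cf (nome (1 / sqrt 5)) = (sqrt 3 + sqrt 5) * (sqrt 5 - 3) / 4"
    by (simp only: w_def r_def s_def)
  have "v = (1 - x1) / 2" by (simp only: vu ux)
  also have "\<dots> = (3 - r) * (s - r) / 4" unfolding x1_def by (simp add: field_simps r(1))
  finally show "cubic_cf (nome (sqrt 5)) = (3 - sqrt 5) * (sqrt 3 - sqrt 5) / 4"
    by (simp only: v_def r_def s_def)
qed

text \<open>Each value is asserted as a limit of convergents, so convergence is part of the claim;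
  \<open>V\<close>, being the \<open>lim\<close> of the same sequence, then takes this
  value.\<close>

theorem theorem5p6:
  shows "(V_conv (- exp (- pi * sqrt 5)) \<longlonglongrightarrow> (3 - sqrt 5) * (sqrt 3 - sqrt 5) / 4) \<and>
    (V_conv (- exp (- pi / sqrt 5)) \<longlonglongrightarrow> (sqrt 3 + sqrt 5) * (sqrt 5 - 3) / 4) \<and>
    (V_conv (- exp (- pi / sqrt 3)) \<longlonglongrightarrow> - 1 / root 3 4) \<and>
    (V_conv (- exp (- pi * sqrt 3)) \<longlonglongrightarrow> (1 - root 3 4) / (2 + root 3 4)) \<and>
    (V_conv (- exp (- pi / (3 * sqrt 3))) \<longlonglongrightarrow>
           - 1 / root 3 ((1/3) * (root 3 4 - 1) ^ 4 + 1)) \<and>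
    (V_conv (- exp (- pi)) \<longlonglongrightarrow> (1 - sqrt 3) / 2) \<and>
    (V_conv (- exp (- pi / 3)) \<longlonglongrightarrow> - 1 / root 3 (2 * (sqrt 3 - 1)))"
proof -
  have lim: "V_conv (- y) \<longlonglongrightarrow> L" if "y = nome a" "a > 0" "cubic_cf (nome a) = L" for y a L
    using V_conv_tendsto_cubic_cf[OF nome_unit[OF that(2)]] that by simp
  show ?thesis
    by (intro conjI lim[OF _ _ cubic_cf_sqrt5] lim[OF _ _ cubic_cf_inv_sqrt5] lim[OF _ _ cubic_cf_inv_sqrt3]
        lim[OF _ _ cubic_cf_sqrt3] lim[OF _ _ cubic_cf_inv_3_sqrt3] lim[OF _ _ cubic_cf_1] lim[OF _ _ cubic_cf_third])
       (simp_all add: nome_def)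
qed

end
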